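(* Let $T$ be a linear $\mathcal{V}\lambda$-theory and consider a model of $T$ on a $\mathcal{V}\text{-}\mathsf{Cat}_{\mathsf{sep}}$-enriched autonomous category $\mathcal{C}$. Then the model induces a $\mathcal{V}\text{-}\mathsf{Cat}_{\mathsf{sep}}$-enriched functor $\mathrm{Syn}(T)\to\mathcal{C}$ (sending each type $A$ to $\llbracket A\rrbracket$ and each morphism $[v]$ to $\llbracket v\rrbracket$) that strictly preserves the autonomous structure of $\mathrm{Syn}(T)$.
   Context: Standing assumptions on $\mathcal{V}$: commutative unital quantale (complete lattice with commutative associative $\otimes$ distributing over joins, unit $k$), integral ($k=\top$), continuous underlying lattice, with a fixed basis $B$ closed under finite joins and $\otimes$ and containing $k$ (here $y\ll x$ means: whenever $x\le\bigvee X$ there is finite $A\subseteq X$ with $y\le\bigvee A$; continuity: $x=\bigvee\{y\mid y\ll x\}$; basis: for each $x$, $B\cap\{y\mid y\ll x\}$ is directed with join $x$). A linear $\mathcal{V}\lambda$-theory $T=((G,\Sigma),Ax)$: linear $\lambda$-calculus with ground types $G$, types $A::=X\mid I\mid A\otimes A\mid A\multimap A$, operation symbols $f:A_1,\dots,A_n\to A$ in $\Sigma$, terms $f(v_1,\dots,v_n)$, variables, $\ast$, $v\ \mathtt{to}\ \ast.\,w$, $v\otimes w$, $\mathtt{pm}\ v\ \mathtt{to}\ x\otimes y.\,w$, $\lambda x:A.\,v$, $v\,w$ typed linearly (contexts combined by order-preserving shuffles); $Ax$ is a class of $\mathcal{V}$-equations-in-context $\Gamma\rhd v=_q w:A$ ($q\in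 B$). Theorems of $T$: the smallest class containing $Ax$ and the $\beta\eta$ and commuting-conversion equations of linear $\lambda$-calculus (each $v=w$ read as $v=_\top w$ and $w=_\top v$), closed under reflexivity $v=_\top v$, transitivity ($v=_q w, w=_r u\Rightarrow v=_{q\otimes r}u$), weakening ($r\le q$), the Archimedean rule (if $v=_r w$ for all $r\ll q$ then $v=_q w$), finite joins ($v=_{q_i}w$ for $i\le n$ gives $v=_{\bigvee q_i}w$, incl. $n=0$), compatibility of every term constructor and of substitution (labels combine by $\otimes$; $\lambda$ preserves the label), and context permutation. $\mathrm{Syn}(T)$: objects are types; for types $A,B$ take the terms $v$ with $x:A\rhd v:B$ and $a(v,w)=\bigvee\{q\mid x:A\rhd v=_q w:B$ is a theorem$\}$; identify $v,w$ when $a(v,w)\ge k$ and $a(w,v)\ge k$; the resulting separated $\mathcal{V}$-category of classes $[v]$ is the hom-object $\mathrm{Syn}(T)(A,B)$, with composition by substitution and identity $[x]$; its autonomous structure is given by the type constructors $\otimes$, $I$, $\multimap$. $\mathcal{V}$-categories: $(X,a)$ with $k\le a(x,x)$, $a(x,y)\otimes a(y,z)\le a(x,z)$; separated if the natural order ($x\le y$ iff $k\le a(x,y)$) is antisymmetric; $\mathcal{V}$-functors: $a(x,y)\le b(fx,fy)$. A $\mathcal{V}\text{-}\mathsf{Cat}_{\mathsf{sep}}$-enriched autonomous category is a symmetric monoidal closed category whose hom-sets are small separated $\mathcal{V}$-categories, with composition and the action of $\otimes$ on homs being $\mathcal{V}$-functors (w.r.t. the pointwise tensor of $\mathcal{V}$-categories),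 and with $-\otimes X\dashv X\multimap-$ an enriched adjunction (both functors act by $\mathcal{V}$-functors on homs and the currying bijections are $\mathcal{V}$-isomorphisms). A $\mathcal{V}\text{-}\mathsf{Cat}_{\mathsf{sep}}$-functor is a functor whose action on each hom is a $\mathcal{V}$-functor. A model of $T$ in such $\mathcal{C}$ is an assignment of objects to ground types and morphisms $\llbracket A_1\rrbracket\otimes\dots\otimes\llbracket A_n\rrbracket\to\llbracket A\rrbracket$ to operation symbols, extended to judgements by the standard interpretation of linear $\lambda$-calculus in autonomous categories, such that every axiom $\Gamma\rhd v=_q w:A$ satisfies $a(\llbracket\Gamma\rhd v:A\rrbracket,\llbracket\Gamma\rhd w:A\rrbracket)\ge q$. *)

theory Defs
  imports "HOL-Library.Multiset"
begin

section \<open>Quantales\<close>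

text \<open>
  The tensor of the quantale is \<open>*\<close> and its unit \<open>k\<close> is \<open>1\<close>. The quantale is fixed by the
  type; \<open>a \<le> b\<close> is the order of the underlying lattice.
\<close>

class integral_quantale = complete_lattice + comm_monoid_mult +
  assumes mult_Sup_distrib: "x * Sup S = Sup ((*) x ` S)"
    and one_eq_top: "1 = top"

definition (in complete_lattice) way_below :: "'a \<Rightarrow> 'a \<Rightarrow> bool"  (infix \<open>\<lless>\<close> 50) where
  "y \<lless> x \<longleftrightarrow> (\<forall>X. x \<le> Sup X \<longrightarrow> (\<exists>F. finite F \<and> F \<subseteq> X \<and> y \<le> Sup F))"

class continuous_quantale = integral_quantale +
  assumes Sup_way_below: "x = Sup {y. y \<lless> x}"

definition directed :: "'v::order set \<Rightarrow> bool" where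
  "directed D \<longleftrightarrow> D \<noteq> {} \<and> (\<forall>a\<in>D. \<forall>b\<in>D. \<exists>c\<in>D. a \<le> c \<and> b \<le> c)"

definition quantale_basis :: "'v::continuous_quantale set \<Rightarrow> bool" where
  "quantale_basis B \<longleftrightarrow>
     (\<forall>x. directed (B \<inter> {y. y \<lless> x}) \<and> Sup (B \<inter> {y. y \<lless> x}) = x) \<and>
     (\<forall>F. finite F \<and> F \<subseteq> B \<longrightarrow> Sup F \<in> B) \<and>
     (\<forall>a\<in>B. \<forall>b\<in>B. a * b \<in> B) \<and>
     1 \<in> B"


section \<open>Enriched autonomous categories\<close>

text \<open>
  A category enriched in separated \<open>\<V>\<close>-categories is given by a set of objects, a set of arrows
  with domain and codomain, identities, composition, and \<open>hdist C f g\<close>, the value \<open>a(f,g)\<close> of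
  the hom-object containing the parallel arrows \<open>f\<close> and \<open>g\<close>. Values of the operations on
  non-composable or non-parallel arguments are irrelevant.
\<close>

record ('o, 'm, 'v) ecat =
  Obj :: "'o set"
  Arr :: "'m set"
  Dom :: "'m \<Rightarrow> 'o"
  Cod :: "'m \<Rightarrow> 'o"
  ident :: "'o \<Rightarrow> 'm"
  comp :: "'m \<Rightarrow> 'm \<Rightarrow> 'm"  (infixr \<open>\<cdot>\<index>\<close> 65)
  hdist :: "'m \<Rightarrow> 'm \<Rightarrow> 'v"

definition hom :: "('o, 'm, 'v, 'z) ecat_scheme \<Rightarrow> 'o \<Rightarrow> 'o \<Rightarrow> 'm set" where
  "hom C X Y = {f \<in> Arr C. Dom C f = X \<and> Cod C f = Y}"

locale enriched_category =
  fixes C :: "('o, 'm, 'v::continuous_quantale, 'z) ecat_scheme" (structure)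
  assumes Dom_in_Obj: "f \<in> Arr C \<Longrightarrow> Dom C f \<in> Obj C"
    and Cod_in_Obj: "f \<in> Arr C \<Longrightarrow> Cod C f \<in> Obj C"
    and ident_hom: "X \<in> Obj C \<Longrightarrow> ident C X \<in> hom C X X"
    and comp_hom: "f \<in> hom C X Y \<Longrightarrow> g \<in> hom C Y Z \<Longrightarrow> g \<cdot> f \<in> hom C X Z"
    and comp_ident_left: "f \<in> hom C X Y \<Longrightarrow> ident C Y \<cdot> f = f"
    and comp_ident_right: "f \<in> hom C X Y \<Longrightarrow> f \<cdot> ident C X = f"
    and comp_assoc: "f \<in> hom C W X \<Longrightarrow> g \<in> hom C X Y \<Longrightarrow> h \<in> hom C Y Z \<Longrightarrow>
          (h \<cdot> g) \<cdot> f = h \<cdot> (g \<cdot> f)"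
    and hdist_refl: "f \<in> hom C X Y \<Longrightarrow> 1 \<le> hdist C f f"
    and hdist_trans: "f \<in> hom C X Y \<Longrightarrow> g \<in> hom C X Y \<Longrightarrow> h \<in> hom C X Y \<Longrightarrow>
          hdist C f g * hdist C g h \<le> hdist C f h"
    and hdist_separated: "f \<in> hom C X Y \<Longrightarrow> g \<in> hom C X Y \<Longrightarrow>
          1 \<le> hdist C f g \<Longrightarrow> 1 \<le> hdist C g f \<Longrightarrow> f = g"
    and hdist_comp: "f \<in> hom C X Y \<Longrightarrow> f' \<in> hom C X Y \<Longrightarrow> g \<in> hom C Y Z \<Longrightarrow> g' \<in> hom C Y Z \<Longrightarrow>
          hdist C g g' * hdist C f f' \<le> hdist C (g \<cdot> f) (g' \<cdot> f')"

text \<open>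
  Orientation of the structure maps: \<open>asc X Y Z : X \<otimes> (Y \<otimes> Z) \<rightarrow> (X \<otimes> Y) \<otimes> Z\<close>,
  \<open>lun X : I \<otimes> X \<rightarrow> X\<close>, \<open>run X : X \<otimes> I \<rightarrow> X\<close>, \<open>sw X Y : X \<otimes> Y \<rightarrow> Y \<otimes> X\<close>,
  \<open>app X Y : (X \<multimap> Y) \<otimes> X \<rightarrow> Y\<close>, and \<open>curry Z X Y\<close> maps arrows \<open>Z \<otimes> X \<rightarrow> Y\<close> to
  arrows \<open>Z \<rightarrow> (X \<multimap> Y)\<close>. The tensor is \<open>\<boxtimes>\<close> on objects and \<open>\<otimes>\<close> on arrows.
\<close>

record ('o, 'm, 'v) autcat = "('o, 'm, 'v) ecat" +
  tenO :: "'o \<Rightarrow> 'o \<Rightarrow> 'o"  (infixl \<open>\<boxtimes>\<index>\<close> 70)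
  tenM :: "'m \<Rightarrow> 'm \<Rightarrow> 'm"  (infixl \<open>\<otimes>\<index>\<close> 70)
  unitO :: 'o
  asc :: "'o \<Rightarrow> 'o \<Rightarrow> 'o \<Rightarrow> 'm"
  lun :: "'o \<Rightarrow> 'm"
  run :: "'o \<Rightarrow> 'm"
  sw :: "'o \<Rightarrow> 'o \<Rightarrow> 'm"
  ihom :: "'o \<Rightarrow> 'o \<Rightarrow> 'o"
  app :: "'o \<Rightarrow> 'o \<Rightarrow> 'm"
  curry :: "'o \<Rightarrow> 'o \<Rightarrow> 'o \<Rightarrow> 'm \<Rightarrow> 'm"

definition inverse_arrows :: "('o, 'm, 'v, 'z) ecat_scheme \<Rightarrow> 'm \<Rightarrow> 'm \<Rightarrow> bool" where
  "inverse_arrows C f g \<longleftrightarrow>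
     f \<in> hom C (Dom C f) (Cod C f) \<and> g \<in> hom C (Cod C f) (Dom C f) \<and>
     g \<cdot>\<^bsub>C\<^esub> f = ident C (Dom C f) \<and> f \<cdot>\<^bsub>C\<^esub> g = ident C (Cod C f)"

definition iso :: "('o, 'm, 'v, 'z) ecat_scheme \<Rightarrow> 'm \<Rightarrow> bool" where
  "iso C f \<longleftrightarrow> (\<exists>g. inverse_arrows C f g)"

definition inv_arrow :: "('o, 'm, 'v, 'z) ecat_scheme \<Rightarrow> 'm \<Rightarrow> 'm" where
  "inv_arrow C f = (THE g. inverse_arrows C f g)"

text \<open>The action of the right adjoint \<open>X \<multimap> -\<close> on an arrow.\<close>

definition ihomM :: "('o, 'm, 'v, 'z) autcat_scheme \<Rightarrow> 'o \<Rightarrow> 'm \<Rightarrow> 'm" where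
  "ihomM C X f =
     curry C (ihom C X (Dom C f)) X (Cod C f) (f \<cdot>\<^bsub>C\<^esub> app C X (Dom C f))"

locale enriched_autonomous_category = enriched_category C
  for C :: "('o, 'm, 'v::continuous_quantale, 'z) autcat_scheme" (structure) +
  assumes tenO_Obj: "X \<in> Obj C \<Longrightarrow> Y \<in> Obj C \<Longrightarrow> X \<boxtimes> Y \<in> Obj C"
    and unitO_Obj: "unitO C \<in> Obj C"
    and ihom_Obj: "X \<in> Obj C \<Longrightarrow> Y \<in> Obj C \<Longrightarrow> ihom C X Y \<in> Obj C"
    \<comment> \<open>the tensor is a bifunctor and acts on homs by \<open>\<V>\<close>-functors\<close>
    and tenM_hom: "f \<in> hom C X Y \<Longrightarrow> g \<in> hom C X' Y' \<Longrightarrow> f \<otimes> g \<in> hom C (X \<boxtimes> X') (Y \<boxtimes> Y')"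
    and tenM_ident: "X \<in> Obj C \<Longrightarrow> Y \<in> Obj C \<Longrightarrow> ident C X \<otimes> ident C Y = ident C (X \<boxtimes> Y)"
    and tenM_comp: "f \<in> hom C X Y \<Longrightarrow> g \<in> hom C Y Z \<Longrightarrow> f' \<in> hom C X' Y' \<Longrightarrow> g' \<in> hom C Y' Z' \<Longrightarrow>
          (g \<cdot> f) \<otimes> (g' \<cdot> f') = (g \<otimes> g') \<cdot> (f \<otimes> f')"
    and hdist_tenM: "f \<in> hom C X Y \<Longrightarrow> g \<in> hom C X Y \<Longrightarrow> f' \<in> hom C X' Y' \<Longrightarrow> g' \<in> hom C X' Y' \<Longrightarrow>
          hdist C f g * hdist C f' g' \<le> hdist C (f \<otimes> f') (g \<otimes> g')"
    \<comment> \<open>natural isomorphisms\<close>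
    and asc_hom: "X \<in> Obj C \<Longrightarrow> Y \<in> Obj C \<Longrightarrow> Z \<in> Obj C \<Longrightarrow>
          asc C X Y Z \<in> hom C (X \<boxtimes> (Y \<boxtimes> Z)) ((X \<boxtimes> Y) \<boxtimes> Z) \<and> iso C (asc C X Y Z)"
    and lun_hom: "X \<in> Obj C \<Longrightarrow> lun C X \<in> hom C (unitO C \<boxtimes> X) X \<and> iso C (lun C X)"
    and run_hom: "X \<in> Obj C \<Longrightarrow> run C X \<in> hom C (X \<boxtimes> unitO C) X \<and> iso C (run C X)"
    and sw_hom: "X \<in> Obj C \<Longrightarrow> Y \<in> Obj C \<Longrightarrow> sw C X Y \<in> hom C (X \<boxtimes> Y) (Y \<boxtimes> X)"
    and asc_natural: "f \<in> hom C X X' \<Longrightarrow> g \<in> hom C Y Y' \<Longrightarrow> h \<in> hom C Z Z' \<Longrightarrow>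
          asc C X' Y' Z' \<cdot> (f \<otimes> (g \<otimes> h)) = ((f \<otimes> g) \<otimes> h) \<cdot> asc C X Y Z"
    and lun_natural: "f \<in> hom C X Y \<Longrightarrow> lun C Y \<cdot> (ident C (unitO C) \<otimes> f) = f \<cdot> lun C X"
    and run_natural: "f \<in> hom C X Y \<Longrightarrow> run C Y \<cdot> (f \<otimes> ident C (unitO C)) = f \<cdot> run C X"
    and sw_natural: "f \<in> hom C X X' \<Longrightarrow> g \<in> hom C Y Y' \<Longrightarrow>
          sw C X' Y' \<cdot> (f \<otimes> g) = (g \<otimes> f) \<cdot> sw C X Y"
    \<comment> \<open>coherence\<close>
    and sw_sw: "X \<in> Obj C \<Longrightarrow> Y \<in> Obj C \<Longrightarrow> sw C Y X \<cdot> sw C X Y = ident C (X \<boxtimes> Y)"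
    and pentagon: "W \<in> Obj C \<Longrightarrow> X \<in> Obj C \<Longrightarrow> Y \<in> Obj C \<Longrightarrow> Z \<in> Obj C \<Longrightarrow>
          asc C (W \<boxtimes> X) Y Z \<cdot> asc C W X (Y \<boxtimes> Z) =
          (asc C W X Y \<otimes> ident C Z) \<cdot> asc C W (X \<boxtimes> Y) Z \<cdot> (ident C W \<otimes> asc C X Y Z)"
    and triangle: "X \<in> Obj C \<Longrightarrow> Y \<in> Obj C \<Longrightarrow>
          (run C X \<otimes> ident C Y) \<cdot> asc C X (unitO C) Y = ident C X \<otimes> lun C Y"
    and hexagon: "X \<in> Obj C \<Longrightarrow> Y \<in> Obj C \<Longrightarrow> Z \<in> Obj C \<Longrightarrow>
          asc C Z X Y \<cdot> sw C (X \<boxtimes> Y) Z \<cdot> asc C X Y Z =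
          (sw C X Z \<otimes> ident C Y) \<cdot> asc C X Z Y \<cdot> (ident C X \<otimes> sw C Y Z)"
    \<comment> \<open>the enriched adjunction between \<open>- \<otimes> X\<close> and \<open>X \<multimap> -\<close>\<close>
    and app_hom: "X \<in> Obj C \<Longrightarrow> Y \<in> Obj C \<Longrightarrow> app C X Y \<in> hom C (ihom C X Y \<boxtimes> X) Y"
    and curry_hom: "X \<in> Obj C \<Longrightarrow> Y \<in> Obj C \<Longrightarrow> Z \<in> Obj C \<Longrightarrow> m \<in> hom C (Z \<boxtimes> X) Y \<Longrightarrow>
          curry C Z X Y m \<in> hom C Z (ihom C X Y)"
    and app_curry: "X \<in> Obj C \<Longrightarrow> Y \<in> Obj C \<Longrightarrow> Z \<in> Obj C \<Longrightarrow> m \<in> hom C (Z \<boxtimes> X) Y \<Longrightarrow>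
          app C X Y \<cdot> (curry C Z X Y m \<otimes> ident C X) = m"
    and curry_app: "X \<in> Obj C \<Longrightarrow> Y \<in> Obj C \<Longrightarrow> Z \<in> Obj C \<Longrightarrow> h \<in> hom C Z (ihom C X Y) \<Longrightarrow>
          curry C Z X Y (app C X Y \<cdot> (h \<otimes> ident C X)) = h"
    and hdist_curry: "X \<in> Obj C \<Longrightarrow> Y \<in> Obj C \<Longrightarrow> Z \<in> Obj C \<Longrightarrow>
          m \<in> hom C (Z \<boxtimes> X) Y \<Longrightarrow> n \<in> hom C (Z \<boxtimes> X) Y \<Longrightarrow>
          hdist C (curry C Z X Y m) (curry C Z X Y n) = hdist C m n"
    and hdist_ihomM: "X \<in> Obj C \<Longrightarrow> f \<in> hom C Y Z \<Longrightarrow> g \<in> hom C Y Z \<Longrightarrow>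
          hdist C f g \<le> hdist C (ihomM C X f) (ihomM C X g)"

definition enriched_functor ::
    "('o, 'm, 'v::continuous_quantale, 'y) ecat_scheme \<Rightarrow> ('p, 'n, 'v, 'z) ecat_scheme
     \<Rightarrow> ('o \<Rightarrow> 'p) \<Rightarrow> ('m \<Rightarrow> 'n) \<Rightarrow> bool" where
  "enriched_functor C D Fo Fm \<longleftrightarrow>
     enriched_category C \<and> enriched_category D \<and>
     (\<forall>X\<in>Obj C. Fo X \<in> Obj D) \<and>
     (\<forall>X Y f. f \<in> hom C X Y \<longrightarrow> Fm f \<in> hom D (Fo X) (Fo Y)) \<and>
     (\<forall>X\<in>Obj C. Fm (ident C X) = ident D (Fo X)) \<and>
     (\<forall>X Y Z f g. f \<in> hom C X Y \<and> g \<in> hom C Y Z \<longrightarrow> Fm (g \<cdot>\<^bsub>C\<^esub> f) = Fm g \<cdot>\<^bsub>D\<^esub> Fm f) \<and>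
     (\<forall>X Y f g. f \<in> hom C X Y \<and> g \<in> hom C X Y \<longrightarrow> hdist C f g \<le> hdist D (Fm f) (Fm g))"

definition strictly_preserves_autonomous_structure ::
    "('o, 'm, 'v::continuous_quantale, 'y) autcat_scheme \<Rightarrow> ('p, 'n, 'v, 'z) autcat_scheme
     \<Rightarrow> ('o \<Rightarrow> 'p) \<Rightarrow> ('m \<Rightarrow> 'n) \<Rightarrow> bool" where
  "strictly_preserves_autonomous_structure C D Fo Fm \<longleftrightarrow>
     Fo (unitO C) = unitO D \<and>
     (\<forall>X\<in>Obj C. \<forall>Y\<in>Obj C. Fo (X \<boxtimes>\<^bsub>C\<^esub> Y) = Fo X \<boxtimes>\<^bsub>D\<^esub> Fo Y) \<and>
     (\<forall>X\<in>Obj C. \<forall>Y\<in>Obj C. Fo (ihom C X Y) = ihom D (Fo X) (Fo Y)) \<and>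
     (\<forall>f\<in>Arr C. \<forall>g\<in>Arr C. Fm (f \<otimes>\<^bsub>C\<^esub> g) = Fm f \<otimes>\<^bsub>D\<^esub> Fm g) \<and>
     (\<forall>X\<in>Obj C. \<forall>Y\<in>Obj C. \<forall>Z\<in>Obj C. Fm (asc C X Y Z) = asc D (Fo X) (Fo Y) (Fo Z)) \<and>
     (\<forall>X\<in>Obj C. Fm (lun C X) = lun D (Fo X)) \<and>
     (\<forall>X\<in>Obj C. Fm (run C X) = run D (Fo X)) \<and>
     (\<forall>X\<in>Obj C. \<forall>Y\<in>Obj C. Fm (sw C X Y) = sw D (Fo X) (Fo Y)) \<and>
     (\<forall>X\<in>Obj C. \<forall>Y\<in>Obj C. Fm (app C X Y) = app D (Fo X) (Fo Y)) \<and>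
     (\<forall>X\<in>Obj C. \<forall>Y\<in>Obj C. \<forall>Z\<in>Obj C. \<forall>m\<in>hom C (Z \<boxtimes>\<^bsub>C\<^esub> X) Y.
        Fm (curry C Z X Y m) = curry D (Fo Z) (Fo X) (Fo Y) (Fm m))"


section \<open>Linear lambda-calculus\<close>

datatype (groundtypes: 'g) ty =
    Ground 'g
  | Unit
  | Tensor "'g ty" "'g ty"
  | Lolli "'g ty" "'g ty"

text \<open>
  Terms are considered up to renaming of bound variables. They are represented in locally
  nameless style: \<open>Var x\<close> is a free variable with name \<open>x\<close>, \<open>Bnd i\<close> is a de Bruijn index for a
  bound variable. The constructors \<open>PM\<close> and \<open>Lam\<close> bind two variables and one variable in their
  last argument, respectively; in \<open>PM\<close> index 0 is the second of the two.
  The named notations of the calculus are recovered as \<open>pm v x y w\<close> and \<open>lam x A v\<close> below, and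
  all later definitions use only these and no index.
\<close>

type_synonym var = nat

datatype ('g, 'f) tm =
    Bnd nat
  | Var var
  | Op 'f "('g, 'f) tm list"
  | Star
  | ToStar "('g, 'f) tm" "('g, 'f) tm"
  | TPair "('g, 'f) tm" "('g, 'f) tm"
  | PM "('g, 'f) tm" "('g, 'f) tm"
  | Lam "'g ty" "('g, 'f) tm"
  | Ap "('g, 'f) tm" "('g, 'f) tm"

primrec close :: "nat \<Rightarrow> var \<Rightarrow> ('g, 'f) tm \<Rightarrow> ('g, 'f) tm" where
  "close k x (Bnd i) = Bnd i"
| "close k x (Var y) = (if y = x then Bnd k else Var y)"
| "close k x (Op f vs) = Op f (map (close k x) vs)"
| "close k x Star = Star"
| "close k x (ToStar v w) = ToStar (close k x v) (close k x w)"
| "close k x (TPair v w) = TPair (close k x v) (close k x w)"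
| "close k x (PM v w) = PM (close k x v) (close (k + 2) x w)"
| "close k x (Lam A v) = Lam A (close (k + 1) x v)"
| "close k x (Ap v w) = Ap (close k x v) (close k x w)"

definition lam :: "var \<Rightarrow> 'g ty \<Rightarrow> ('g, 'f) tm \<Rightarrow> ('g, 'f) tm" where
  "lam x A v = Lam A (close 0 x v)"

definition pm :: "('g, 'f) tm \<Rightarrow> var \<Rightarrow> var \<Rightarrow> ('g, 'f) tm \<Rightarrow> ('g, 'f) tm" where
  "pm v x y w = PM v (close 1 x (close 0 y w))"

text \<open>
  \<open>v[w/x]\<close> is capture-avoiding whenever \<open>w\<close> has no dangling index, which is the case for all
  typable terms.
\<close>

primrec subst :: "('g, 'f) tm \<Rightarrow> ('g, 'f) tm \<Rightarrow> var \<Rightarrow> ('g, 'f) tm"  (\<open>_[_'/'/_]\<close> [1000, 0, 0] 1000) where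
  "(Bnd i)[w//x] = Bnd i"
| "(Var y)[w//x] = (if y = x then w else Var y)"
| "(Op f vs)[w//x] = Op f (map (\<lambda>v. v[w//x]) vs)"
| "Star[w//x] = Star"
| "(ToStar u v)[w//x] = ToStar (u[w//x]) (v[w//x])"
| "(TPair u v)[w//x] = TPair (u[w//x]) (v[w//x])"
| "(PM u v)[w//x] = PM (u[w//x]) (v[w//x])"
| "(Lam A v)[w//x] = Lam A (v[w//x])"
| "(Ap u v)[w//x] = Ap (u[w//x]) (v[w//x])"

type_synonym 'g ctx = "(var \<times> 'g ty) list"

abbreviation vars :: "'g ctx \<Rightarrow> var set" where
  "vars \<Gamma> \<equiv> fst ` set \<Gamma>"

abbreviation nonrep :: "'g ctx \<Rightarrow> bool" where
  "nonrep \<Gamma> \<equiv> distinct (map fst \<Gamma>)"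

text \<open>\<open>Sf [\<Gamma>\<^sub>1, \<dots>, \<Gamma>\<^sub>n]\<close> is the set of order-preserving shuffles.\<close>

primrec Sf :: "'a list list \<Rightarrow> 'a list set" where
  "Sf [] = {[]}"
| "Sf (\<Gamma> # \<Gamma>s) = (\<Union>\<Delta>\<in>Sf \<Gamma>s. shuffles \<Gamma> \<Delta>)"

record ('g, 'f) signature =
  grounds :: "'g set"
  ops :: "'f set"
  args :: "'f \<Rightarrow> 'g ty list"
  res :: "'f \<Rightarrow> 'g ty"

definition types :: "('g, 'f, 'z) signature_scheme \<Rightarrow> 'g ty set" where
  "types S = {A. groundtypes A \<subseteq> grounds S}"

definition wf_signature :: "('g, 'f, 'z) signature_scheme \<Rightarrow> bool" where
  "wf_signature S \<longleftrightarrow> (\<forall>f\<in>ops S. set (args S f) \<subseteq> types S \<and> res S f \<in> types S)"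

inductive typed :: "('g, 'f, 'z) signature_scheme \<Rightarrow> 'g ctx \<Rightarrow> ('g, 'f) tm \<Rightarrow> 'g ty \<Rightarrow> bool"
  for S where
  op: "\<lbrakk>f \<in> ops S; length \<Gamma>s = length (args S f); length vs = length (args S f);
        \<forall>i < length (args S f). typed S (\<Gamma>s ! i) (vs ! i) (args S f ! i);
        E \<in> Sf \<Gamma>s; nonrep E\<rbrakk> \<Longrightarrow> typed S E (Op f vs) (res S f)"
| hyp: "A \<in> types S \<Longrightarrow> typed S [(x, A)] (Var x) A"
| unit_intro: "typed S [] Star Unit"
| unit_elim: "\<lbrakk>typed S \<Gamma> v Unit; typed S \<Delta> w A; E \<in> Sf [\<Gamma>, \<Delta>]; nonrep E\<rbrakk>
    \<Longrightarrow> typed S E (ToStar v w) A"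
| tensor_intro: "\<lbrakk>typed S \<Gamma> v A; typed S \<Delta> w B; E \<in> Sf [\<Gamma>, \<Delta>]; nonrep E\<rbrakk>
    \<Longrightarrow> typed S E (TPair v w) (Tensor A B)"
| tensor_elim: "\<lbrakk>typed S \<Gamma> v (Tensor A B); typed S (\<Delta> @ [(x, A), (y, B)]) w C;
        E \<in> Sf [\<Gamma>, \<Delta>]; nonrep E\<rbrakk>
    \<Longrightarrow> typed S E (pm v x y w) C"
| lolli_intro: "typed S (\<Gamma> @ [(x, A)]) v B \<Longrightarrow> typed S \<Gamma> (lam x A v) (Lolli A B)"
| lolli_elim: "\<lbrakk>typed S \<Gamma> v (Lolli A B); typed S \<Delta> w A; E \<in> Sf [\<Gamma>, \<Delta>]; nonrep E\<rbrakk>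
    \<Longrightarrow> typed S E (Ap v w) B"

text \<open>
  The equations of linear lambda-calculus. Bound names may be chosen freely, so they can be
  required to be fresh; \<open>y \<notin> vars \<Gamma>\<close> in \<open>beta_pm\<close> makes the iterated substitution agree with the
  simultaneous one.
\<close>

inductive lambda_eq ::
    "('g, 'f, 'z) signature_scheme \<Rightarrow> 'g ctx \<Rightarrow> ('g, 'f) tm \<Rightarrow> ('g, 'f) tm \<Rightarrow> 'g ty \<Rightarrow> bool"
  for S where
  beta_pm: "\<lbrakk>typed S \<Gamma> v A; typed S \<Delta> w B; typed S (\<Theta> @ [(x, A), (y, B)]) u C;
      E \<in> Sf [\<Gamma>, \<Delta>, \<Theta>]; nonrep E; y \<notin> vars \<Gamma>\<rbrakk>
    \<Longrightarrow> lambda_eq S E (pm (TPair v w) x y u) (u[v//x][w//y]) C"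
| eta_pm: "\<lbrakk>typed S \<Gamma> v (Tensor A B); typed S (\<Delta> @ [(z, Tensor A B)]) u C;
      E \<in> Sf [\<Gamma>, \<Delta>]; nonrep E; x \<noteq> y; x \<notin> vars \<Delta>; y \<notin> vars \<Delta>\<rbrakk>
    \<Longrightarrow> lambda_eq S E (pm v x y (u[TPair (Var x) (Var y)//z])) (u[v//z]) C"
| beta_unit: "typed S E v A \<Longrightarrow> lambda_eq S E (ToStar Star v) v A"
| eta_unit: "\<lbrakk>typed S \<Gamma> v Unit; typed S (\<Delta> @ [(z, Unit)]) w A; E \<in> Sf [\<Gamma>, \<Delta>]; nonrep E\<rbrakk>
    \<Longrightarrow> lambda_eq S E (ToStar v (w[Star//z])) (w[v//z]) A"
| beta_lam: "\<lbrakk>typed S (\<Gamma> @ [(x, A)]) v B; typed S \<Delta> w A; E \<in> Sf [\<Gamma>, \<Delta>]; nonrep E\<rbrakk>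
    \<Longrightarrow> lambda_eq S E (Ap (lam x A v) w) (v[w//x]) B"
| eta_lam: "\<lbrakk>typed S E v (Lolli A B); x \<notin> vars E\<rbrakk>
    \<Longrightarrow> lambda_eq S E (lam x A (Ap v (Var x))) v (Lolli A B)"
| comm_unit: "\<lbrakk>typed S \<Gamma> v Unit; typed S \<Delta> w A; typed S (\<Theta> @ [(z, A)]) u C;
      E \<in> Sf [\<Gamma>, \<Delta>, \<Theta>]; nonrep E\<rbrakk>
    \<Longrightarrow> lambda_eq S E (u[ToStar v w//z]) (ToStar v (u[w//z])) C"
| comm_pm: "\<lbrakk>typed S \<Gamma> v (Tensor A B); typed S (\<Delta> @ [(x, A), (y, B)]) w D;
      typed S (\<Theta> @ [(z, D)]) u C;
      E \<in> Sf [\<Gamma>, \<Delta>, \<Theta>]; nonrep E; x \<notin> vars \<Theta>; y \<notin> vars \<Theta>\<rbrakk>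
    \<Longrightarrow> lambda_eq S E (u[pm v x y w//z]) (pm v x y (u[w//z])) C"


section \<open>Linear V-lambda-theories\<close>

text \<open>The tuple \<open>(\<Gamma>, v, q, w, A)\<close> stands for the equation-in-context \<open>\<Gamma> \<rhd> v =\<^sub>q w : A\<close>.\<close>

record ('g, 'f, 'v) vtheory = "('g, 'f) signature" +
  Ax :: "('g ctx \<times> ('g, 'f) tm \<times> 'v \<times> ('g, 'f) tm \<times> 'g ty) set"

definition vlambda_theory ::
    "'v::continuous_quantale set \<Rightarrow> ('g, 'f, 'v) vtheory \<Rightarrow> bool" where
  "vlambda_theory B T \<longleftrightarrow> wf_signature T \<and>
     (\<forall>(\<Gamma>, v, q, w, A) \<in> Ax T. q \<in> B \<and> typed T \<Gamma> v A \<and> typed T \<Gamma> w A)"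

inductive vthm ::
    "'v::continuous_quantale set \<Rightarrow> ('g, 'f, 'v) vtheory \<Rightarrow>
     'g ctx \<Rightarrow> ('g, 'f) tm \<Rightarrow> 'v \<Rightarrow> ('g, 'f) tm \<Rightarrow> 'g ty \<Rightarrow> bool"
  for \<B> T where
  axm: "(\<Gamma>, v, q, w, A) \<in> Ax T \<Longrightarrow> vthm \<B> T \<Gamma> v q w A"
| eq_left: "lambda_eq T \<Gamma> v w A \<Longrightarrow> vthm \<B> T \<Gamma> v top w A"
| eq_right: "lambda_eq T \<Gamma> v w A \<Longrightarrow> vthm \<B> T \<Gamma> w top v A"
| refl: "typed T \<Gamma> v A \<Longrightarrow> vthm \<B> T \<Gamma> v top v A"
| trans: "\<lbrakk>vthm \<B> T \<Gamma> v q w A; vthm \<B> T \<Gamma> w r u A\<rbrakk> \<Longrightarrow> vthm \<B> T \<Gamma> v (q * r) u A"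
| weak: "\<lbrakk>vthm \<B> T \<Gamma> v q w A; r \<in> \<B>; r \<le> q\<rbrakk> \<Longrightarrow> vthm \<B> T \<Gamma> v r w A"
| arch: "\<lbrakk>typed T \<Gamma> v A; typed T \<Gamma> w A; q \<in> \<B>; \<forall>r\<in>\<B>. r \<lless> q \<longrightarrow> vthm \<B> T \<Gamma> v r w A\<rbrakk>
    \<Longrightarrow> vthm \<B> T \<Gamma> v q w A"
| join: "\<lbrakk>typed T \<Gamma> v A; typed T \<Gamma> w A; finite Q; \<forall>q\<in>Q. vthm \<B> T \<Gamma> v q w A\<rbrakk>
    \<Longrightarrow> vthm \<B> T \<Gamma> v (Sup Q) w A"
| op: "\<lbrakk>f \<in> ops T; length \<Gamma>s = length (args T f); length vs = length (args T f);
        length ws = length (args T f); length qs = length (args T f);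
        \<forall>i < length (args T f). vthm \<B> T (\<Gamma>s ! i) (vs ! i) (qs ! i) (ws ! i) (args T f ! i);
        E \<in> Sf \<Gamma>s; nonrep E\<rbrakk>
    \<Longrightarrow> vthm \<B> T E (Op f vs) (prod_list qs) (Op f ws) (res T f)"
| unit_elim: "\<lbrakk>vthm \<B> T \<Gamma> v q w Unit; vthm \<B> T \<Delta> v' r w' A; E \<in> Sf [\<Gamma>, \<Delta>]; nonrep E\<rbrakk>
    \<Longrightarrow> vthm \<B> T E (ToStar v v') (q * r) (ToStar w w') A"
| tensor_intro: "\<lbrakk>vthm \<B> T \<Gamma> v q w A; vthm \<B> T \<Delta> v' r w' B; E \<in> Sf [\<Gamma>, \<Delta>]; nonrep E\<rbrakk>
    \<Longrightarrow> vthm \<B> T E (TPair v v') (q * r) (TPair w w') (Tensor A B)"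
| tensor_elim: "\<lbrakk>vthm \<B> T \<Gamma> v q w (Tensor A B); vthm \<B> T (\<Delta> @ [(x, A), (y, B)]) v' r w' C;
        E \<in> Sf [\<Gamma>, \<Delta>]; nonrep E\<rbrakk>
    \<Longrightarrow> vthm \<B> T E (pm v x y v') (q * r) (pm w x y w') C"
| lolli_intro: "vthm \<B> T (\<Gamma> @ [(x, A)]) v q w B
    \<Longrightarrow> vthm \<B> T \<Gamma> (lam x A v) q (lam x A w) (Lolli A B)"
| lolli_elim: "\<lbrakk>vthm \<B> T \<Gamma> v q w (Lolli A B); vthm \<B> T \<Delta> v' r w' A; E \<in> Sf [\<Gamma>, \<Delta>]; nonrep E\<rbrakk>
    \<Longrightarrow> vthm \<B> T E (Ap v v') (q * r) (Ap w w') B"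
| subst: "\<lbrakk>vthm \<B> T (\<Gamma> @ [(x, A)]) v q w B; vthm \<B> T \<Delta> v' r w' A; nonrep (\<Gamma> @ \<Delta>)\<rbrakk>
    \<Longrightarrow> vthm \<B> T (\<Gamma> @ \<Delta>) (v[v'//x]) (q * r) (w[w'//x]) B"
| permute: "\<lbrakk>vthm \<B> T \<Gamma> v q w A; mset \<Delta> = mset \<Gamma>\<rbrakk> \<Longrightarrow> vthm \<B> T \<Delta> v q w A"


section \<open>The syntactic category\<close>

definition tdist ::
    "'v::continuous_quantale set \<Rightarrow> ('g, 'f, 'v) vtheory \<Rightarrow> 'g ctx \<Rightarrow> 'g ty
     \<Rightarrow> ('g, 'f) tm \<Rightarrow> ('g, 'f) tm \<Rightarrow> 'v" where
  "tdist \<B> T \<Gamma> A v w = Sup {q. vthm \<B> T \<Gamma> v q w A}"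

text \<open>
  The single variable of the contexts \<open>x : A\<close> is the name \<open>0\<close>. An arrow of the syntactic
  category from \<open>A\<close> to \<open>B\<close> is the triple of \<open>A\<close>, \<open>B\<close> and the equivalence class of a term; the
  operations are defined on representatives, of which they are independent. In the terms below the names \<open>1, 2, \<dots>\<close> serve as
  fresh variables.
\<close>

type_synonym ('g, 'f) synarr = "'g ty \<times> 'g ty \<times> ('g, 'f) tm set"

definition cls ::
    "'v::continuous_quantale set \<Rightarrow> ('g, 'f, 'v) vtheory \<Rightarrow> 'g ty \<Rightarrow> 'g ty
     \<Rightarrow> ('g, 'f) tm \<Rightarrow> ('g, 'f) synarr" where
  "cls \<B> T A B v = (A, B, {w. typed T [(0, A)] w B \<and>
      1 \<le> tdist \<B> T [(0, A)] B v w \<and> 1 \<le> tdist \<B> T [(0, A)] B w v})"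

definition rep :: "('g, 'f) synarr \<Rightarrow> ('g, 'f) tm" where
  "rep m = (SOME v. v \<in> snd (snd m))"

definition Syn ::
    "'v::continuous_quantale set \<Rightarrow> ('g, 'f, 'v) vtheory
     \<Rightarrow> ('g ty, ('g, 'f) synarr, 'v) autcat" where
  "Syn \<B> T =
     \<lparr> Obj = types T,
       Arr = {cls \<B> T A B v | A B v. A \<in> types T \<and> B \<in> types T \<and> typed T [(0, A)] v B},
       Dom = (\<lambda>(A, B, V). A),
       Cod = (\<lambda>(A, B, V). B),
       ident = (\<lambda>A. cls \<B> T A A (Var 0)),
       comp = (\<lambda>n m. cls \<B> T (fst m) (fst (snd n)) ((rep n)[rep m//0])),
       hdist = (\<lambda>m n. tdist \<B> T [(0, fst m)] (fst (snd m)) (rep m) (rep n)),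
       tenO = Tensor,
       tenM = (\<lambda>m n. cls \<B> T (Tensor (fst m) (fst n)) (Tensor (fst (snd m)) (fst (snd n)))
                 (pm (Var 0) 1 2 (TPair ((rep m)[Var 1//0]) ((rep n)[Var 2//0])))),
       unitO = Unit,
       asc = (\<lambda>A B C. cls \<B> T (Tensor A (Tensor B C)) (Tensor (Tensor A B) C)
                 (pm (Var 0) 1 2 (pm (Var 2) 3 4 (TPair (TPair (Var 1) (Var 3)) (Var 4))))),
       lun = (\<lambda>A. cls \<B> T (Tensor Unit A) A (pm (Var 0) 1 2 (ToStar (Var 1) (Var 2)))),
       run = (\<lambda>A. cls \<B> T (Tensor A Unit) A (pm (Var 0) 1 2 (ToStar (Var 2) (Var 1)))),
       sw = (\<lambda>A B. cls \<B> T (Tensor A B) (Tensor B A) (pm (Var 0) 1 2 (TPair (Var 2) (Var 1)))),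
       ihom = Lolli,
       app = (\<lambda>A B. cls \<B> T (Tensor (Lolli A B) A) B (pm (Var 0) 1 2 (Ap (Var 1) (Var 2)))),
       curry = (\<lambda>C A B m. cls \<B> T C (Lolli A B)
                 (lam 1 A ((rep m)[TPair (Var 0) (Var 1)//0]))) \<rparr>"


section \<open>Interpretation and models\<close>

text \<open>
  The \<open>n\<close>-fold tensor associates to the left: \<open>(\<dots>(X\<^sub>1 \<otimes> X\<^sub>2) \<otimes> \<dots>) \<otimes> X\<^sub>n\<close>, with the unit
  for \<open>n = 0\<close> and \<open>X\<^sub>1\<close> itself for \<open>n = 1\<close>.
\<close>

fun tens :: "('o, 'm, 'v, 'z) autcat_scheme \<Rightarrow> 'o list \<Rightarrow> 'o" where
  "tens C [] = unitO C"
| "tens C (X # Xs) = foldl (tenO C) X Xs"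

fun tensM :: "('o, 'm, 'v, 'z) autcat_scheme \<Rightarrow> 'm list \<Rightarrow> 'm" where
  "tensM C [] = ident C (unitO C)"
| "tensM C (f # fs) = foldl (tenM C) f fs"

text \<open>
  \<open>split2 C Xs Ys : \<Otimes>(Xs @ Ys) \<rightarrow> \<Otimes>Xs \<otimes> \<Otimes>Ys\<close>. The auxiliary function
  recurses on the last element of \<open>Ys\<close>, its second list being \<open>Ys\<close> reversed.
\<close>

fun split2_rev :: "('o, 'm, 'v, 'z) autcat_scheme \<Rightarrow> 'o list \<Rightarrow> 'o list \<Rightarrow> 'm" where
  "split2_rev C Xs [] = inv_arrow C (run C (tens C Xs))"
| "split2_rev C Xs [Y] = ident C (tens C Xs \<boxtimes>\<^bsub>C\<^esub> Y)"
| "split2_rev C Xs (Y # Y' # Ys) =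
     inv_arrow C (asc C (tens C Xs) (tens C (rev (Y' # Ys))) Y) \<cdot>\<^bsub>C\<^esub>
     (split2_rev C Xs (Y' # Ys) \<otimes>\<^bsub>C\<^esub> ident C Y)"

definition split2 :: "('o, 'm, 'v, 'z) autcat_scheme \<Rightarrow> 'o list \<Rightarrow> 'o list \<Rightarrow> 'm" where
  "split2 C Xs Ys = (if Xs = [] then inv_arrow C (lun C (tens C Ys)) else split2_rev C Xs (rev Ys))"

text \<open>
  \<open>split C [Xs\<^sub>1, \<dots>, Xs\<^sub>n] : \<Otimes>(Xs\<^sub>1 @ \<dots> @ Xs\<^sub>n) \<rightarrow> \<Otimes>Xs\<^sub>1 \<otimes> \<dots> \<otimes> \<Otimes>Xs\<^sub>n\<close>, with the recursion
  on the last block; \<open>joined\<close> is its inverse.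
\<close>

fun split_rev :: "('o, 'm, 'v, 'z) autcat_scheme \<Rightarrow> 'o list list \<Rightarrow> 'm" where
  "split_rev C [] = ident C (unitO C)"
| "split_rev C [Xs] = ident C (tens C Xs)"
| "split_rev C (Xs # Xs' # Xss) =
     (split_rev C (Xs' # Xss) \<otimes>\<^bsub>C\<^esub> ident C (tens C Xs)) \<cdot>\<^bsub>C\<^esub>
     split2 C (concat (rev (Xs' # Xss))) Xs"

definition split :: "('o, 'm, 'v, 'z) autcat_scheme \<Rightarrow> 'o list list \<Rightarrow> 'm" where
  "split C Xss = split_rev C (rev Xss)"

definition joined :: "('o, 'm, 'v, 'z) autcat_scheme \<Rightarrow> 'o list list \<Rightarrow> 'm" where
  "joined C Xss = inv_arrow C (split C Xss)"

text \<open>\<open>exch C P X Y R : \<Otimes>(P @ [X, Y] @ R) \<rightarrow> \<Otimes>(P @ [Y, X] @ R)\<close>.\<close>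

definition exch :: "('o, 'm, 'v, 'z) autcat_scheme \<Rightarrow> 'o list \<Rightarrow> 'o \<Rightarrow> 'o \<Rightarrow> 'o list \<Rightarrow> 'm" where
  "exch C P X Y R =
     joined C [P, [Y, X], R] \<cdot>\<^bsub>C\<^esub>
     ((ident C (tens C P) \<otimes>\<^bsub>C\<^esub> sw C X Y) \<otimes>\<^bsub>C\<^esub> ident C (tens C R)) \<cdot>\<^bsub>C\<^esub>
     split C [P, [X, Y], R]"

record ('g, 'f, 'o, 'm) assignment =
  gobj :: "'g \<Rightarrow> 'o"
  oarr :: "'f \<Rightarrow> 'm"

primrec tyO :: "('o, 'm, 'v, 'z) autcat_scheme \<Rightarrow> ('g, 'f, 'o, 'm) assignment \<Rightarrow> 'g ty \<Rightarrow> 'o" where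
  "tyO C M (Ground X) = gobj M X"
| "tyO C M Unit = unitO C"
| "tyO C M (Tensor A B) = tyO C M A \<boxtimes>\<^bsub>C\<^esub> tyO C M B"
| "tyO C M (Lolli A B) = ihom C (tyO C M A) (tyO C M B)"

abbreviation ctxOs ::
    "('o, 'm, 'v, 'z) autcat_scheme \<Rightarrow> ('g, 'f, 'o, 'm) assignment \<Rightarrow> 'g ctx \<Rightarrow> 'o list" where
  "ctxOs C M \<Gamma> \<equiv> map (\<lambda>(x, A). tyO C M A) \<Gamma>"

definition ctxO ::
    "('o, 'm, 'v, 'z) autcat_scheme \<Rightarrow> ('g, 'f, 'o, 'm) assignment \<Rightarrow> 'g ctx \<Rightarrow> 'o" where
  "ctxO C M \<Gamma> = tens C (ctxOs C M \<Gamma>)"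

text \<open>
  The shuffle morphism \<open>shuf C M P E \<Gamma> : \<lbrakk>P, E\<rbrakk> \<rightarrow> \<lbrakk>P, \<Gamma>\<rbrakk>\<close>, for \<open>\<Gamma>\<close> a permutation of the
  non-repetitive context \<open>E\<close>, is a composite of exchanges: the variables of \<open>\<Gamma>\<close> are brought to the
  front one after the other. Here \<open>to_front C M P E a R : \<lbrakk>P, E, a, R\<rbrakk> \<rightarrow> \<lbrakk>P, a, E, R\<rbrakk>\<close>.
\<close>

primrec to_front ::
    "('o, 'm, 'v, 'z) autcat_scheme \<Rightarrow> ('g, 'f, 'o, 'm) assignment
     \<Rightarrow> 'g ctx \<Rightarrow> 'g ctx \<Rightarrow> var \<times> 'g ty \<Rightarrow> 'g ctx \<Rightarrow> 'm" where
  "to_front C M P [] a R = ident C (ctxO C M (P @ [a] @ R))"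
| "to_front C M P (b # E) a R =
     exch C (ctxOs C M P) (tyO C M (snd b)) (tyO C M (snd a)) (ctxOs C M (E @ R)) \<cdot>\<^bsub>C\<^esub>
     to_front C M (P @ [b]) E a R"

primrec shuf ::
    "('o, 'm, 'v, 'z) autcat_scheme \<Rightarrow> ('g, 'f, 'o, 'm) assignment
     \<Rightarrow> 'g ctx \<Rightarrow> 'g ctx \<Rightarrow> 'g ctx \<Rightarrow> 'm" where
  "shuf C M P E [] = ident C (ctxO C M P)"
| "shuf C M P E (a # \<Gamma>) =
     shuf C M (P @ [a]) (remove1 a E) \<Gamma> \<cdot>\<^bsub>C\<^esub>
     to_front C M P (takeWhile (\<lambda>b. b \<noteq> a) E) a (tl (dropWhile (\<lambda>b. b \<noteq> a) E))"

text \<open>\<open>\<lbrakk>E\<rbrakk> \<rightarrow> \<lbrakk>\<Gamma>\<^sub>1\<rbrakk> \<otimes> \<dots> \<otimes> \<lbrakk>\<Gamma>\<^sub>n\<rbrakk>\<close> for a shuffle \<open>E \<in> Sf [\<Gamma>\<^sub>1, \<dots>, \<Gamma>\<^sub>n]\<close>.\<close>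

definition unshuffle ::
    "('o, 'm, 'v, 'z) autcat_scheme \<Rightarrow> ('g, 'f, 'o, 'm) assignment
     \<Rightarrow> 'g ctx \<Rightarrow> 'g ctx list \<Rightarrow> 'm" where
  "unshuffle C M E \<Gamma>s = split C (map (ctxOs C M) \<Gamma>s) \<cdot>\<^bsub>C\<^esub> shuf C M [] E (concat \<Gamma>s)"

text \<open>
  \<open>interp S C M \<Gamma> v A m\<close>: the derivation of \<open>\<Gamma> \<rhd> v : A\<close> is interpreted by \<open>m\<close>. Derivations are
  unique up to the names of bound variables, so \<open>m\<close> is determined by the judgement.
\<close>

inductive interp ::
    "('g, 'f, 's) signature_scheme \<Rightarrow> ('o, 'm, 'v, 'z) autcat_scheme \<Rightarrow> ('g, 'f, 'o, 'm) assignment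
     \<Rightarrow> 'g ctx \<Rightarrow> ('g, 'f) tm \<Rightarrow> 'g ty \<Rightarrow> 'm \<Rightarrow> bool"
  for S C M where
  op: "\<lbrakk>f \<in> ops S; length \<Gamma>s = length (args S f); length vs = length (args S f);
        length ms = length (args S f);
        \<forall>i < length (args S f). interp S C M (\<Gamma>s ! i) (vs ! i) (args S f ! i) (ms ! i);
        E \<in> Sf \<Gamma>s; nonrep E\<rbrakk>
    \<Longrightarrow> interp S C M E (Op f vs) (res S f)
          (oarr M f \<cdot>\<^bsub>C\<^esub> tensM C ms \<cdot>\<^bsub>C\<^esub> unshuffle C M E \<Gamma>s)"
| hyp: "A \<in> types S \<Longrightarrow> interp S C M [(x, A)] (Var x) A (ident C (tyO C M A))"
| unit_intro: "interp S C M [] Star Unit (ident C (unitO C))"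
| unit_elim: "\<lbrakk>interp S C M \<Gamma> v Unit m; interp S C M \<Delta> w A n; E \<in> Sf [\<Gamma>, \<Delta>]; nonrep E\<rbrakk>
    \<Longrightarrow> interp S C M E (ToStar v w) A
          (n \<cdot>\<^bsub>C\<^esub> lun C (ctxO C M \<Delta>) \<cdot>\<^bsub>C\<^esub> (m \<otimes>\<^bsub>C\<^esub> ident C (ctxO C M \<Delta>)) \<cdot>\<^bsub>C\<^esub>
           unshuffle C M E [\<Gamma>, \<Delta>])"
| tensor_intro: "\<lbrakk>interp S C M \<Gamma> v A m; interp S C M \<Delta> w B n; E \<in> Sf [\<Gamma>, \<Delta>]; nonrep E\<rbrakk>
    \<Longrightarrow> interp S C M E (TPair v w) (Tensor A B) ((m \<otimes>\<^bsub>C\<^esub> n) \<cdot>\<^bsub>C\<^esub> unshuffle C M E [\<Gamma>, \<Delta>])"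
| tensor_elim: "\<lbrakk>interp S C M \<Gamma> v (Tensor A B) m;
        interp S C M (\<Delta> @ [(x, A), (y, B)]) w D n; E \<in> Sf [\<Gamma>, \<Delta>]; nonrep E\<rbrakk>
    \<Longrightarrow> interp S C M E (pm v x y w) D
          (n \<cdot>\<^bsub>C\<^esub> joined C [ctxOs C M \<Delta>, [tyO C M A], [tyO C M B]] \<cdot>\<^bsub>C\<^esub>
           asc C (ctxO C M \<Delta>) (tyO C M A) (tyO C M B) \<cdot>\<^bsub>C\<^esub>
           sw C (tyO C M (Tensor A B)) (ctxO C M \<Delta>) \<cdot>\<^bsub>C\<^esub>
           (m \<otimes>\<^bsub>C\<^esub> ident C (ctxO C M \<Delta>)) \<cdot>\<^bsub>C\<^esub> unshuffle C M E [\<Gamma>, \<Delta>])"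
| lolli_intro: "interp S C M (\<Gamma> @ [(x, A)]) v B m
    \<Longrightarrow> interp S C M \<Gamma> (lam x A v) (Lolli A B)
          (curry C (ctxO C M \<Gamma>) (tyO C M A) (tyO C M B)
            (m \<cdot>\<^bsub>C\<^esub> joined C [ctxOs C M \<Gamma>, [tyO C M A]]))"
| lolli_elim: "\<lbrakk>interp S C M \<Gamma> v (Lolli A B) m; interp S C M \<Delta> w A n; E \<in> Sf [\<Gamma>, \<Delta>]; nonrep E\<rbrakk>
    \<Longrightarrow> interp S C M E (Ap v w) B
          (app C (tyO C M A) (tyO C M B) \<cdot>\<^bsub>C\<^esub> (m \<otimes>\<^bsub>C\<^esub> n) \<cdot>\<^bsub>C\<^esub> unshuffle C M E [\<Gamma>, \<Delta>])"

definition sem ::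
    "('g, 'f, 's) signature_scheme \<Rightarrow> ('o, 'm, 'v, 'z) autcat_scheme \<Rightarrow> ('g, 'f, 'o, 'm) assignment
     \<Rightarrow> 'g ctx \<Rightarrow> ('g, 'f) tm \<Rightarrow> 'g ty \<Rightarrow> 'm" where
  "sem S C M \<Gamma> v A = (THE m. interp S C M \<Gamma> v A m)"

definition model ::
    "('g, 'f, 'v) vtheory \<Rightarrow> ('o, 'm, 'v::continuous_quantale, 'z) autcat_scheme
     \<Rightarrow> ('g, 'f, 'o, 'm) assignment \<Rightarrow> bool" where
  "model T C M \<longleftrightarrow>
     (\<forall>X\<in>grounds T. gobj M X \<in> Obj C) \<and>
     (\<forall>f\<in>ops T. oarr M f \<in> hom C (tens C (map (tyO C M) (args T f))) (tyO C M (res T f))) \<and>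
     (\<forall>(\<Gamma>, v, q, w, A) \<in> Ax T. q \<le> hdist C (sem T C M \<Gamma> v A) (sem T C M \<Gamma> w A))"

end

theory Submission
  imports Defs
begin

text \<open>
  Syntactic equality is soundly interpreted because every typing rule acts on arrows by a
  \<open>\<V>\<close>-functorial operation; the work lies in the bookkeeping of contexts. Contexts are replaced by
  binary trees of named variables, and two symmetric monoidal structural arrows between trees with
  distinct leaves are equal: pulling one leaf \<open>X\<close> out of a tree \<open>a\<close> gives an isomorphism
  \<open>X \<otimes> (a - X) \<rightarrow> a\<close> natural in structural arrows, so coherence follows by induction on the number
  of leaves. Over trees closed under structural arrows, exchange is trivial and substitution becomes
  grafting, which turns each equation of the calculus into a short computation. The interpretation
  of judgements is then determined by its value on trees, and the functor sends \<open>[v]\<close> to it.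
\<close>


section \<open>Categorical preliminaries and unit coherence\<close>

text \<open>The obstacle is the form of \<open>interp\<close>: it works on ordered, left-nested
  contexts cut apart by explicit \<open>unshuffle\<close> arrows, while substitution and the
  commuting conversions yield contexts ordered and bracketed in other ways. Comparing these arrows
  calls for a uniqueness principle. Coherence fails for repeated objects, since
  \<open>sw C X X\<close> need not be an identity. Leaves therefore carry labels, here pairs of a
  name and a type, and linearity supplies the distinctness: a context lists each name once, and its
  names are exactly the free variables of the term. The same fact forces how a context splits
  between two subterms, which makes derivations determinate. A second obstacle is that
  \<open>typed\<close>, \<open>interp\<close> and \<open>vthm\<close> speak of chosen bound names,
  whereas \<open>PM\<close> and \<open>Lam\<close> contain none. The tree semantics asks its binder
  premises for all names outside a finite set; renaming, which leaves arrows unchanged, mediates in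
  both directions.\<close>

context enriched_category
begin

lemma hom_iff: "f \<in> hom C X Y \<longleftrightarrow> f \<in> Arr C \<and> Dom C f = X \<and> Cod C f = Y"
  by (simp add: hom_def)

lemma Dom_Obj [simp]: "f \<in> Arr C \<Longrightarrow> Dom C f \<in> Obj C"
  by (rule Dom_in_Obj)

lemma Cod_Obj [simp]: "f \<in> Arr C \<Longrightarrow> Cod C f \<in> Obj C"
  by (rule Cod_in_Obj)

lemma ident_arr [simp]:
  assumes "X \<in> Obj C"
  shows "ident C X \<in> Arr C" "Dom C (ident C X) = X" "Cod C (ident C X) = X"
  using ident_hom[OF assms] by (auto simp: hom_iff)

lemma comp_arr [simp]:
  assumes "f \<in> Arr C" "g \<in> Arr C" "Dom C g = Cod C f"
  shows "g \<cdot> f \<in> Arr C" "Dom C (g \<cdot> f) = Dom C f" "Cod C (g \<cdot> f) = Cod C g"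
  using comp_hom[of f "Dom C f" "Cod C f" g "Cod C g"] assms by (auto simp: hom_iff)

lemma comp_ident [simp]:
  "f \<in> Arr C \<Longrightarrow> Cod C f = Y \<Longrightarrow> ident C Y \<cdot> f = f"
  "f \<in> Arr C \<Longrightarrow> Dom C f = X \<Longrightarrow> f \<cdot> ident C X = f"
  using comp_ident_left[of f] comp_ident_right[of f] by (auto simp: hom_iff)

lemma assoc [simp]:
  "f \<in> Arr C \<Longrightarrow> g \<in> Arr C \<Longrightarrow> h \<in> Arr C \<Longrightarrow> Dom C g = Cod C f \<Longrightarrow> Dom C h = Cod C g \<Longrightarrow>
    (h \<cdot> g) \<cdot> f = h \<cdot> (g \<cdot> f)"
  using comp_assoc[of f _ _ g _ h] by (simp add: hom_iff)

text \<open>Composites are normalised to nest to the right, so an equation for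
  \<open>g \<cdot> f\<close> no longer matches once something stands to the right of
  \<open>f\<close>. This is its form for use in the middle of a composite.\<close>

lemma reassoc:
  assumes "g \<cdot> f = k" "f \<in> Arr C" "g \<in> Arr C" "Dom C g = Cod C f" "h \<in> Arr C" "Dom C f = Cod C h"
  shows "g \<cdot> (f \<cdot> h) = k \<cdot> h"
  using assms(1)[symmetric] assms(2-) by simp

lemma inverse_arrowsD:
  assumes "inverse_arrows C f g"
  shows "f \<in> Arr C" "g \<in> Arr C" "Dom C g = Cod C f" "Cod C g = Dom C f"
    "g \<cdot> f = ident C (Dom C f)" "f \<cdot> g = ident C (Cod C f)"
  using assms by (auto simp: inverse_arrows_def hom_iff)

lemma inverse_arrows_unique:
  assumes "inverse_arrows C f g" "inverse_arrows C f h"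
  shows "g = h"
proof -
  note G = inverse_arrowsD[OF assms(1)] and H = inverse_arrowsD[OF assms(2)]
  have "g = g \<cdot> (f \<cdot> h)"
    using G H by simp
  also have "\<dots> = (g \<cdot> f) \<cdot> h"
    by (rule assoc[symmetric]) (use G H in simp_all)
  also have "\<dots> = h"
    using G(5) H by simp
  finally show ?thesis .
qed

lemma inv_arrow_eq: "inverse_arrows C f g \<Longrightarrow> inv_arrow C f = g"
  unfolding inv_arrow_def by (rule the_equality) (auto intro: inverse_arrows_unique)

lemma inverse_inv_arrow: "iso C f \<Longrightarrow> inverse_arrows C f (inv_arrow C f)"
  unfolding iso_def using inv_arrow_eq by blast

lemma inv_arrow_simps [simp]:
  assumes "iso C f"
  shows "inv_arrow C f \<in> Arr C" "Dom C (inv_arrow C f) = Cod C f" "Cod C (inv_arrow C f) = Dom C f"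
    "inv_arrow C f \<cdot> f = ident C (Dom C f)" "f \<cdot> inv_arrow C f = ident C (Cod C f)"
  using inverse_arrowsD[OF inverse_inv_arrow[OF assms]] by auto

lemma iso_arr: "iso C f \<Longrightarrow> f \<in> Arr C"
  unfolding iso_def using inverse_arrowsD by blast

lemma inv_cancel [simp]:
  assumes "iso C f" "g \<in> Arr C"
  shows "Cod C g = Dom C f \<Longrightarrow> inv_arrow C f \<cdot> (f \<cdot> g) = g"
    and "Cod C g = Cod C f \<Longrightarrow> f \<cdot> (inv_arrow C f \<cdot> g) = g"
  using assms iso_arr[OF assms(1)]
  by (simp_all add: assoc[symmetric] del: assoc)

lemma inverse_arrows_sym: "inverse_arrows C f g \<Longrightarrow> inverse_arrows C g f"
  by (auto simp: inverse_arrows_def hom_iff)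

lemma iso_cancel_left:
  assumes "iso C f" "f \<cdot> g = f \<cdot> h" "g \<in> Arr C" "h \<in> Arr C" "Cod C g = Dom C f" "Cod C h = Dom C f"
  shows "g = h"
  using inv_cancel(1)[OF assms(1,3,5)] inv_cancel(1)[OF assms(1,4,6)] assms(2) by metis

lemma iso_cancel_right:
  assumes "iso C f" "g \<cdot> f = h \<cdot> f" "g \<in> Arr C" "h \<in> Arr C" "Dom C g = Cod C f" "Dom C h = Cod C f"
  shows "g = h"
proof -
  have "(g \<cdot> f) \<cdot> inv_arrow C f = (h \<cdot> f) \<cdot> inv_arrow C f"
    using assms(2) by simp
  then show ?thesis
    using assms(1,3-) iso_arr[OF assms(1)] by simp
qed

lemma iso_comp:
  assumes "iso C f" "iso C g" "Dom C g = Cod C f"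
  shows "iso C (g \<cdot> f)"
proof -
  note A = iso_arr[OF assms(1)] iso_arr[OF assms(2)]
  have "inverse_arrows C (g \<cdot> f) (inv_arrow C f \<cdot> inv_arrow C g)"
    using assms A by (simp add: inverse_arrows_def hom_iff)
  then show ?thesis by (auto simp: iso_def)
qed

lemma iso_ident: "X \<in> Obj C \<Longrightarrow> iso C (ident C X)"
  by (auto simp: iso_def inverse_arrows_def hom_iff intro!: exI[of _ "ident C X"])

end

section \<open>Calculation rules for the tensor, and Kelly's derivation of the remaining unit
  laws\<close>

context enriched_autonomous_category
begin

lemma obj_simps [simp]:
  "X \<in> Obj C \<Longrightarrow> Y \<in> Obj C \<Longrightarrow> X \<boxtimes> Y \<in> Obj C"
  "unitO C \<in> Obj C"
  "X \<in> Obj C \<Longrightarrow> Y \<in> Obj C \<Longrightarrow> ihom C X Y \<in> Obj C"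
  by (simp_all add: tenO_Obj unitO_Obj ihom_Obj)

lemma ten_arr [simp]:
  assumes "f \<in> Arr C" "g \<in> Arr C"
  shows "f \<otimes> g \<in> Arr C" "Dom C (f \<otimes> g) = Dom C f \<boxtimes> Dom C g" "Cod C (f \<otimes> g) = Cod C f \<boxtimes> Cod C g"
  using tenM_hom[of f _ _ g] assms by (auto simp: hom_iff)

lemma ten_ident [simp]:
  "X \<in> Obj C \<Longrightarrow> Y \<in> Obj C \<Longrightarrow> ident C X \<otimes> ident C Y = ident C (X \<boxtimes> Y)"
  by (rule tenM_ident)

lemma interchange [simp]:
  "f \<in> Arr C \<Longrightarrow> g \<in> Arr C \<Longrightarrow> f' \<in> Arr C \<Longrightarrow> g' \<in> Arr C \<Longrightarrow> Dom C g = Cod C f \<Longrightarrow>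
    Dom C g' = Cod C f' \<Longrightarrow> (g \<otimes> g') \<cdot> (f \<otimes> f') = (g \<cdot> f) \<otimes> (g' \<cdot> f')"
  using tenM_comp[of f _ _ g _ f' _ _ g'] by (auto simp: hom_iff)

lemma interchange_assoc [simp]:
  "f \<in> Arr C \<Longrightarrow> g \<in> Arr C \<Longrightarrow> f' \<in> Arr C \<Longrightarrow> g' \<in> Arr C \<Longrightarrow> h \<in> Arr C \<Longrightarrow>
    Dom C g = Cod C f \<Longrightarrow> Dom C g' = Cod C f' \<Longrightarrow> Cod C h = Dom C f \<boxtimes> Dom C f' \<Longrightarrow>
    (g \<otimes> g') \<cdot> ((f \<otimes> f') \<cdot> h) = ((g \<cdot> f) \<otimes> (g' \<cdot> f')) \<cdot> h"
  by (simp add: assoc[symmetric] del: assoc)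

lemma structure_arr [simp]:
  "X \<in> Obj C \<Longrightarrow> Y \<in> Obj C \<Longrightarrow> Z \<in> Obj C \<Longrightarrow> asc C X Y Z \<in> Arr C"
  "X \<in> Obj C \<Longrightarrow> Y \<in> Obj C \<Longrightarrow> Z \<in> Obj C \<Longrightarrow> Dom C (asc C X Y Z) = X \<boxtimes> (Y \<boxtimes> Z)"
  "X \<in> Obj C \<Longrightarrow> Y \<in> Obj C \<Longrightarrow> Z \<in> Obj C \<Longrightarrow> Cod C (asc C X Y Z) = (X \<boxtimes> Y) \<boxtimes> Z"
  "X \<in> Obj C \<Longrightarrow> Y \<in> Obj C \<Longrightarrow> Z \<in> Obj C \<Longrightarrow> iso C (asc C X Y Z)"
  "X \<in> Obj C \<Longrightarrow> lun C X \<in> Arr C"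
  "X \<in> Obj C \<Longrightarrow> Dom C (lun C X) = unitO C \<boxtimes> X"
  "X \<in> Obj C \<Longrightarrow> Cod C (lun C X) = X"
  "X \<in> Obj C \<Longrightarrow> iso C (lun C X)"
  "X \<in> Obj C \<Longrightarrow> run C X \<in> Arr C"
  "X \<in> Obj C \<Longrightarrow> Dom C (run C X) = X \<boxtimes> unitO C"
  "X \<in> Obj C \<Longrightarrow> Cod C (run C X) = X"
  "X \<in> Obj C \<Longrightarrow> iso C (run C X)"
  "X \<in> Obj C \<Longrightarrow> Y \<in> Obj C \<Longrightarrow> sw C X Y \<in> Arr C"
  "X \<in> Obj C \<Longrightarrow> Y \<in> Obj C \<Longrightarrow> Dom C (sw C X Y) = X \<boxtimes> Y"
  "X \<in> Obj C \<Longrightarrow> Y \<in> Obj C \<Longrightarrow> Cod C (sw C X Y) = Y \<boxtimes> X"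
  using asc_hom[of X Y Z] lun_hom[of X] run_hom[of X] sw_hom[of X Y] by (auto simp: hom_iff)

lemma sw_sw_simps [simp]:
  "X \<in> Obj C \<Longrightarrow> Y \<in> Obj C \<Longrightarrow> sw C Y X \<cdot> sw C X Y = ident C (X \<boxtimes> Y)"
  "X \<in> Obj C \<Longrightarrow> Y \<in> Obj C \<Longrightarrow> f \<in> Arr C \<Longrightarrow> Cod C f = X \<boxtimes> Y \<Longrightarrow> sw C Y X \<cdot> (sw C X Y \<cdot> f) = f"
proof -
  show 1: "sw C Y X \<cdot> sw C X Y = ident C (X \<boxtimes> Y)" if "X \<in> Obj C" "Y \<in> Obj C"
    using sw_sw that .
  show "sw C Y X \<cdot> (sw C X Y \<cdot> f) = f"
    if "X \<in> Obj C" "Y \<in> Obj C" "f \<in> Arr C" "Cod C f = X \<boxtimes> Y"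
    using reassoc[OF 1] that by simp
qed

lemma iso_sw [simp]: "X \<in> Obj C \<Longrightarrow> Y \<in> Obj C \<Longrightarrow> iso C (sw C X Y)"
  by (auto simp: iso_def inverse_arrows_def hom_iff intro!: exI[of _ "sw C Y X"])

lemma iso_ten:
  assumes "iso C f" "iso C g"
  shows "iso C (f \<otimes> g)"
proof -
  note A = iso_arr[OF assms(1)] iso_arr[OF assms(2)]
  have "inverse_arrows C (f \<otimes> g) (inv_arrow C f \<otimes> inv_arrow C g)"
    using assms A by (simp add: inverse_arrows_def hom_iff)
  then show ?thesis by (auto simp: iso_def)
qed

lemma asc_nat:
  "f \<in> Arr C \<Longrightarrow> g \<in> Arr C \<Longrightarrow> h \<in> Arr C \<Longrightarrow> X = Cod C f \<Longrightarrow> Y = Cod C g \<Longrightarrow> Z = Cod C h \<Longrightarrow>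
    asc C X Y Z \<cdot> (f \<otimes> (g \<otimes> h)) = ((f \<otimes> g) \<otimes> h) \<cdot> asc C (Dom C f) (Dom C g) (Dom C h)"
  using asc_natural[of f _ _ g _ _ h] by (simp add: hom_iff)

lemma asc_nat_assoc:
  "f \<in> Arr C \<Longrightarrow> g \<in> Arr C \<Longrightarrow> h \<in> Arr C \<Longrightarrow> X = Cod C f \<Longrightarrow> Y = Cod C g \<Longrightarrow> Z = Cod C h \<Longrightarrow>
    k \<in> Arr C \<Longrightarrow> Cod C k = Dom C f \<boxtimes> (Dom C g \<boxtimes> Dom C h) \<Longrightarrow>
    asc C X Y Z \<cdot> ((f \<otimes> (g \<otimes> h)) \<cdot> k) = ((f \<otimes> g) \<otimes> h) \<cdot> (asc C (Dom C f) (Dom C g) (Dom C h) \<cdot> k)"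
  using reassoc[OF asc_nat] by simp

lemma lun_nat:
  "f \<in> Arr C \<Longrightarrow> Y = Cod C f \<Longrightarrow> lun C Y \<cdot> (ident C (unitO C) \<otimes> f) = f \<cdot> lun C (Dom C f)"
  using lun_natural[of f] by (simp add: hom_iff)

lemma run_nat:
  "f \<in> Arr C \<Longrightarrow> Y = Cod C f \<Longrightarrow> run C Y \<cdot> (f \<otimes> ident C (unitO C)) = f \<cdot> run C (Dom C f)"
  using run_natural[of f] by (simp add: hom_iff)

lemma sw_nat:
  "f \<in> Arr C \<Longrightarrow> g \<in> Arr C \<Longrightarrow> X = Cod C f \<Longrightarrow> Y = Cod C g \<Longrightarrow>
    sw C X Y \<cdot> (f \<otimes> g) = (g \<otimes> f) \<cdot> sw C (Dom C f) (Dom C g)"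
  using sw_natural[of f _ _ g] by (simp add: hom_iff)

text \<open>\<open>lun\<close> is a natural isomorphism onto the identity, hence tensoring with the
  unit is faithful. The unit laws below are proved after such a tensoring, where pentagon, triangle
  and hexagon become available.\<close>

lemma unit_ten_cancel:
  assumes "ident C (unitO C) \<otimes> f = ident C (unitO C) \<otimes> g" "f \<in> Arr C" "g \<in> Arr C"
    "Dom C f = Dom C g" "Cod C f = Cod C g"
  shows "f = g"
proof (rule iso_cancel_right)
  show "iso C (lun C (Dom C f))" using assms by simp
  show "f \<cdot> lun C (Dom C f) = g \<cdot> lun C (Dom C f)"
    using lun_nat[OF assms(2) HOL.refl] lun_nat[OF assms(3) HOL.refl] assms by metis
qed (use assms in simp_all)

lemma ten_unit_cancel:
  assumes "f \<otimes> ident C (unitO C) = g \<otimes> ident C (unitO C)" "f \<in> Arr C" "g \<in> Arr C"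
    "Dom C f = Dom C g" "Cod C f = Cod C g"
  shows "f = g"
proof (rule iso_cancel_right)
  show "iso C (run C (Dom C f))" using assms by simp
  show "f \<cdot> run C (Dom C f) = g \<cdot> run C (Dom C f)"
    using run_nat[OF assms(2) HOL.refl] run_nat[OF assms(3) HOL.refl] assms by metis
qed (use assms in simp_all)

text \<open>The pentagon with two leading units, rewritten by the triangle at both ends, is this law
  tensored with the unit on the left.\<close>

lemma lun_asc:
  assumes [simp]: "X \<in> Obj C" "Y \<in> Obj C"
  shows "(lun C X \<otimes> ident C Y) \<cdot> asc C (unitO C) X Y = lun C (X \<boxtimes> Y)"
proof (rule unit_ten_cancel)
  let ?I = "unitO C" and ?i = "ident C"
  have "asc C ?I X Y \<cdot> (?i ?I \<otimes> ((lun C X \<otimes> ?i Y) \<cdot> asc C ?I X Y)) =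
      asc C ?I X Y \<cdot> ((?i ?I \<otimes> (lun C X \<otimes> ?i Y)) \<cdot> (?i ?I \<otimes> asc C ?I X Y))"
    by simp
  also have "\<dots> = ((?i ?I \<otimes> lun C X) \<otimes> ?i Y) \<cdot> (asc C ?I (?I \<boxtimes> X) Y \<cdot> (?i ?I \<otimes> asc C ?I X Y))"
    by (subst asc_nat_assoc) simp_all
  also have "\<dots> = (((run C ?I \<otimes> ?i X) \<cdot> asc C ?I ?I X) \<otimes> ?i Y) \<cdot>
      (asc C ?I (?I \<boxtimes> X) Y \<cdot> (?i ?I \<otimes> asc C ?I X Y))"
    using triangle[of ?I X] by simp
  also have "\<dots> = ((run C ?I \<otimes> ?i X) \<otimes> ?i Y) \<cdot>
      ((asc C ?I ?I X \<otimes> ?i Y) \<cdot> (asc C ?I (?I \<boxtimes> X) Y \<cdot> (?i ?I \<otimes> asc C ?I X Y)))"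
    by simp
  also have "\<dots> = ((run C ?I \<otimes> ?i X) \<otimes> ?i Y) \<cdot> (asc C (?I \<boxtimes> ?I) X Y \<cdot> asc C ?I ?I (X \<boxtimes> Y))"
    by (subst pentagon) simp_all
  also have "\<dots> = asc C ?I X Y \<cdot> ((run C ?I \<otimes> ?i (X \<boxtimes> Y)) \<cdot> asc C ?I ?I (X \<boxtimes> Y))"
    using asc_nat_assoc[of "run C ?I" "?i X" "?i Y" ?I X Y "asc C ?I ?I (X \<boxtimes> Y)"] by simp
  also have "\<dots> = asc C ?I X Y \<cdot> (?i ?I \<otimes> lun C (X \<boxtimes> Y))"
    by (subst triangle) simp_all
  finally show "?i ?I \<otimes> ((lun C X \<otimes> ?i Y) \<cdot> asc C ?I X Y) = ?i ?I \<otimes> lun C (X \<boxtimes> Y)"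
    by (rule iso_cancel_left[rotated]) simp_all
qed simp_all

text \<open>Mirror image of \<open>lun_asc\<close>: the pentagon with two trailing units, compared
  after tensoring with the unit on the right.\<close>

lemma run_asc:
  assumes [simp]: "X \<in> Obj C" "Y \<in> Obj C"
  shows "run C (X \<boxtimes> Y) \<cdot> asc C X Y (unitO C) = ident C X \<otimes> run C Y"
proof (rule ten_unit_cancel)
  let ?I = "unitO C" and ?i = "ident C"
  let ?k = "asc C X (Y \<boxtimes> ?I) ?I \<cdot> (?i X \<otimes> asc C Y ?I ?I)"
  have "((run C (X \<boxtimes> Y) \<cdot> asc C X Y ?I) \<otimes> ?i ?I) \<cdot> ?k =
      (run C (X \<boxtimes> Y) \<otimes> ?i ?I) \<cdot> ((asc C X Y ?I \<otimes> ?i ?I) \<cdot> ?k)"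
    by simp
  also have "\<dots> = (run C (X \<boxtimes> Y) \<otimes> ?i ?I) \<cdot> (asc C (X \<boxtimes> Y) ?I ?I \<cdot> asc C X Y (?I \<boxtimes> ?I))"
    by (subst pentagon) simp_all
  also have "\<dots> = (?i (X \<boxtimes> Y) \<otimes> lun C ?I) \<cdot> asc C X Y (?I \<boxtimes> ?I)"
    by (subst reassoc[OF triangle]) simp_all
  also have "\<dots> = asc C X Y ?I \<cdot> (?i X \<otimes> (?i Y \<otimes> lun C ?I))"
    by (subst asc_nat) simp_all
  also have "\<dots> = asc C X Y ?I \<cdot> (?i X \<otimes> ((run C Y \<otimes> ?i ?I) \<cdot> asc C Y ?I ?I))"
    by (subst triangle) simp_all
  also have "\<dots> = asc C X Y ?I \<cdot> ((?i X \<otimes> (run C Y \<otimes> ?i ?I)) \<cdot> (?i X \<otimes> asc C Y ?I ?I))"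
    by simp
  also have "\<dots> = ((?i X \<otimes> run C Y) \<otimes> ?i ?I) \<cdot> ?k"
    by (subst asc_nat_assoc) simp_all
  finally show "(run C (X \<boxtimes> Y) \<cdot> asc C X Y ?I) \<otimes> ?i ?I = (?i X \<otimes> run C Y) \<otimes> ?i ?I"
    by (rule iso_cancel_right[rotated]) (simp_all add: iso_comp iso_ten iso_ident)
qed simp_all

text \<open>Naturality of \<open>lun\<close> at itself identifies
  \<open>lun C (I \<boxtimes> I)\<close> with \<open>ident C I \<otimes> lun C I\<close>, for the
  unit \<open>I\<close>; then \<open>lun_asc\<close> and the triangle have the same right-hand side
  and the associator is cancelled.\<close>

lemma lun_unit: "lun C (unitO C) = run C (unitO C)"
proof (rule ten_unit_cancel)
  let ?I = "unitO C" and ?i = "ident C"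
  have "lun C (?I \<boxtimes> ?I) = ?i ?I \<otimes> lun C ?I"
    by (rule iso_cancel_left[of "lun C ?I"]) (simp_all add: lun_nat)
  then have "(lun C ?I \<otimes> ?i ?I) \<cdot> asc C ?I ?I ?I = (run C ?I \<otimes> ?i ?I) \<cdot> asc C ?I ?I ?I"
    using lun_asc[of ?I ?I] triangle[of ?I ?I] by simp
  then show "lun C ?I \<otimes> ?i ?I = run C ?I \<otimes> ?i ?I"
    by (rule iso_cancel_right[rotated]) simp_all
qed simp_all

text \<open>The hexagon at two units and \<open>Z\<close>, tensored with the unit; the triangle,
  naturality of \<open>sw\<close> and \<open>lun_asc\<close> eliminate everything except the two
  unitors.\<close>

lemma run_sw:
  assumes [simp]: "Z \<in> Obj C"
  shows "run C Z \<cdot> sw C (unitO C) Z = lun C Z"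
proof (rule ten_unit_cancel)
  let ?I = "unitO C" and ?i = "ident C"
  let ?k = "asc C ?I Z ?I \<cdot> (?i ?I \<otimes> sw C ?I Z)"
  have "((run C Z \<cdot> sw C ?I Z) \<otimes> ?i ?I) \<cdot> ?k = (run C Z \<otimes> ?i ?I) \<cdot> ((sw C ?I Z \<otimes> ?i ?I) \<cdot> ?k)"
    by simp
  also have "\<dots> = (run C Z \<otimes> ?i ?I) \<cdot> (asc C Z ?I ?I \<cdot> (sw C (?I \<boxtimes> ?I) Z \<cdot> asc C ?I ?I Z))"
    by (subst hexagon) simp_all
  also have "\<dots> = (?i Z \<otimes> lun C ?I) \<cdot> (sw C (?I \<boxtimes> ?I) Z \<cdot> asc C ?I ?I Z)"
    by (subst reassoc[OF triangle]) simp_all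
  also have "\<dots> = sw C ?I Z \<cdot> ((lun C ?I \<otimes> ?i Z) \<cdot> asc C ?I ?I Z)"
    using reassoc[OF sw_nat[of "lun C ?I" "?i Z" ?I Z, symmetric]] reassoc[OF sw_nat[of "lun C ?I" "?i Z" ?I Z]]
    by simp
  also have "\<dots> = lun C (Z \<boxtimes> ?I) \<cdot> (?i ?I \<otimes> sw C ?I Z)"
    by (simp add: lun_asc lun_nat)
  also have "\<dots> = (lun C Z \<otimes> ?i ?I) \<cdot> ?k"
    using lun_asc[of Z ?I, symmetric] by simp
  finally show "(run C Z \<cdot> sw C ?I Z) \<otimes> ?i ?I = lun C Z \<otimes> ?i ?I"
    by (rule iso_cancel_right[rotated]) (simp_all add: iso_comp iso_ten iso_ident)
qed simp_all

lemma lun_sw: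
  assumes [simp]: "Z \<in> Obj C"
  shows "lun C Z \<cdot> sw C Z (unitO C) = run C Z"
  using run_sw[OF assms, symmetric] by simp

end


section \<open>Coherence for labelled trees\<close>

context enriched_autonomous_category
begin

text \<open>Moves \<open>X\<close> past \<open>Y\<close> while the bracketing stays to the right;
  this is how a leaf leaves the right child of a node.\<close>

definition past :: "'o \<Rightarrow> 'o \<Rightarrow> 'o \<Rightarrow> 'm" where
  "past X Y Z = inv_arrow C (asc C Y X Z) \<cdot> (sw C X Y \<otimes> ident C Z) \<cdot> asc C X Y Z"

lemma past_arr [simp]:
  assumes "X \<in> Obj C" "Y \<in> Obj C" "Z \<in> Obj C"
  shows "past X Y Z \<in> Arr C" "Dom C (past X Y Z) = X \<boxtimes> (Y \<boxtimes> Z)"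
    "Cod C (past X Y Z) = Y \<boxtimes> (X \<boxtimes> Z)"
  using assms by (simp_all add: past_def)

text \<open>Composing with the associator removes the inverse inside \<open>past\<close>. The
  naturality and reassociation laws of \<open>past\<close> are proved in this form and the
  associator is cancelled afterwards.\<close>

lemma asc_past:
  assumes "X \<in> Obj C" "Y \<in> Obj C" "Z \<in> Obj C"
  shows "asc C Y X Z \<cdot> past X Y Z = (sw C X Y \<otimes> ident C Z) \<cdot> asc C X Y Z"
  using assms by (simp add: past_def)

lemma past_nat_right:
  assumes "X \<in> Obj C" "Y \<in> Obj C" "f \<in> Arr C"
  shows "past X Y (Cod C f) \<cdot> (ident C X \<otimes> (ident C Y \<otimes> f)) =
    (ident C Y \<otimes> (ident C X \<otimes> f)) \<cdot> past X Y (Dom C f)"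
proof -
  let ?i = "ident C"
  let ?A = "asc C Y X (Cod C f)"
  have "?A \<cdot> (past X Y (Cod C f) \<cdot> (?i X \<otimes> (?i Y \<otimes> f))) =
      ((sw C X Y \<otimes> ?i (Cod C f)) \<cdot> asc C X Y (Cod C f)) \<cdot> (?i X \<otimes> (?i Y \<otimes> f))"
    by (subst reassoc[OF asc_past]) (use assms in simp_all)
  also have "\<dots> = (?i (Y \<boxtimes> X) \<otimes> f) \<cdot> ((sw C X Y \<otimes> ?i (Dom C f)) \<cdot> asc C X Y (Dom C f))"
    using assms by (simp add: asc_nat)
  also have "\<dots> = ((?i Y \<otimes> ?i X) \<otimes> f) \<cdot> (asc C Y X (Dom C f) \<cdot> past X Y (Dom C f))"
    using assms by (simp add: asc_past)
  also have "\<dots> = ?A \<cdot> ((?i Y \<otimes> (?i X \<otimes> f)) \<cdot> past X Y (Dom C f))"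
    by (subst asc_nat_assoc) (use assms in simp_all)
  finally show ?thesis
    by (rule iso_cancel_left[rotated]) (use assms in simp_all)
qed

lemma past_nat_middle:
  assumes "X \<in> Obj C" "f \<in> Arr C" "Z \<in> Obj C"
  shows "past X (Cod C f) Z \<cdot> (ident C X \<otimes> (f \<otimes> ident C Z)) =
    (f \<otimes> (ident C X \<otimes> ident C Z)) \<cdot> past X (Dom C f) Z"
proof -
  let ?i = "ident C"
  let ?A = "asc C (Cod C f) X Z"
  have "?A \<cdot> (past X (Cod C f) Z \<cdot> (?i X \<otimes> (f \<otimes> ?i Z))) =
      ((sw C X (Cod C f) \<otimes> ?i Z) \<cdot> asc C X (Cod C f) Z) \<cdot> (?i X \<otimes> (f \<otimes> ?i Z))"
    by (subst reassoc[OF asc_past]) (use assms in simp_all)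
  also have "\<dots> = ((f \<otimes> ?i X) \<otimes> ?i Z) \<cdot> ((sw C X (Dom C f) \<otimes> ?i Z) \<cdot> asc C X (Dom C f) Z)"
    using assms by (simp add: asc_nat sw_nat)
  also have "\<dots> = ((f \<otimes> ?i X) \<otimes> ?i Z) \<cdot> (asc C (Dom C f) X Z \<cdot> past X (Dom C f) Z)"
    using assms by (simp add: asc_past)
  also have "\<dots> = ?A \<cdot> ((f \<otimes> (?i X \<otimes> ?i Z)) \<cdot> past X (Dom C f) Z)"
    by (subst asc_nat_assoc) (use assms in \<open>simp_all del: ten_ident\<close>)
  finally show ?thesis
    by (rule iso_cancel_left[rotated]) (use assms in simp_all)
qed

text \<open>Two pentagons, one with \<open>Y\<close> before \<open>X\<close> and one with
  \<open>X\<close> before \<open>Y\<close>, joined by naturality of the associator. It serves the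
  case of a leaf pulled out of the middle factor of a reassociation.\<close>

lemma past_asc_middle:
  assumes [simp]: "X \<in> Obj C" "Y \<in> Obj C" "Z \<in> Obj C" "W \<in> Obj C"
  shows "asc C Y (X \<boxtimes> Z) W \<cdot> (ident C Y \<otimes> asc C X Z W) \<cdot> past X Y (Z \<boxtimes> W) =
    (past X Y Z \<otimes> ident C W) \<cdot> asc C X (Y \<boxtimes> Z) W \<cdot> (ident C X \<otimes> asc C Y Z W)"
proof -
  let ?i = "ident C"
  let ?A = "asc C Y X Z \<otimes> ?i W"
  have "?A \<cdot> (asc C Y (X \<boxtimes> Z) W \<cdot> (?i Y \<otimes> asc C X Z W) \<cdot> past X Y (Z \<boxtimes> W)) =
      (?A \<cdot> (asc C Y (X \<boxtimes> Z) W \<cdot> (?i Y \<otimes> asc C X Z W))) \<cdot> past X Y (Z \<boxtimes> W)"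
    by simp
  also have "\<dots> = asc C (Y \<boxtimes> X) Z W \<cdot> (asc C Y X (Z \<boxtimes> W) \<cdot> past X Y (Z \<boxtimes> W))"
    by (subst pentagon[symmetric]) simp_all
  also have "\<dots> = asc C (Y \<boxtimes> X) Z W \<cdot> ((sw C X Y \<otimes> (?i Z \<otimes> ?i W)) \<cdot> asc C X Y (Z \<boxtimes> W))"
    by (simp add: asc_past)
  also have "\<dots> = ((sw C X Y \<otimes> ?i Z) \<otimes> ?i W) \<cdot> (asc C (X \<boxtimes> Y) Z W \<cdot> asc C X Y (Z \<boxtimes> W))"
    by (subst asc_nat_assoc) simp_all
  also have "\<dots> = (((sw C X Y \<otimes> ?i Z) \<cdot> asc C X Y Z) \<otimes> ?i W) \<cdot>
      (asc C X (Y \<boxtimes> Z) W \<cdot> (?i X \<otimes> asc C Y Z W))"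
    by (subst pentagon) simp_all
  also have "\<dots> = ?A \<cdot> ((past X Y Z \<otimes> ?i W) \<cdot> asc C X (Y \<boxtimes> Z) W \<cdot> (?i X \<otimes> asc C Y Z W))"
    by (simp add: asc_past)
  finally show ?thesis
    by (rule iso_cancel_left[rotated]) (simp_all add: iso_ten iso_ident)
qed

text \<open>The hexagon solved for the switch with a product: passing \<open>Y \<boxtimes> Z\<close>
  means passing \<open>Y\<close> and then \<open>Z\<close>.\<close>

lemma sw_past:
  assumes [simp]: "X \<in> Obj C" "Y \<in> Obj C" "Z \<in> Obj C"
  shows "asc C Y Z X \<cdot> (ident C Y \<otimes> sw C X Z) \<cdot> past X Y Z = sw C X (Y \<boxtimes> Z)"
proof (rule iso_cancel_right)
  let ?i = "ident C"
  let ?k = "sw C (Y \<boxtimes> Z) X \<cdot> asc C Y Z X"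
  have "past X Y Z \<cdot> ?k =
      inv_arrow C (asc C Y X Z) \<cdot> ((sw C X Y \<otimes> ?i Z) \<cdot> (asc C X Y Z \<cdot> ?k))"
    by (simp add: past_def)
  also have "\<dots> = ?i Y \<otimes> sw C Z X"
    by (subst hexagon) simp_all
  finally show "(asc C Y Z X \<cdot> (ident C Y \<otimes> sw C X Z) \<cdot> past X Y Z) \<cdot> ?k = sw C X (Y \<boxtimes> Z) \<cdot> ?k"
    by simp
qed (simp_all add: iso_comp)

text \<open>Serves the case of a leaf pulled out of the last factor of a reassociation. The pentagon
  separates the two moves; \<open>past_asc_middle\<close> and \<open>sw_past\<close> merge them into
  a single move past \<open>Y \<boxtimes> Z\<close>.\<close>

lemma past_asc_right:
  assumes [simp]: "X \<in> Obj C" "Y \<in> Obj C" "Z \<in> Obj C" "W \<in> Obj C"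
  shows "asc C Y Z (X \<boxtimes> W) \<cdot> (ident C Y \<otimes> past X Z W) \<cdot> past X Y (Z \<boxtimes> W) =
    past X (Y \<boxtimes> Z) W \<cdot> (ident C X \<otimes> asc C Y Z W)"
proof -
  let ?i = "ident C"
  let ?A = "asc C (Y \<boxtimes> Z) X W"
  have "?A \<cdot> (asc C Y Z (X \<boxtimes> W) \<cdot> (?i Y \<otimes> past X Z W) \<cdot> past X Y (Z \<boxtimes> W)) =
      (?A \<cdot> asc C Y Z (X \<boxtimes> W)) \<cdot> ((?i Y \<otimes> past X Z W) \<cdot> past X Y (Z \<boxtimes> W))"
    by simp
  also have "\<dots> = (asc C Y Z X \<otimes> ?i W) \<cdot> asc C Y (Z \<boxtimes> X) W \<cdot>
      (?i Y \<otimes> (asc C Z X W \<cdot> past X Z W)) \<cdot> past X Y (Z \<boxtimes> W)"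
    by (subst pentagon) simp_all
  also have "\<dots> = (asc C Y Z X \<otimes> ?i W) \<cdot> (asc C Y (Z \<boxtimes> X) W \<cdot>
      ((?i Y \<otimes> (sw C X Z \<otimes> ?i W)) \<cdot> (?i Y \<otimes> asc C X Z W) \<cdot> past X Y (Z \<boxtimes> W)))"
    by (simp add: asc_past)
  also have "\<dots> = (asc C Y Z X \<otimes> ?i W) \<cdot> ((?i Y \<otimes> sw C X Z) \<otimes> ?i W) \<cdot>
      (asc C Y (X \<boxtimes> Z) W \<cdot> (?i Y \<otimes> asc C X Z W) \<cdot> past X Y (Z \<boxtimes> W))"
    by (subst asc_nat_assoc) simp_all
  also have "\<dots> = ((asc C Y Z X \<cdot> (?i Y \<otimes> sw C X Z) \<cdot> past X Y Z) \<otimes> ?i W) \<cdot>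
      (asc C X (Y \<boxtimes> Z) W \<cdot> (?i X \<otimes> asc C Y Z W))"
    by (simp add: past_asc_middle)
  also have "\<dots> = (sw C X (Y \<boxtimes> Z) \<otimes> ?i W) \<cdot> (asc C X (Y \<boxtimes> Z) W \<cdot> (?i X \<otimes> asc C Y Z W))"
    by (simp only: sw_past assms)
  also have "\<dots> = ?A \<cdot> (past X (Y \<boxtimes> Z) W \<cdot> (?i X \<otimes> asc C Y Z W))"
    by (subst reassoc[OF asc_past]) simp_all
  finally show ?thesis
    by (rule iso_cancel_left[rotated]) simp_all
qed

lemma lun_past:
  assumes [simp]: "X \<in> Obj C" "Z \<in> Obj C"
  shows "lun C (X \<boxtimes> Z) \<cdot> past X (unitO C) Z = ident C X \<otimes> lun C Z"
proof -
  let ?i = "ident C"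
  have "lun C (X \<boxtimes> Z) \<cdot> past X (unitO C) Z =
      (lun C X \<otimes> ?i Z) \<cdot> (asc C (unitO C) X Z \<cdot> past X (unitO C) Z)"
    by (simp add: lun_asc[symmetric])
  also have "\<dots> = (run C X \<otimes> ?i Z) \<cdot> asc C X (unitO C) Z"
    by (simp add: asc_past lun_sw)
  finally show ?thesis by (simp add: triangle)
qed

end


section \<open>Labelled trees and the structural arrows between them\<close>

datatype 'l tree = Leaf 'l | Empty | Node "'l tree" "'l tree"

primrec leaves :: "'l tree \<Rightarrow> 'l list" where
  "leaves (Leaf l) = [l]"
| "leaves Empty = []"
| "leaves (Node a b) = leaves a @ leaves b"

text \<open>The leaf turns into \<open>Empty\<close> instead of disappearing. The shape of the tree
  is kept, so a structural arrow restricts to the erased trees constructor by constructor.\<close>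

primrec erase :: "'l \<Rightarrow> 'l tree \<Rightarrow> 'l tree" where
  "erase l (Leaf k) = (if k = l then Empty else Leaf k)"
| "erase l Empty = Empty"
| "erase l (Node a b) = (if l \<in> set (leaves a) then Node (erase l a) b else Node a (erase l b))"

primrec graft :: "('l \<Rightarrow> 'l tree) \<Rightarrow> 'l tree \<Rightarrow> 'l tree" where
  "graft f (Leaf l) = f l"
| "graft f Empty = Empty"
| "graft f (Node a b) = Node (graft f a) (graft f b)"

lemma leaves_erase: "leaves (erase l a) = remove1 l (leaves a)"
  by (induction a) (auto simp: remove1_append)

text \<open>Different labels may denote the same object. Distinctness is demanded of labels, never
  of objects, since a switch of two equal objects is in general not an identity.\<close>

locale labelled_category = enriched_autonomous_category C
  for C :: "('o, 'm, 'v::continuous_quantale, 'z) autcat_scheme" (structure) +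
  fixes ob :: "'l \<Rightarrow> 'o"
begin

primrec tobj :: "'l tree \<Rightarrow> 'o" where
  "tobj (Leaf l) = ob l"
| "tobj Empty = unitO C"
| "tobj (Node a b) = tobj a \<boxtimes> tobj b"

definition wf_tree :: "'l tree \<Rightarrow> bool" where
  "wf_tree a \<longleftrightarrow> (\<forall>l\<in>set (leaves a). ob l \<in> Obj C)"

lemma wf_tree_simps [simp]:
  "wf_tree (Leaf l) \<longleftrightarrow> ob l \<in> Obj C" "wf_tree Empty"
  "wf_tree (Node a b) \<longleftrightarrow> wf_tree a \<and> wf_tree b"
  by (auto simp: wf_tree_def)

lemma tobj_Obj [simp]: "wf_tree a \<Longrightarrow> tobj a \<in> Obj C"
  by (induction a) auto

lemma wf_tree_erase [simp]: "wf_tree a \<Longrightarrow> wf_tree (erase l a)"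
  by (induction a) auto

lemma wf_treeD: "wf_tree a \<Longrightarrow> l \<in> set (leaves a) \<Longrightarrow> ob l \<in> Obj C"
  by (simp add: wf_tree_def)

text \<open>An arrow does not remember its bracketing, so the source and target trees are indices.
  Closure under inverses allows trees to be compared in either direction.\<close>

inductive struct :: "'l tree \<Rightarrow> 'l tree \<Rightarrow> 'm \<Rightarrow> bool" where
  struct_id: "wf_tree a \<Longrightarrow> struct a a (ident C (tobj a))"
| struct_comp: "struct a b m \<Longrightarrow> struct b c n \<Longrightarrow> struct a c (n \<cdot> m)"
| struct_ten: "struct a b m \<Longrightarrow> struct a' b' n \<Longrightarrow> struct (Node a a') (Node b b') (m \<otimes> n)"
| struct_asc: "wf_tree a \<Longrightarrow> wf_tree b \<Longrightarrow> wf_tree c \<Longrightarrow>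
    struct (Node a (Node b c)) (Node (Node a b) c) (asc C (tobj a) (tobj b) (tobj c))"
| struct_lun: "wf_tree a \<Longrightarrow> struct (Node Empty a) a (lun C (tobj a))"
| struct_run: "wf_tree a \<Longrightarrow> struct (Node a Empty) a (run C (tobj a))"
| struct_sw: "wf_tree a \<Longrightarrow> wf_tree b \<Longrightarrow> struct (Node a b) (Node b a) (sw C (tobj a) (tobj b))"
| struct_inverse: "struct a b m \<Longrightarrow> inverse_arrows C m n \<Longrightarrow> struct b a n"

lemma struct_props:
  assumes "struct a b m"
  shows "wf_tree a \<and> wf_tree b \<and> m \<in> Arr C \<and> Dom C m = tobj a \<and> Cod C m = tobj b \<and> iso C m \<and>
    mset (leaves a) = mset (leaves b)"
  using assms
proof (induction rule: struct.induct)
  case (struct_inverse a b m n)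
  then show ?case
    using inverse_arrowsD[OF struct_inverse.hyps(2)] inverse_arrows_sym[OF struct_inverse.hyps(2)]
    by (auto simp: iso_def)
qed (auto simp: iso_ident iso_comp iso_ten)

lemma struct_simps [simp]:
  assumes "struct a b m"
  shows "m \<in> Arr C" "Dom C m = tobj a" "Cod C m = tobj b" "iso C m"
  using struct_props[OF assms] by auto

lemma struct_wf:
  assumes "struct a b m"
  shows "wf_tree a" "wf_tree b"
  using struct_props[OF assms] by auto

lemma struct_mset: "struct a b m \<Longrightarrow> mset (leaves a) = mset (leaves b)"
  using struct_props by blast

lemma struct_set: "struct a b m \<Longrightarrow> set (leaves a) = set (leaves b)"
  using struct_mset mset_eq_setD by blast

lemma struct_inv: "struct a b m \<Longrightarrow> struct b a (inv_arrow C m)"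
  using struct_inverse inverse_inv_arrow struct_simps(4) by blast

text \<open>The source is \<open>ob l\<close> tensored with the object of \<open>erase l a\<close>.
  At the leaf itself the erased tree is the unit, hence \<open>run\<close>.\<close>

primrec pull :: "'l \<Rightarrow> 'l tree \<Rightarrow> 'm" where
  "pull l (Leaf k) = run C (ob k)"
| "pull l Empty = ident C (unitO C)"
| "pull l (Node a b) =
    (if l \<in> set (leaves a)
     then (pull l a \<otimes> ident C (tobj b)) \<cdot> asc C (ob l) (tobj (erase l a)) (tobj b)
     else (ident C (tobj a) \<otimes> pull l b) \<cdot> past (ob l) (tobj a) (tobj (erase l b)))"

lemma struct_past:
  assumes "wf_tree a" "wf_tree b" "wf_tree c"
  shows "struct (Node a (Node b c)) (Node b (Node a c)) (past (tobj a) (tobj b) (tobj c))"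
  unfolding past_def
  by (rule struct_comp[OF struct_comp[OF struct_asc struct_ten[OF struct_sw struct_id]]
        struct_inv[OF struct_asc]]) (use assms in auto)

lemma struct_pull:
  "wf_tree a \<Longrightarrow> l \<in> set (leaves a) \<Longrightarrow> struct (Node (Leaf l) (erase l a)) a (pull l a)"
proof (induction a)
  case (Leaf k)
  then show ?case using struct_run[of "Leaf k"] by simp
next
  case (Node a b)
  have l: "wf_tree (Leaf l)" using Node.prems wf_treeD[of "Node a b" l] by simp
  show ?case
  proof (cases "l \<in> set (leaves a)")
    case True
    have "struct (Node (Leaf l) (Node (erase l a) b)) (Node (Node (Leaf l) (erase l a)) b)
        (asc C (ob l) (tobj (erase l a)) (tobj b))"
      using struct_asc[OF l, of "erase l a" b] Node.prems by simp
    moreover have "struct (Node (Node (Leaf l) (erase l a)) b) (Node a b)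
        (pull l a \<otimes> ident C (tobj b))"
      using struct_ten[OF Node.IH(1) struct_id] True Node.prems by simp
    ultimately show ?thesis using True by (simp add: struct_comp)
  next
    case False
    have "struct (Node (Leaf l) (Node a (erase l b))) (Node a (Node (Leaf l) (erase l b)))
        (past (ob l) (tobj a) (tobj (erase l b)))"
      using struct_past[OF l, of a "erase l b"] Node.prems by simp
    moreover have "struct (Node a (Node (Leaf l) (erase l b))) (Node a b)
        (ident C (tobj a) \<otimes> pull l b)"
      using struct_ten[OF struct_id Node.IH(2)] False Node.prems by simp
    ultimately show ?thesis using False by (simp add: struct_comp)
  qed
qed simp

lemma pull_arr [simp]:
  assumes "wf_tree a" "l \<in> set (leaves a)"
  shows "pull l a \<in> Arr C" "Dom C (pull l a) = ob l \<boxtimes> tobj (erase l a)"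
    "Cod C (pull l a) = tobj a" "iso C (pull l a)"
  using struct_simps[OF struct_pull[OF assms]] by auto

text \<open>The hexagon, read as a law about \<open>past\<close>. A leaf in the right child is
  handled later by inverting this equation.\<close>

lemma struct_pull_sw:
  assumes "wf_tree a" "wf_tree b" "l \<in> set (leaves a)" "l \<notin> set (leaves b)"
  shows "sw C (tobj a) (tobj b) \<cdot> pull l (Node a b) =
    pull l (Node b a) \<cdot> (ident C (ob l) \<otimes> sw C (tobj (erase l a)) (tobj b))"
proof -
  have [simp]: "ob l \<in> Obj C" using assms wf_treeD by blast
  note [simp] = assms
  let ?a = "tobj (erase l a)" and ?b = "tobj b" and ?i = "ident C" and ?x = "ob l"
  have "sw C (tobj a) ?b \<cdot> pull l (Node a b) =
      (sw C (tobj a) ?b \<cdot> (pull l a \<otimes> ?i ?b)) \<cdot> asc C ?x ?a ?b"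
    by simp
  also have "\<dots> = (?i ?b \<otimes> pull l a) \<cdot> (sw C (?x \<boxtimes> ?a) ?b \<cdot> asc C ?x ?a ?b)"
    by (subst sw_nat) simp_all
  also have "sw C (?x \<boxtimes> ?a) ?b \<cdot> asc C ?x ?a ?b = past ?x ?b ?a \<cdot> (?i ?x \<otimes> sw C ?a ?b)"
    by (rule iso_cancel_left[of "asc C ?b ?x ?a"]) (simp_all add: hexagon reassoc[OF asc_past])
  finally show ?thesis by simp
qed

text \<open>Distinctness makes the occurrence of \<open>l\<close> unambiguous: with \<open>l\<close>
  in both children of a node, \<open>pull\<close> would select a different occurrence after a
  switch.\<close>

lemma struct_pull_nat:
  assumes "struct a b m" "distinct (leaves a)" "l \<in> set (leaves a)"
  shows "\<exists>m'. struct (erase l a) (erase l b) m' \<and>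
    m \<cdot> pull l a = pull l b \<cdot> (ident C (ob l) \<otimes> m')"
  using assms
proof (induction rule: struct.induct)
  case (struct_id a)
  then show ?case
    using struct.struct_id[of "erase l a"] wf_treeD[of a l]
    by (intro exI[of _ "ident C (tobj (erase l a))"]) simp
next
  case (struct_comp a b m c n)
  note eqs = struct_mset[OF struct_comp.hyps(1)] struct_mset[OF struct_comp.hyps(2)]
  note wf = struct_wf[OF struct_comp.hyps(1)] struct_wf[OF struct_comp.hyps(2)]
  have db: "distinct (leaves b)" "l \<in> set (leaves b)" "l \<in> set (leaves c)"
    using struct_comp.prems eqs mset_eq_setD[OF eqs(1)] mset_eq_setD[OF eqs(2)]
    by (auto dest: mset_eq_imp_distinct_iff)
  have ob: "ob l \<in> Obj C" using wf_treeD wf struct_comp.prems by blast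
  obtain m' n' where m': "struct (erase l a) (erase l b) m'"
      "m \<cdot> pull l a = pull l b \<cdot> (ident C (ob l) \<otimes> m')"
    and n': "struct (erase l b) (erase l c) n'"
      "n \<cdot> pull l b = pull l c \<cdot> (ident C (ob l) \<otimes> n')"
    using struct_comp.IH struct_comp.prems db by blast
  have "(n \<cdot> m) \<cdot> pull l a = (n \<cdot> pull l b) \<cdot> (ident C (ob l) \<otimes> m')"
    using struct_comp.hyps struct_comp.prems wf m' db ob by simp
  also have "\<dots> = pull l c \<cdot> (ident C (ob l) \<otimes> (n' \<cdot> m'))"
    using n' m'(1) wf db ob by simp
  finally show ?case using struct.struct_comp[OF m'(1) n'(1)] by blast
next
  case (struct_ten a b m a' b' n)
  note eqs = struct_set[OF struct_ten.hyps(1)] struct_set[OF struct_ten.hyps(2)]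
  note wf [simp] = struct_wf[OF struct_ten.hyps(1)] struct_wf[OF struct_ten.hyps(2)]
  note [simp] = struct_simps[OF struct_ten.hyps(1)] struct_simps[OF struct_ten.hyps(2)]
  have ob [simp]: "ob l \<in> Obj C" using wf_treeD[of "Node a a'"] wf struct_ten.prems by simp
  show ?case
  proof (cases "l \<in> set (leaves a)")
    case True
    then obtain m' where m': "struct (erase l a) (erase l b) m'"
      "m \<cdot> pull l a = pull l b \<cdot> (ident C (ob l) \<otimes> m')"
      using struct_ten.IH(1) struct_ten.prems by auto
    note [simp] = True True[unfolded eqs] struct_simps[OF m'(1)]
    have "(m \<otimes> n) \<cdot> pull l (Node a a') =
        ((pull l b \<otimes> ident C (tobj b')) \<cdot> ((ident C (ob l) \<otimes> m') \<otimes> n)) \<cdot>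
          asc C (ob l) (tobj (erase l a)) (tobj a')"
      by (simp add: m'(2))
    also have "\<dots> = pull l (Node b b') \<cdot> (ident C (ob l) \<otimes> (m' \<otimes> n))"
      by (simp add: asc_nat del: interchange interchange_assoc)
    finally show ?thesis using struct.struct_ten[OF m'(1) struct_ten.hyps(2)] by force
  next
    case False
    then have l: "l \<in> set (leaves a')" using struct_ten.prems by simp
    then obtain n' where n': "struct (erase l a') (erase l b') n'"
      "n \<cdot> pull l a' = pull l b' \<cdot> (ident C (ob l) \<otimes> n')"
      using struct_ten.IH(2) struct_ten.prems by auto
    note [simp] = False False[unfolded eqs] l l[unfolded eqs] struct_simps[OF n'(1)]
    have "(m \<otimes> n) \<cdot> pull l (Node a a') =
        (ident C (tobj b) \<otimes> pull l b') \<cdot> ((m \<otimes> (ident C (ob l) \<otimes> ident C (tobj (erase l b')))) \<cdot>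
         ((ident C (tobj a) \<otimes> (ident C (ob l) \<otimes> n')) \<cdot> past (ob l) (tobj a) (tobj (erase l a'))))"
      by (simp add: n'(2))
    also have "(ident C (tobj a) \<otimes> (ident C (ob l) \<otimes> n')) \<cdot> past (ob l) (tobj a) (tobj (erase l a')) =
        past (ob l) (tobj a) (tobj (erase l b')) \<cdot> (ident C (ob l) \<otimes> (ident C (tobj a) \<otimes> n'))"
      using past_nat_right[of "ob l" "tobj a" n'] by simp
    also have "(m \<otimes> (ident C (ob l) \<otimes> ident C (tobj (erase l b')))) \<cdot> \<dots> =
        past (ob l) (tobj b) (tobj (erase l b')) \<cdot> (ident C (ob l) \<otimes> (m \<otimes> n'))"
      using reassoc[OF past_nat_middle[of "ob l" m "tobj (erase l b')", symmetric],
          of "ident C (ob l) \<otimes> (ident C (tobj a) \<otimes> n')"] by (simp del: ten_ident)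
    also have "(ident C (tobj b) \<otimes> pull l b') \<cdot> \<dots> =
        pull l (Node b b') \<cdot> (ident C (ob l) \<otimes> (m \<otimes> n'))"
      by simp
    finally show ?thesis using struct.struct_ten[OF struct_ten.hyps(1) n'(1)] by force
  qed
next
  case (struct_asc a b c)
  note [simp] = struct_asc.hyps
  have ob [simp]: "ob l \<in> Obj C" using wf_treeD[of "Node a (Node b c)"] struct_asc.prems by simp
  \<comment> \<open>The three positions of the leaf correspond to \<open>pentagon\<close>,
    \<open>past_asc_middle\<close> and \<open>past_asc_right\<close>.\<close>
  consider "l \<in> set (leaves a)" | "l \<notin> set (leaves a)" "l \<in> set (leaves b)"
    | "l \<notin> set (leaves a)" "l \<notin> set (leaves b)" "l \<in> set (leaves c)"
    using struct_asc.prems by auto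
  then show ?case
  proof cases
    case 1
    let ?a = "tobj (erase l a)" and ?b = "tobj b" and ?c = "tobj c" and ?i = "ident C"
    note [simp] = 1
    have "asc C (tobj a) ?b ?c \<cdot> pull l (Node a (Node b c)) =
        asc C (tobj a) ?b ?c \<cdot> ((pull l a \<otimes> (?i ?b \<otimes> ?i ?c)) \<cdot> asc C (ob l) ?a (?b \<boxtimes> ?c))"
      by simp
    also have "\<dots> = ((pull l a \<otimes> ?i ?b) \<otimes> ?i ?c) \<cdot>
        (asc C (ob l \<boxtimes> ?a) ?b ?c \<cdot> asc C (ob l) ?a (?b \<boxtimes> ?c))"
      by (subst asc_nat_assoc) simp_all
    also have "\<dots> = pull l (Node (Node a b) c) \<cdot> (?i (ob l) \<otimes> asc C ?a ?b ?c)"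
      by (subst pentagon) simp_all
    finally show ?thesis
      using struct.struct_asc[of "erase l a" b c] by force
  next
    case 2
    let ?a = "tobj a" and ?b = "tobj (erase l b)" and ?c = "tobj c" and ?i = "ident C"
    note [simp] = 2
    have "asc C ?a (tobj b) ?c \<cdot> pull l (Node a (Node b c)) =
        asc C ?a (tobj b) ?c \<cdot> ((?i ?a \<otimes> (pull l b \<otimes> ?i ?c)) \<cdot>
          ((?i ?a \<otimes> asc C (ob l) ?b ?c) \<cdot> past (ob l) ?a (?b \<boxtimes> ?c)))"
      by simp
    also have "\<dots> = ((?i ?a \<otimes> pull l b) \<otimes> ?i ?c) \<cdot>
        (asc C ?a (ob l \<boxtimes> ?b) ?c \<cdot> (?i ?a \<otimes> asc C (ob l) ?b ?c) \<cdot> past (ob l) ?a (?b \<boxtimes> ?c))"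
      by (subst asc_nat_assoc) simp_all
    also have "\<dots> = pull l (Node (Node a b) c) \<cdot> (?i (ob l) \<otimes> asc C ?a ?b ?c)"
      by (subst past_asc_middle) simp_all
    finally show ?thesis
      using struct.struct_asc[of a "erase l b" c] by force
  next
    case 3
    let ?a = "tobj a" and ?b = "tobj b" and ?c = "tobj (erase l c)" and ?i = "ident C"
    note [simp] = 3
    have "asc C ?a ?b (tobj c) \<cdot> pull l (Node a (Node b c)) =
        asc C ?a ?b (tobj c) \<cdot> ((?i ?a \<otimes> (?i ?b \<otimes> pull l c)) \<cdot>
          ((?i ?a \<otimes> past (ob l) ?b ?c) \<cdot> past (ob l) ?a (?b \<boxtimes> ?c)))"
      by simp
    also have "\<dots> = ((?i ?a \<otimes> ?i ?b) \<otimes> pull l c) \<cdot>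
        (asc C ?a ?b (ob l \<boxtimes> ?c) \<cdot> (?i ?a \<otimes> past (ob l) ?b ?c) \<cdot> past (ob l) ?a (?b \<boxtimes> ?c))"
      by (subst asc_nat_assoc) simp_all
    also have "\<dots> = pull l (Node (Node a b) c) \<cdot> (?i (ob l) \<otimes> asc C ?a ?b ?c)"
      by (subst past_asc_right) simp_all
    finally show ?thesis
      using struct.struct_asc[of a b "erase l c"] by force
  qed
next
  case (struct_lun a)
  note [simp] = struct_lun.hyps
  have ob [simp]: "ob l \<in> Obj C" using wf_treeD[of a] struct_lun.prems by simp
  let ?i = "ident C" and ?a = "tobj (erase l a)"
  have "lun C (tobj a) \<cdot> pull l (Node Empty a) =
      (lun C (tobj a) \<cdot> (?i (unitO C) \<otimes> pull l a)) \<cdot> past (ob l) (unitO C) ?a"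
    using struct_lun.prems by simp
  also have "\<dots> = pull l a \<cdot> (?i (ob l) \<otimes> lun C ?a)"
    by (subst lun_nat) (use struct_lun.prems in \<open>simp_all add: lun_past\<close>)
  finally show ?case
    using struct.struct_lun[of "erase l a"] by force
next
  case (struct_run a)
  note [simp] = struct_run.hyps
  have ob [simp]: "ob l \<in> Obj C" using wf_treeD[of a] struct_run.prems by simp
  let ?i = "ident C" and ?a = "tobj (erase l a)"
  have "run C (tobj a) \<cdot> pull l (Node a Empty) =
      (run C (tobj a) \<cdot> (pull l a \<otimes> ?i (unitO C))) \<cdot> asc C (ob l) ?a (unitO C)"
    using struct_run.prems by simp
  also have "\<dots> = pull l a \<cdot> (?i (ob l) \<otimes> run C ?a)"
    by (subst run_nat) (use struct_run.prems in \<open>simp_all add: run_asc\<close>)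
  finally show ?case
    using struct.struct_run[of "erase l a"] struct_run.prems by force
next
  case (struct_sw a b)
  note [simp] = struct_sw.hyps
  have ob [simp]: "ob l \<in> Obj C" using wf_treeD[of "Node a b"] struct_sw.prems by simp
  show ?case
  proof (cases "l \<in> set (leaves a)")
    case True
    moreover have nb: "l \<notin> set (leaves b)" using True struct_sw.prems by auto
    ultimately show ?thesis
      using struct_pull_sw[OF struct_sw.hyps] struct.struct_sw[of "erase l a" b] by force
  next
    case False
    then have lb: "l \<in> set (leaves b)" using struct_sw.prems by simp
    \<comment> \<open>A switch and its inverse are inserted on the erased trees, so that
      \<open>struct_pull_sw\<close> for the exchanged trees applies backwards.\<close>
    have "sw C (tobj a) (tobj b) \<cdot> pull l (Node a b) =
        sw C (tobj a) (tobj b) \<cdot> (pull l (Node a b) \<cdot>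
          (ident C (ob l) \<otimes> sw C (tobj (erase l b)) (tobj a))) \<cdot>
          (ident C (ob l) \<otimes> sw C (tobj a) (tobj (erase l b)))"
      using False lb by simp
    also have "\<dots> = pull l (Node b a) \<cdot> (ident C (ob l) \<otimes> sw C (tobj a) (tobj (erase l b)))"
      using False lb struct_pull_sw[OF struct_sw.hyps(2,1) lb False, symmetric]
      by simp
    finally show ?thesis
      using struct.struct_sw[of a "erase l b"] False lb by force
  qed
next
  case (struct_inverse a b m n)
  note I = inverse_arrowsD[OF struct_inverse.hyps(2)]
  note wf [simp] = struct_wf[OF struct_inverse.hyps(1)]
  note eqs = struct_mset[OF struct_inverse.hyps(1)]
  have l: "distinct (leaves a)" "l \<in> set (leaves a)"
    using struct_inverse.prems eqs mset_eq_setD[OF eqs] by (auto dest: mset_eq_imp_distinct_iff)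
  have ob [simp]: "ob l \<in> Obj C" using wf_treeD[of a] l by simp
  obtain m' where m': "struct (erase l a) (erase l b) m'"
      "m \<cdot> pull l a = pull l b \<cdot> (ident C (ob l) \<otimes> m')"
    using struct_inverse.IH l by blast
  let ?n = "inv_arrow C m'"
  note [simp] = struct_simps[OF m'(1)] struct_simps[OF struct_inv[OF m'(1)]] struct_simps[OF struct_inverse.hyps(1)]
    struct_inverse.prems(2) l(2)
  have n [simp]: "n \<in> Arr C" "Dom C n = tobj b" "Cod C n = tobj a" using I by auto
  \<comment> \<open>Inserting \<open>m'\<close> and its inverse exposes the right-hand side of the
    induction hypothesis; then \<open>n\<close> meets \<open>m\<close> and cancels.\<close>
  have "n \<cdot> pull l b = n \<cdot> (pull l b \<cdot> (ident C (ob l) \<otimes> m')) \<cdot> (ident C (ob l) \<otimes> ?n)"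
    by simp
  also have "\<dots> = (n \<cdot> m) \<cdot> pull l a \<cdot> (ident C (ob l) \<otimes> ?n)"
    using m'(2)[symmetric] by simp
  also have "\<dots> = pull l a \<cdot> (ident C (ob l) \<otimes> ?n)"
    using I by (simp del: assoc)
  finally show ?case using struct_inv[OF m'(1)] by blast
qed

text \<open>For a tree without leaves this is the canonical isomorphism to the unit, the base of the
  coherence induction.\<close>

primrec collapse :: "'l tree \<Rightarrow> 'm" where
  "collapse (Leaf l) = ident C (ob l)"
| "collapse Empty = ident C (unitO C)"
| "collapse (Node a b) = lun C (unitO C) \<cdot> (collapse a \<otimes> collapse b)"

lemma struct_collapse: "leaves a = [] \<Longrightarrow> struct a Empty (collapse a)"
proof (induction a)
  case (Node a b)
  then show ?case
    using struct_comp[OF struct_ten struct_lun[of Empty]] by auto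
qed (use struct_id[of Empty] in auto)

lemma collapse_arr [simp]:
  assumes "leaves a = []"
  shows "collapse a \<in> Arr C" "Dom C (collapse a) = tobj a" "Cod C (collapse a) = unitO C" "iso C (collapse a)"
  using struct_simps[OF struct_collapse[OF assms]] by simp_all

text \<open>The collapse arrows form a cocone over the leafless trees. As \<open>collapse b\<close>
  is invertible, only one arrow from \<open>a\<close> to \<open>b\<close> can be structural. At the
  unit, \<open>lun_unit\<close> identifies the two unitors.\<close>

lemma struct_collapse_nat:
  assumes "struct a b m" "leaves a = []"
  shows "collapse b \<cdot> m = collapse a"
  using assms
proof (induction rule: struct.induct)
  case (struct_id a)
  then show ?case by simp
next
  case (struct_comp a b m c n)
  have "leaves b = []" "leaves c = []"
    using struct_mset[OF struct_comp.hyps(1)] struct_mset[OF struct_comp.hyps(2)] struct_comp.prems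
    by auto
  note [simp] = this struct_simps[OF struct_comp.hyps(1)] struct_simps[OF struct_comp.hyps(2)]
  have "collapse c \<cdot> (n \<cdot> m) = (collapse c \<cdot> n) \<cdot> m"
    by simp
  then show ?case
    using struct_comp.IH struct_comp.prems \<open>leaves b = []\<close> by simp
next
  case (struct_ten a b m a' b' n)
  have *: "leaves a = []" "leaves a' = []" "leaves b = []" "leaves b' = []"
    using struct_mset[OF struct_ten.hyps(1)] struct_mset[OF struct_ten.hyps(2)] struct_ten.prems
    by auto
  note [simp] = * struct_simps[OF struct_ten.hyps(1)] struct_simps[OF struct_ten.hyps(2)]
  show ?case using struct_ten.IH by simp
next
  case (struct_asc a b c)
  then have *: "leaves a = []" "leaves b = []" "leaves c = []" by auto
  note [simp] = * struct_asc.hyps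
  let ?l = "lun C (unitO C)" and ?i = "ident C (unitO C)"
  have "collapse (Node (Node a b) c) \<cdot> asc C (tobj a) (tobj b) (tobj c) =
      ?l \<cdot> (?l \<otimes> ?i) \<cdot> (((collapse a \<otimes> collapse b) \<otimes> collapse c) \<cdot> asc C (tobj a) (tobj b) (tobj c))"
    by simp
  also have "\<dots> = ?l \<cdot> (((?l \<otimes> ?i) \<cdot> asc C (unitO C) (unitO C) (unitO C)) \<cdot>
      (collapse a \<otimes> (collapse b \<otimes> collapse c)))"
    by (simp add: asc_nat del: interchange interchange_assoc)
  also have "(?l \<otimes> ?i) \<cdot> asc C (unitO C) (unitO C) (unitO C) = ?i \<otimes> ?l"
    using triangle[of "unitO C" "unitO C"] by (simp add: lun_unit)
  finally show ?case by simp
next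
  case (struct_lun a)
  then have "leaves a = []" by simp
  note [simp] = this
  show ?case using struct_lun.hyps lun_nat[of "collapse a" "unitO C"] by simp
next
  case (struct_run a)
  then have "leaves a = []" by simp
  note [simp] = this
  show ?case using struct_run.hyps run_nat[of "collapse a" "unitO C"] by (simp add: lun_unit)
next
  case (struct_sw a b)
  then have *: "leaves a = []" "leaves b = []" by auto
  note [simp] = * struct_sw.hyps
  have "collapse (Node b a) \<cdot> sw C (tobj a) (tobj b) =
      (lun C (unitO C) \<cdot> sw C (unitO C) (unitO C)) \<cdot> (collapse a \<otimes> collapse b)"
    by (simp add: sw_nat del: interchange interchange_assoc)
  also have "lun C (unitO C) \<cdot> sw C (unitO C) (unitO C) = lun C (unitO C)"
    using lun_sw[of "unitO C"] lun_unit by simp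
  finally show ?case by simp
next
  case (struct_inverse a b m n)
  note I = inverse_arrowsD[OF struct_inverse.hyps(2)]
  have *: "leaves a = []" "leaves b = []"
    using struct_mset[OF struct_inverse.hyps(1)] struct_inverse.prems by auto
  note [simp] = * struct_simps[OF struct_inverse.hyps(1)]
  have "collapse a \<cdot> n = (collapse b \<cdot> m) \<cdot> n" using struct_inverse.IH * by simp
  also have "\<dots> = collapse b" using I by simp
  finally show ?case .
qed

theorem struct_unique:
  assumes "struct a b m" "struct a b n" "distinct (leaves a)"
  shows "m = n"
  using assms
proof (induction "length (leaves a)" arbitrary: a b m n)
  case 0
  then have *: "leaves a = []" "leaves b = []"
    using struct_mset by fastforce+
  show ?case
    \<comment> \<open>\<open>struct_collapse_nat\<close> makes both composites equal to
      \<open>collapse a\<close>.\<close>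
    by (rule iso_cancel_left[of "collapse b"])
      (use 0 * struct_simps[OF 0(2)] struct_simps[OF 0(3)] struct_collapse_nat in simp_all)
next
  case (Suc k)
  then obtain l where l: "l \<in> set (leaves a)" by (metis list.set_intros(1) neq_Nil_conv length_0_conv nat.distinct(1))
  have l': "l \<in> set (leaves b)" using struct_set[OF Suc.prems(1)] l by simp
  note wf [simp] = struct_wf[OF Suc.prems(1)] and [simp] = l l' struct_simps[OF Suc.prems(1)] struct_simps[OF Suc.prems(2)]
  obtain m' n' where m': "struct (erase l a) (erase l b) m'"
      "m \<cdot> pull l a = pull l b \<cdot> (ident C (ob l) \<otimes> m')"
    and n': "struct (erase l a) (erase l b) n'"
      "n \<cdot> pull l a = pull l b \<cdot> (ident C (ob l) \<otimes> n')"
    using struct_pull_nat[OF _ Suc.prems(3) l] Suc.prems by blast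
  have "m' = n'"
  proof (rule Suc.hyps(1)[OF _ m'(1) n'(1)])
    show "k = length (leaves (erase l a))"
      using Suc.hyps(2) l by (simp add: leaves_erase length_remove1)
    show "distinct (leaves (erase l a))"
      using Suc.prems(3) by (simp add: leaves_erase)
  qed
  then have "m \<cdot> pull l a = n \<cdot> pull l a"
    using m' n' by simp
  then show ?case by (rule iso_cancel_right[rotated]) simp_all
qed

lemma struct_exists:
  assumes "wf_tree a" "mset (leaves a) = mset (leaves b)"
  shows "\<exists>m. struct a b m"
  using assms
proof (induction "length (leaves a)" arbitrary: a b)
  case 0
  then have "leaves a = []" "leaves b = []" by auto
  then show ?case
    using struct_comp[OF struct_collapse struct_inv[OF struct_collapse]] by blast
next
  case (Suc k)
  then obtain l where l: "l \<in> set (leaves a)" by (metis list.set_intros(1) neq_Nil_conv length_0_conv nat.distinct(1))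
  have l': "l \<in> set (leaves b)" using Suc.prems(2) l mset_eq_setD by blast
  have wf: "wf_tree (Leaf l)" "wf_tree b"
    using Suc.prems l mset_eq_setD[OF Suc.prems(2)] by (auto simp: wf_tree_def)
  have "k = length (leaves (erase l a))" "mset (leaves (erase l a)) = mset (leaves (erase l b))"
    using Suc.hyps(2) l Suc.prems(2) by (simp_all add: leaves_erase length_remove1)
  then obtain m where "struct (erase l a) (erase l b) m"
    using Suc.hyps(1) Suc.prems by fastforce
  then have "struct (Node (Leaf l) (erase l a)) (Node (Leaf l) (erase l b)) (ident C (ob l) \<otimes> m)"
    using struct_ten[OF struct_id[OF wf(1)]] by simp
  \<comment> \<open>Pull \<open>l\<close> out of \<open>a\<close>, act on the remainder, and push
    \<open>l\<close> back into \<open>b\<close>.\<close>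
  from struct_comp[OF struct_comp[OF struct_inv[OF struct_pull] this] struct_pull]
  show ?case using Suc.prems(1) l l' wf by blast
qed

text \<open>The tensor of one arrow per leaf, in the shape of the tree: the semantic counterpart of
  \<open>graft\<close>.\<close>

primrec plug :: "('l \<Rightarrow> 'm) \<Rightarrow> 'l tree \<Rightarrow> 'm" where
  "plug g (Leaf l) = g l"
| "plug g Empty = ident C (unitO C)"
| "plug g (Node a b) = plug g a \<otimes> plug g b"

definition fills :: "('l \<Rightarrow> 'l tree) \<Rightarrow> ('l \<Rightarrow> 'm) \<Rightarrow> 'l tree \<Rightarrow> bool" where
  "fills f g a \<longleftrightarrow> wf_tree a \<and> (\<forall>l\<in>set (leaves a). wf_tree (f l) \<and> g l \<in> hom C (tobj (f l)) (ob l))"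

lemma fills_simps [simp]:
  "fills f g (Leaf l) \<longleftrightarrow> ob l \<in> Obj C \<and> wf_tree (f l) \<and> g l \<in> hom C (tobj (f l)) (ob l)"
  "fills f g Empty"
  "fills f g (Node a b) \<longleftrightarrow> fills f g a \<and> fills f g b"
  by (auto simp: fills_def)

lemma plug_arr:
  assumes "fills f g a"
  shows "plug g a \<in> Arr C" "Dom C (plug g a) = tobj (graft f a)" "Cod C (plug g a) = tobj a"
    "wf_tree (graft f a)" "wf_tree a"
  using assms by (induction a) (auto simp: hom_iff)

text \<open>Every structural constructor contributes its naturality square, and \<open>m'\<close> is
  built like \<open>m\<close> over the grafted trees. This is what carries a substitution across a
  change of shape.\<close>

lemma struct_plug_nat:
  assumes "struct a b m" "fills f g a"
  shows "\<exists>m'. struct (graft f a) (graft f b) m' \<and> m \<cdot> plug g a = plug g b \<cdot> m'"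
  using assms
proof (induction rule: struct.induct)
  case (struct_id a)
  note [simp] = plug_arr[OF struct_id.prems]
  have "ident C (tobj a) \<cdot> plug g a = plug g a \<cdot> ident C (tobj (graft f a))"
    by simp
  then show ?case
    using struct.struct_id[of "graft f a"]
    by (intro exI[of _ "ident C (tobj (graft f a))"]) simp
next
  case (struct_comp a b m c n)
  have fb: "fills f g b" "fills f g c"
    using struct_comp.prems struct_set[OF struct_comp.hyps(1)] struct_set[OF struct_comp.hyps(2)] struct_wf[OF struct_comp.hyps(2)]
    by (simp_all add: fills_def)
  note [simp] = struct_simps[OF struct_comp.hyps(1)] struct_simps[OF struct_comp.hyps(2)] plug_arr[OF fb(1)] plug_arr[OF fb(2)] plug_arr[OF struct_comp.prems]
  obtain m' n' where m': "struct (graft f a) (graft f b) m'" "m \<cdot> plug g a = plug g b \<cdot> m'"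
    and n': "struct (graft f b) (graft f c) n'" "n \<cdot> plug g b = plug g c \<cdot> n'"
    using struct_comp.IH struct_comp.prems fb by blast
  have "(n \<cdot> m) \<cdot> plug g a = (n \<cdot> plug g b) \<cdot> m'"
    using m' by simp
  also have "\<dots> = plug g c \<cdot> (n' \<cdot> m')"
    using m'(1) n' by simp
  finally show ?case using struct.struct_comp[OF m'(1) n'(1)] by blast
next
  case (struct_ten a b m a' b' n)
  have fb: "fills f g b" "fills f g b'" "fills f g a" "fills f g a'"
    using struct_ten.prems struct_set[OF struct_ten.hyps(1)] struct_set[OF struct_ten.hyps(2)]
      struct_wf[OF struct_ten.hyps(1)] struct_wf[OF struct_ten.hyps(2)]
    by (simp_all add: fills_def)
  note [simp] = struct_simps[OF struct_ten.hyps(1)] struct_simps[OF struct_ten.hyps(2)] fb[THEN plug_arr(1)] fb[THEN plug_arr(2)] fb[THEN plug_arr(3)]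
  obtain m' n' where m': "struct (graft f a) (graft f b) m'" "m \<cdot> plug g a = plug g b \<cdot> m'"
    and n': "struct (graft f a') (graft f b') n'" "n \<cdot> plug g a' = plug g b' \<cdot> n'"
    using struct_ten.IH fb by blast
  show ?case
    using struct.struct_ten[OF m'(1) n'(1)] m' n'
    by (intro exI[of _ "m' \<otimes> n'"]) simp
next
  case (struct_asc a b c)
  have fa: "fills f g a" "fills f g b" "fills f g c" using struct_asc.prems by simp_all
  note [simp] = fa[THEN plug_arr(1)] fa[THEN plug_arr(2)] fa[THEN plug_arr(3)] fa[THEN plug_arr(4)]
  show ?case using struct_asc.hyps struct.struct_asc[of "graft f a" "graft f b" "graft f c"]
      asc_nat[of "plug g a" "plug g b" "plug g c"]
    by (intro exI[of _ "asc C (tobj (graft f a)) (tobj (graft f b)) (tobj (graft f c))"]) simp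
next
  case (struct_lun a)
  have fa: "fills f g a" using struct_lun.prems by simp_all
  note [simp] = fa[THEN plug_arr(1)] fa[THEN plug_arr(2)] fa[THEN plug_arr(3)] fa[THEN plug_arr(4)]
  show ?case using struct_lun.hyps struct.struct_lun[of "graft f a"] lun_nat[of "plug g a"]
    by (intro exI[of _ "lun C (tobj (graft f a))"]) simp
next
  case (struct_run a)
  have fa: "fills f g a" using struct_run.prems by simp_all
  note [simp] = fa[THEN plug_arr(1)] fa[THEN plug_arr(2)] fa[THEN plug_arr(3)] fa[THEN plug_arr(4)]
  show ?case using struct_run.hyps struct.struct_run[of "graft f a"] run_nat[of "plug g a"]
    by (intro exI[of _ "run C (tobj (graft f a))"]) simp
next
  case (struct_sw a b)
  have fa: "fills f g a" "fills f g b" using struct_sw.prems by simp_all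
  note [simp] = fa[THEN plug_arr(1)] fa[THEN plug_arr(2)] fa[THEN plug_arr(3)] fa[THEN plug_arr(4)]
  show ?case using struct_sw.hyps struct.struct_sw[of "graft f a" "graft f b"] sw_nat[of "plug g a" "plug g b"]
    by (intro exI[of _ "sw C (tobj (graft f a)) (tobj (graft f b))"]) simp
next
  case (struct_inverse a b m n)
  note I = inverse_arrowsD[OF struct_inverse.hyps(2)]
  have fa: "fills f g a"
    using struct_inverse.prems struct_set[OF struct_inverse.hyps(1)] struct_wf[OF struct_inverse.hyps(1)]
    by (simp add: fills_def)
  note [simp] = struct_simps[OF struct_inverse.hyps(1)] plug_arr[OF fa] plug_arr[OF struct_inverse.prems]
  obtain m' where m': "struct (graft f a) (graft f b) m'" "m \<cdot> plug g a = plug g b \<cdot> m'"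
    using struct_inverse.IH fa by blast
  let ?n = "inv_arrow C m'"
  have n [simp]: "n \<in> Arr C" "Dom C n = tobj b" "Cod C n = tobj a" using I by auto
  have "n \<cdot> plug g b = n \<cdot> (plug g b \<cdot> m') \<cdot> ?n"
    using m'(1) by simp
  also have "\<dots> = (n \<cdot> m) \<cdot> plug g a \<cdot> ?n"
    using m'(1) by (simp add: m'(2)[symmetric])
  also have "\<dots> = plug g a \<cdot> ?n"
    using I m'(1) by (simp del: assoc)
  finally show ?case using struct_inv[OF m'(1)] by blast
qed

end


section \<open>Locally nameless terms and tree-shaped contexts\<close>

primrec opn :: "nat \<Rightarrow> var \<Rightarrow> ('g, 'f) tm \<Rightarrow> ('g, 'f) tm" where
  "opn k x (Bnd i) = (if i = k then Var x else Bnd i)"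
| "opn k x (Var y) = Var y"
| "opn k x (Op f vs) = Op f (map (opn k x) vs)"
| "opn k x Star = Star"
| "opn k x (ToStar v w) = ToStar (opn k x v) (opn k x w)"
| "opn k x (TPair v w) = TPair (opn k x v) (opn k x w)"
| "opn k x (PM v w) = PM (opn k x v) (opn (k + 2) x w)"
| "opn k x (Lam A v) = Lam A (opn (k + 1) x v)"
| "opn k x (Ap v w) = Ap (opn k x v) (opn k x w)"

text \<open>Local closure: dangling indices stay below \<open>k\<close>. Level 0 is the condition
  under which substitution cannot capture.\<close>

primrec lcat :: "nat \<Rightarrow> ('g, 'f) tm \<Rightarrow> bool" where
  "lcat k (Bnd i) \<longleftrightarrow> i < k"
| "lcat k (Var y) \<longleftrightarrow> True"
| "lcat k (Op f vs) \<longleftrightarrow> (\<forall>p\<in>set (map (lcat k) vs). p)"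
| "lcat k Star \<longleftrightarrow> True"
| "lcat k (ToStar v w) \<longleftrightarrow> lcat k v \<and> lcat k w"
| "lcat k (TPair v w) \<longleftrightarrow> lcat k v \<and> lcat k w"
| "lcat k (PM v w) \<longleftrightarrow> lcat k v \<and> lcat (k + 2) w"
| "lcat k (Lam A v) \<longleftrightarrow> lcat (k + 1) v"
| "lcat k (Ap v w) \<longleftrightarrow> lcat k v \<and> lcat k w"

primrec fv :: "('g, 'f) tm \<Rightarrow> var set" where
  "fv (Bnd i) = {}"
| "fv (Var y) = {y}"
| "fv (Op f vs) = \<Union> (set (map fv vs))"
| "fv Star = {}"
| "fv (ToStar v w) = fv v \<union> fv w"
| "fv (TPair v w) = fv v \<union> fv w"
| "fv (PM v w) = fv v \<union> fv w"
| "fv (Lam A v) = fv v"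
| "fv (Ap v w) = fv v \<union> fv w"

lemma finite_fv [simp]: "finite (fv v)"
  by (induction v) auto

lemma lcat_mono: "lcat k v \<Longrightarrow> k \<le> j \<Longrightarrow> lcat j v"
proof (induction v arbitrary: k j)
  case (PM v w)
  then show ?case using PM.IH(2)[of "k + 2" "j + 2"] by auto
next
  case (Lam A v)
  then show ?case using Lam.IH[of "k + 1" "j + 1"] by auto
qed auto

lemma opn_lcat: "lcat k v \<Longrightarrow> k \<le> j \<Longrightarrow> opn j x v = v"
proof (induction v arbitrary: k j)
  case (PM v w)
  then show ?case using PM.IH(2)[of "k + 2" "j + 2"] by auto
next
  case (Lam A v)
  then show ?case using Lam.IH[of "k + 1" "j + 1"] by auto
next
  case (Op f vs)
  then show ?case by (auto intro!: map_idI)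
qed auto

text \<open>Opening at \<open>i\<close> fills only the index \<open>i\<close>, so the unopened term
  may contain that index in addition to those below \<open>j\<close>.\<close>

lemma lcat_opnD: "lcat j (opn i x v) \<Longrightarrow> lcat (max j (Suc i)) v"
proof (induction v arbitrary: i j)
  case (PM v w)
  then show ?case using PM.IH(2)[of "j + 2" "i + 2"] by (auto simp: max_def split: if_splits)
next
  case (Lam A v)
  then show ?case using Lam.IH[of "j + 1" "i + 1"] by (auto simp: max_def split: if_splits)
qed (auto split: if_splits)

text \<open>Opening does not reach into the copies of \<open>u\<close>, because \<open>u\<close> is
  locally closed.\<close>

lemma opn_subst: "lcat 0 u \<Longrightarrow> z \<noteq> x \<Longrightarrow> (opn k x v)[u//z] = opn k x (v[u//z])"
  by (induction v arbitrary: k) (auto simp: opn_lcat)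

lemma opn_close: "lcat k v \<Longrightarrow> opn k y (close k x v) = v[Var y//x]"
  by (induction v arbitrary: k) auto

lemma opn_close_commute:
  "i \<noteq> j \<Longrightarrow> x \<noteq> y \<Longrightarrow> opn i y (close j x v) = close j x (opn i y v)"
  by (induction v arbitrary: i j) auto

lemma close_opn: "x \<notin> fv v \<Longrightarrow> close k x (opn k x v) = v"
  by (induction v arbitrary: k) (auto simp: map_idI)

lemma fv_opn: "fv v \<subseteq> fv (opn k x v)" "fv (opn k x v) \<subseteq> insert x (fv v)"
  by (induction v arbitrary: k) (auto, blast+)

text \<open>After the first substitution \<open>x\<close> survives only inside copies of
  \<open>w\<close>. This becomes associativity of composition in the syntactic category.\<close>

lemma subst_subst_same: "u[w//x][v//x] = u[w[v//x]//x]"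
  by (induction u) auto

lemma subst_Var_same: "u[Var x//x] = u"
  by (induction u) (auto simp: map_idI)

text \<open>The condition \<open>y' \<noteq> x\<close> keeps the closing at \<open>x\<close> from
  capturing the name just opened. Opening with new names thus amounts to two renamings, which the
  semantics can follow.\<close>

lemma opn_pm:
  assumes "lcat 0 w" "y' \<noteq> x"
  shows "opn 1 x' (opn 0 y' (close 1 x (close 0 y w))) = w[Var y'//y][Var x'//x]"
proof -
  have lc: "lcat 0 (v[Var z//y])" if "lcat 0 v" for v :: "('a, 'b) tm" and z
  proof -
    have "lcat k v \<Longrightarrow> lcat k (v[Var z//y])" for k
      by (induction v arbitrary: k) auto
    then show ?thesis using that .
  qed
  have "opn 0 y' (close 1 x (close 0 y w)) = close 1 x (w[Var y'//y])"
    using assms by (simp add: opn_close_commute opn_close)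
  then show ?thesis
    using opn_close[OF lcat_mono[OF lc[OF assms(1)], of 1]] by simp
qed

text \<open>Every \<open>PM\<close> is a \<open>pm\<close> over fresh names, so a premise for
  cofinitely many names can be turned back into a rule with chosen names.\<close>

lemma pm_opn:
  assumes "x \<notin> fv w" "y \<notin> fv w" "x \<noteq> y"
  shows "pm v x y (opn 1 x (opn 0 y w)) = PM v w"
proof -
  have "close 0 y (opn 1 x (opn 0 y w)) = opn 1 x w"
    using assms by (simp add: opn_close_commute[symmetric] close_opn)
  then show ?thesis
    using assms(1) by (simp add: pm_def close_opn)
qed

lemma lam_opn: "x \<notin> fv v \<Longrightarrow> lam x A (opn 0 x v) = Lam A v"
  by (simp add: lam_def close_opn)


lemma fresh2:
  assumes "finite (L :: var set)"
  obtains x y where "x \<notin> L" "y \<notin> L" "x \<noteq> y"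
proof -
  obtain x where x: "x \<notin> L" using ex_new_if_finite[OF infinite_UNIV_nat assms] by blast
  have "finite (insert x L)" using assms by simp
  then obtain y where "y \<notin> insert x L" using ex_new_if_finite[OF infinite_UNIV_nat] by blast
  with x show ?thesis using that by blast
qed

lemma insert_sandwich:
  "insert x N = F \<Longrightarrow> V \<subseteq> F \<Longrightarrow> F \<subseteq> insert x V \<Longrightarrow> x \<notin> N \<Longrightarrow> x \<notin> V \<Longrightarrow> N = V"
  by blast

text \<open>Nested to the left with no unit in front, so that its objects and arrows agree on the
  nose with \<open>tens\<close> and \<open>tensM\<close>.\<close>

fun nodes :: "'l tree list \<Rightarrow> 'l tree" where
  "nodes [] = Empty"
| "nodes (a # as) = foldl Node a as"

lemma nodes_snoc: "as \<noteq> [] \<Longrightarrow> nodes (as @ [a]) = Node (nodes as) a"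
  by (cases as) auto

lemma leaves_nodes: "leaves (nodes as) = concat (map leaves as)"
proof (induction as rule: rev_induct)
  case (snoc a as)
  then show ?case by (cases "as = []") (auto simp: nodes_snoc)
qed simp

lemma graft_nodes: "graft f (nodes as) = nodes (map (graft f) as)"
proof (induction as rule: rev_induct)
  case (snoc a as)
  then show ?case by (cases "as = []") (auto simp: nodes_snoc)
qed simp

abbreviation names :: "(var \<times> 'g ty) tree \<Rightarrow> var set" where
  "names a \<equiv> fst ` set (leaves a)"

abbreviation ndist :: "(var \<times> 'g ty) tree \<Rightarrow> bool" where
  "ndist a \<equiv> distinct (map fst (leaves a))"

lemma ndist_distinct: "ndist a \<Longrightarrow> distinct (leaves a)"
  by (simp add: distinct_map)

lemma ndist_cong: "mset (leaves a) = mset (leaves b) \<Longrightarrow> ndist a \<longleftrightarrow> ndist b"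
  by (metis mset_eq_imp_distinct_iff mset_map)

lemma ndist_leaf_unique: "ndist a \<Longrightarrow> (x, A) \<in> set (leaves a) \<Longrightarrow> (x, B) \<in> set (leaves a) \<Longrightarrow> A = B"
  by (metis distinct_map fst_conv inj_onD snd_conv)

abbreviation hole :: "var \<Rightarrow> (var \<times> 'g ty) tree \<Rightarrow> var \<times> 'g ty \<Rightarrow> (var \<times> 'g ty) tree" where
  "hole x b \<equiv> (\<lambda>l. if fst l = x then b else Leaf l)"

lemma graft_hole_fresh: "x \<notin> names a \<Longrightarrow> graft (hole x b) a = a"
  by (induction a) auto

section \<open>The n-fold tensor and currying as operations on arrows\<close>

context enriched_autonomous_category
begin

lemma tens_snoc: "Xs \<noteq> [] \<Longrightarrow> tens C (Xs @ [X]) = tens C Xs \<boxtimes> X"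
  by (cases Xs) auto

lemma tensM_snoc: "fs \<noteq> [] \<Longrightarrow> tensM C (fs @ [f]) = tensM C fs \<otimes> f"
  by (cases fs) auto

lemma tensM_arr:
  assumes "set fs \<subseteq> Arr C"
  shows "tensM C fs \<in> Arr C" "Dom C (tensM C fs) = tens C (map (Dom C) fs)"
    "Cod C (tensM C fs) = tens C (map (Cod C) fs)"
  using assms
proof (induction fs rule: rev_induct)
  case (snoc f fs)
  {
    case 1
    then show ?case using snoc by (cases "fs = []") (auto simp: tensM_snoc)
  next
    case 2
    then show ?case using snoc by (cases "fs = []") (auto simp: tensM_snoc tens_snoc)
  next
    case 3
    then show ?case using snoc by (cases "fs = []") (auto simp: tensM_snoc tens_snoc)
  }
qed simp_all

lemma tensM_comp:
  assumes "list_all2 (\<lambda>g f. g \<in> Arr C \<and> f \<in> Arr C \<and> Dom C g = Cod C f) gs fs"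
  shows "tensM C gs \<cdot> tensM C fs = tensM C (map2 (comp C) gs fs)"
  using assms
proof (induction gs arbitrary: fs rule: rev_induct)
  case (snoc g gs)
  then obtain f fs' where f: "fs = fs' @ [f]" "g \<in> Arr C" "f \<in> Arr C" "Dom C g = Cod C f"
    and fs': "list_all2 (\<lambda>g f. g \<in> Arr C \<and> f \<in> Arr C \<and> Dom C g = Cod C f) gs fs'"
    by (auto simp: list_all2_append1 list_all2_Cons1)
  have len: "length gs = length fs'" using fs' list_all2_lengthD by blast
  show ?case
  proof (cases "gs = []")
    case True
    then show ?thesis using f len by simp
  next
    case False
    then have ne: "fs' \<noteq> []" "zip gs fs' \<noteq> []" using len by auto
    have A: "set gs \<subseteq> Arr C" "set fs' \<subseteq> Arr C" "map (Dom C) gs = map (Cod C) fs'"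
      using fs' len by (auto simp: list_all2_conv_all_nth in_set_conv_nth intro!: nth_equalityI)
    show ?thesis
      using snoc.IH[OF fs'] f False ne len A(3) tensM_arr[OF A(1)] tensM_arr[OF A(2)]
      by (simp add: tensM_snoc)
  qed
qed simp

lemma curry_arr [simp]:
  assumes "X \<in> Obj C" "Y \<in> Obj C" "Z \<in> Obj C" "m \<in> Arr C" "Dom C m = Z \<boxtimes> X" "Cod C m = Y"
  shows "curry C Z X Y m \<in> Arr C" "Dom C (curry C Z X Y m) = Z" "Cod C (curry C Z X Y m) = ihom C X Y"
  using curry_hom[of X Y Z m] assms by (auto simp: hom_iff)

lemma app_arr [simp]:
  assumes "X \<in> Obj C" "Y \<in> Obj C"
  shows "app C X Y \<in> Arr C" "Dom C (app C X Y) = ihom C X Y \<boxtimes> X" "Cod C (app C X Y) = Y"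
  using app_hom[of X Y] assms by (auto simp: hom_iff)

text \<open>Both sides have the same image under the inverse of currying, so naturality is a
  consequence of \<open>app_curry\<close> and \<open>curry_app\<close>.\<close>

lemma curry_nat:
  assumes "X \<in> Obj C" "Y \<in> Obj C" "m \<in> Arr C" "Dom C m = Cod C h \<boxtimes> X" "Cod C m = Y" "h \<in> Arr C"
    "Z = Cod C h"
  shows "curry C Z X Y m \<cdot> h = curry C (Dom C h) X Y (m \<cdot> (h \<otimes> ident C X))"
proof -
  let ?k = "curry C Z X Y m"
  have "app C X Y \<cdot> ((?k \<cdot> h) \<otimes> ident C X) = (app C X Y \<cdot> (?k \<otimes> ident C X)) \<cdot> (h \<otimes> ident C X)"
    using assms by simp
  also have "\<dots> = m \<cdot> (h \<otimes> ident C X)"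
    using assms app_curry[of X Y Z m] by (simp add: hom_iff)
  finally show ?thesis
    using curry_app[of X Y "Dom C h" "?k \<cdot> h"] assms by (simp add: hom_iff)
qed

text \<open>Interchange splits off the argument and leaves \<open>app_curry\<close>. This is the
  semantic content of beta reduction for functions.\<close>

lemma app_curry_ten:
  assumes "X \<in> Obj C" "Y \<in> Obj C" "Z \<in> Obj C" "m \<in> Arr C" "Dom C m = Z \<boxtimes> X" "Cod C m = Y"
    "n \<in> Arr C" "Cod C n = X"
  shows "app C X Y \<cdot> (curry C Z X Y m \<otimes> n) = m \<cdot> (ident C Z \<otimes> n)"
proof -
  have "app C X Y \<cdot> (curry C Z X Y m \<otimes> n) =
      (app C X Y \<cdot> (curry C Z X Y m \<otimes> ident C X)) \<cdot> (ident C Z \<otimes> n)"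
    using assms by simp
  then show ?thesis using app_curry[of X Y Z m] assms by (simp add: hom_iff)
qed

end


context labelled_category
begin

lemma tobj_nodes: "tobj (nodes as) = tens C (map tobj as)"
proof (induction as rule: rev_induct)
  case (snoc a as)
  then show ?case by (cases "as = []") (auto simp: nodes_snoc tens_snoc)
qed simp

lemma plug_nodes: "plug g (nodes as) = tensM C (map (plug g) as)"
proof (induction as rule: rev_induct)
  case (snoc a as)
  then show ?case by (cases "as = []") (auto simp: nodes_snoc tensM_snoc)
qed simp

lemma struct_nodes:
  assumes "length as = length bs" "length ss = length bs"
    "\<And>i. i < length bs \<Longrightarrow> struct (as ! i) (bs ! i) (ss ! i)"
  shows "struct (nodes as) (nodes bs) (tensM C ss)"
  using assms
proof (induction bs arbitrary: as ss rule: rev_induct)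
  case Nil
  then show ?case using struct_id[of Empty] by simp
next
  case (snoc b bs)
  obtain a as' where a: "as = as' @ [a]" using snoc.prems(1) by (metis append_is_Nil_conv length_0_conv not_Cons_self2 rev_exhaust)
  obtain s ss' where s: "ss = ss' @ [s]" using snoc.prems(2) by (metis append_is_Nil_conv length_0_conv not_Cons_self2 rev_exhaust)
  have "length as' = length bs" "length ss' = length bs" using snoc.prems a s by auto
  then have last: "struct a b s"
    using snoc.prems(3)[of "length bs"] a s by (metis length_append_singleton lessI nth_append_length)
  show ?case
  proof (cases "bs = []")
    case True
    then show ?thesis using snoc.prems a s last by simp
  next
    case False
    have "struct (nodes as') (nodes bs) (tensM C ss')"
    proof (rule snoc.IH)
      fix i assume "i < length bs"
      then show "struct (as' ! i) (bs ! i) (ss' ! i)"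
        using snoc.prems(3)[of i] snoc.prems a s by (simp add: nth_append)
    qed (use snoc.prems a s in auto)
    moreover have "as' \<noteq> []" "ss' \<noteq> []" using snoc.prems False a s by auto
    ultimately show ?thesis
      using struct_ten[OF _ last] False a s by (simp add: nodes_snoc tensM_snoc)
  qed
qed

end


text \<open>Only the signature part of a model is fixed: determinacy and soundness for the lambda
  equations hold before any axiom is imposed. A leaf is a named variable and denotes the object of
  its type.\<close>

locale signature_interpretation = labelled_category C "\<lambda>l :: var \<times> 'g ty. tyO C M (snd l)"
  for C :: "('o, 'm, 'v::continuous_quantale, 'z) autcat_scheme" (structure)
    and M :: "('g, 'f, 'o, 'm) assignment" +
  fixes S :: "('g, 'f, 's) signature_scheme"
  assumes wf_sig: "wf_signature S"
    and gobj: "X \<in> grounds S \<Longrightarrow> gobj M X \<in> Obj C"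
    and oarr: "f \<in> ops S \<Longrightarrow> oarr M f \<in> hom C (tens C (map (tyO C M) (args S f))) (tyO C M (res S f))"
begin

abbreviation ty :: "'g ty \<Rightarrow> 'o" where
  "ty \<equiv> tyO C M"

lemma types_simps [simp]:
  "Unit \<in> types S"
  "Tensor A B \<in> types S \<longleftrightarrow> A \<in> types S \<and> B \<in> types S"
  "Lolli A B \<in> types S \<longleftrightarrow> A \<in> types S \<and> B \<in> types S"
  by (auto simp: types_def)

lemma ty_Obj [simp]: "A \<in> types S \<Longrightarrow> ty A \<in> Obj C"
  by (induction A) (auto simp: types_def gobj)

lemma op_types:
  assumes "f \<in> ops S"
  shows "res S f \<in> types S" "A \<in> set (args S f) \<Longrightarrow> A \<in> types S"
  using wf_sig assms by (auto simp: wf_signature_def)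

text \<open>
  A semantics over tree-shaped contexts that is closed under all structural isomorphisms, with
  cofinitely quantified names at the binders: exchange is built in, and by coherence the resulting
  arrow depends only on the term and the shape of the context.
\<close>

inductive den :: "(var \<times> 'g ty) tree \<Rightarrow> ('g, 'f) tm \<Rightarrow> 'g ty \<Rightarrow> 'm \<Rightarrow> bool" where
  den_struct: "den a v A m \<Longrightarrow> struct b a s \<Longrightarrow> den b v A (m \<cdot> s)"
| den_var: "A \<in> types S \<Longrightarrow> den (Leaf (x, A)) (Var x) A (ident C (ty A))"
| den_star: "den Empty Star Unit (ident C (unitO C))"
| den_to_star: "den a v Unit m \<Longrightarrow> den b w A n \<Longrightarrow> ndist (Node a b) \<Longrightarrow>
    den (Node a b) (ToStar v w) A (lun C (ty A) \<cdot> (m \<otimes> n))"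
| den_pair: "den a v A m \<Longrightarrow> den b w B n \<Longrightarrow> ndist (Node a b) \<Longrightarrow>
    den (Node a b) (TPair v w) (Tensor A B) (m \<otimes> n)"
| den_pm_cofinite: "den a v (Tensor A B) m \<Longrightarrow> finite L \<Longrightarrow>
    (\<forall>x y. x \<notin> L \<longrightarrow> y \<notin> L \<longrightarrow> x \<noteq> y \<longrightarrow>
      den (Node (Node (Leaf (x, A)) (Leaf (y, B))) b) (opn 1 x (opn 0 y w)) D n) \<Longrightarrow>
    ndist (Node a b) \<Longrightarrow>
    den (Node a b) (PM v w) D (n \<cdot> (m \<otimes> ident C (tobj b)))"
| den_lam_cofinite: "finite L \<Longrightarrow>
    (\<forall>x. x \<notin> L \<longrightarrow> den (Node a (Leaf (x, A))) (opn 0 x v) B m) \<Longrightarrow>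
    den a (Lam A v) (Lolli A B) (curry C (tobj a) (ty A) (ty B) m)"
| den_ap: "den a v (Lolli A B) m \<Longrightarrow> den b w A n \<Longrightarrow> ndist (Node a b) \<Longrightarrow>
    den (Node a b) (Ap v w) B (app C (ty A) (ty B) \<cdot> (m \<otimes> n))"
| den_op: "f \<in> ops S \<Longrightarrow> length as = length (args S f) \<Longrightarrow> length vs = length (args S f) \<Longrightarrow>
    length ms = length (args S f) \<Longrightarrow>
    (\<forall>i < length (args S f). den (as ! i) (vs ! i) (args S f ! i) (ms ! i)) \<Longrightarrow>
    ndist (nodes as) \<Longrightarrow>
    den (nodes as) (Op f vs) (res S f) (oarr M f \<cdot> tensM C ms)"

definition wt_tree :: "(var \<times> 'g ty) tree \<Rightarrow> bool" where
  "wt_tree a \<longleftrightarrow> snd ` set (leaves a) \<subseteq> types S"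

lemma wt_tree_simps [simp]:
  "wt_tree (Leaf l) \<longleftrightarrow> snd l \<in> types S" "wt_tree Empty"
  "wt_tree (Node a b) \<longleftrightarrow> wt_tree a \<and> wt_tree b"
  by (auto simp: wt_tree_def)

lemma wt_tree_wf [simp]: "wt_tree a \<Longrightarrow> wf_tree a"
  by (auto simp: wt_tree_def wf_tree_def)

lemma wt_tree_nodes: "wt_tree (nodes as) \<longleftrightarrow> (\<forall>a\<in>set as. wt_tree a)"
  unfolding wt_tree_def leaves_nodes by fastforce

text \<open>The equation \<open>names a = fv v\<close> expresses linearity. It is the reason why the
  split of a context between subterms can be recovered from the term alone.\<close>

lemma den_props:
  assumes "den a v A m"
  shows "wt_tree a \<and> ndist a \<and> A \<in> types S \<and> m \<in> Arr C \<and> Dom C m = tobj a \<and> Cod C m = ty A \<and>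
    lcat 0 v \<and> names a = fv v"
  using assms
proof (induction rule: den.induct)
  case (den_struct a v A m b s)
  then show ?case
    using struct_set[OF den_struct.hyps(2)] ndist_cong[OF struct_mset[OF den_struct.hyps(2)]]
      struct_simps[OF den_struct.hyps(2)]
    by (simp add: wt_tree_def)
next
  case (den_pm_cofinite a v A B m L b w D n)
  obtain x y where xy: "x \<notin> L \<union> names b \<union> fv w" "y \<notin> L \<union> names b \<union> fv w" "x \<noteq> y"
    by (rule fresh2[of "L \<union> names b \<union> fv w"]) (use den_pm_cofinite.hyps in auto)
  then have IH: "wt_tree (Node (Node (Leaf (x, A)) (Leaf (y, B))) b) \<and>
      D \<in> types S \<and> n \<in> Arr C \<and> Dom C n = (ty A \<boxtimes> ty B) \<boxtimes> tobj b \<and> Cod C n = ty D \<and>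
      lcat 0 (opn 1 x (opn 0 y w)) \<and> {x, y} \<union> names b = fv (opn 1 x (opn 0 y w))"
    using den_pm_cofinite.IH(2) by auto
  then have "lcat 0 (opn 1 x (opn 0 y w))" by simp
  \<comment> \<open>Undoing the opening at 1 and then the one at 0 leaves closure at level 2, as the
    body of \<open>PM\<close> requires.\<close>
  from lcat_opnD[OF lcat_opnD[OF this]] have "lcat (max (max 0 (Suc 1)) (Suc 0)) w" .
  moreover have "fv w \<subseteq> fv (opn 1 x (opn 0 y w))"
    by (rule order.trans[OF fv_opn(1) fv_opn(1)])
  moreover have "fv (opn 1 x (opn 0 y w)) \<subseteq> insert x (insert y (fv w))"
    by (rule order.trans[OF fv_opn(2) insert_mono[OF fv_opn(2)]])
  moreover have "{x, y} \<union> names b = fv (opn 1 x (opn 0 y w))" using IH by simp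
  ultimately have "lcat 2 w" "names b = fv w" using xy by (auto simp: numeral_2_eq_2)
  then show ?case
    using IH den_pm_cofinite.IH(1) den_pm_cofinite.hyps by (simp add: image_Un numeral_2_eq_2)
next
  case (den_lam_cofinite L a A v B m)
  obtain x where x: "x \<notin> L \<union> names a \<union> fv v"
    by (rule fresh2[of "L \<union> names a \<union> fv v"]) (use den_lam_cofinite.hyps in auto)
  then have IH: "wt_tree (Node a (Leaf (x, A))) \<and> ndist a \<and>
      B \<in> types S \<and> m \<in> Arr C \<and> Dom C m = tobj a \<boxtimes> ty A \<and> Cod C m = ty B \<and>
      lcat 0 (opn 0 x v) \<and> insert x (names a) = fv (opn 0 x v)"
    using den_lam_cofinite.IH by auto
  then have "lcat (max 0 (Suc 0)) v" using lcat_opnD[of 0 0 x v] by simp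
  moreover have "insert x (names a) = fv (opn 0 x v)" using IH by simp
  then have "names a = fv v"
    by (rule insert_sandwich[OF _ fv_opn]) (use x in auto)
  ultimately show ?case using IH by simp
next
  case (den_op f as vs ms)
  let ?n = "length (args S f)"
  have as: "wt_tree (nodes as)"
    using den_op.IH den_op.hyps(2) by (auto simp: wt_tree_nodes in_set_conv_nth)
  have ms: "set ms \<subseteq> Arr C" "map (Dom C) ms = map tobj as" "map (Cod C) ms = map ty (args S f)"
    using den_op.IH den_op.hyps by (auto simp: in_set_conv_nth intro!: nth_equalityI)
  have "lcat 0 v" if "v \<in> set vs" for v
    using den_op.IH den_op.hyps that by (auto simp: in_set_conv_nth)
  moreover have "map fv vs = map names as"
    using den_op.IH den_op.hyps by (auto intro!: nth_equalityI)
  then have "names (nodes as) = \<Union> (set (map fv vs))"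
    by (auto simp: leaves_nodes)
  ultimately show ?case
    using as ms tensM_arr[OF ms(1)] oarr[OF den_op.hyps(1)] op_types[OF den_op.hyps(1)] den_op.hyps(5)
    by (auto simp: hom_iff tobj_nodes)
qed (auto simp: image_Un)

lemma denD:
  assumes "den a v A m"
  shows "wt_tree a" "ndist a" "A \<in> types S" "m \<in> Arr C" "Dom C m = tobj a" "Cod C m = ty A"
    "lcat 0 v" "names a = fv v" "wf_tree a"
  using den_props[OF assms] by auto

end


section \<open>Substitution and inversion\<close>

no_notation quotient  (infixl \<open>'/'/\<close> 90)

lemma ndist_nodesD: "ndist (nodes as) \<Longrightarrow> a \<in> set as \<Longrightarrow> ndist a"
  by (auto simp: leaves_nodes dest!: split_list)

text \<open>\<open>hole\<close> looks at the name only; this condition ensures that the leaf it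
  replaces has the type of the grafted term.\<close>

abbreviation only_type :: "var \<Rightarrow> 'g ty \<Rightarrow> (var \<times> 'g ty) tree \<Rightarrow> bool" where
  "only_type x A a \<equiv> \<forall>A'. (x, A') \<in> set (leaves a) \<longrightarrow> A' = A"

section \<open>Substitution, derived binder rules and inversion for the tree semantics\<close>

context signature_interpretation
begin

abbreviation filler :: "var \<Rightarrow> 'm \<Rightarrow> var \<times> 'g ty \<Rightarrow> 'm" where
  "filler x n \<equiv> (\<lambda>l. if fst l = x then n else ident C (ty (snd l)))"

lemma plug_fresh: "x \<notin> names a \<Longrightarrow> wf_tree a \<Longrightarrow> plug (filler x n) a = ident C (tobj a)"
  by (induction a) (auto simp: image_Un)

lemma plug_ident: "wf_tree a \<Longrightarrow> only_type x A a \<Longrightarrow>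
    plug (filler x (ident C (ty A))) a = ident C (tobj a)"
  by (induction a) auto

lemma fills_hole:
  assumes "wt_tree a" "only_type x A a" "den b w A n"
  shows "fills (hole x b) (filler x n) a"
  using assms(1,2) denD[OF assms(3)]
  by (induction a) (auto simp: hom_iff)

lemmas plug_filler = plug_arr[OF fills_hole]

text \<open>The name \<open>x\<close> may be absent from \<open>a\<close>, in which case
  \<open>graft\<close> and \<open>plug\<close> do nothing. At a node both induction hypotheses then
  apply without asking which child contains the variable.\<close>

lemma den_subst:
  assumes "den a v B m" "den b w A n" "only_type x A a"
    "ndist (graft (hole x b) a)"
  shows "den (graft (hole x b) a) (v[w//x]) B (m \<cdot> plug (filler x n) a)"
  using assms(1,3,4)
proof (induction rule: den.induct)
  case (den_struct a v B m c s)
  let ?f = "hole x b" and ?g = "filler x n"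
  have fc: "fills ?f ?g c"
    using fills_hole[OF _ den_struct.prems(1) assms(2)] denD(1)[OF den.den_struct[OF den_struct.hyps]]
    by simp
  have fa: "fills ?f ?g a"
    using fills_hole[OF _ _ assms(2)] denD(1)[OF den_struct.hyps(1)] den_struct.prems(1)
      struct_set[OF den_struct.hyps(2)] by simp
  \<comment> \<open>Naturality of \<open>plug\<close> moves the structural arrow across the
    substitution.\<close>
  obtain s' where s': "struct (graft ?f c) (graft ?f a) s'" "s \<cdot> plug ?g c = plug ?g a \<cdot> s'"
    using struct_plug_nat[OF den_struct.hyps(2) fc] by blast
  have "den (graft ?f a) (v[w//x]) B (m \<cdot> plug ?g a)"
    using den_struct.IH den_struct.prems struct_set[OF den_struct.hyps(2)] ndist_cong[OF struct_mset[OF s'(1)]]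
    by simp
  then have "den (graft ?f c) (v[w//x]) B ((m \<cdot> plug ?g a) \<cdot> s')"
    using s'(1) by (rule den.den_struct)
  moreover have "(m \<cdot> plug ?g a) \<cdot> s' = (m \<cdot> s) \<cdot> plug ?g c"
    using s' denD[OF den_struct.hyps(1)] plug_arr[OF fa] plug_arr[OF fc]
      struct_simps[OF s'(1)] struct_simps[OF den_struct.hyps(2)] by simp
  ultimately show ?case by simp
next
  case (den_var B y)
  show ?case
  proof (cases "y = x")
    case True
    then show ?thesis using den_var assms(2) denD[OF assms(2)] by simp
  next
    case False
    then show ?thesis using den_var den.den_var[of B y] by simp
  qed
next
  case den_star
  then show ?case using den.den_star by simp
next
  case (den_to_star a u m c v A' n')
  have *: "only_type x A a" "only_type x A c"
    using den_to_star.prems by auto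
  note D = denD[OF den_to_star.hyps(1)] denD[OF den_to_star.hyps(2)]
  note [simp] = D plug_filler[OF D(1) *(1) assms(2)] plug_filler[OF D(10) *(2) assms(2)]
  show ?case
    using den.den_to_star[OF den_to_star.IH(1)[OF *(1)] den_to_star.IH(2)[OF *(2)]] den_to_star.prems
    by simp
next
  case (den_pair a u A' m c v B' n')
  have *: "only_type x A a" "only_type x A c"
    using den_pair.prems by auto
  note D = denD[OF den_pair.hyps(1)] denD[OF den_pair.hyps(2)]
  note [simp] = D plug_filler[OF D(1) *(1) assms(2)] plug_filler[OF D(10) *(2) assms(2)]
  show ?case
    using den.den_pair[OF den_pair.IH(1)[OF *(1)] den_pair.IH(2)[OF *(2)]] den_pair.prems
    by simp
next
  case (den_ap a u A' B' m c v n')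
  have *: "only_type x A a" "only_type x A c"
    using den_ap.prems by auto
  note D = denD[OF den_ap.hyps(1)] denD[OF den_ap.hyps(2)]
  note [simp] = D plug_filler[OF D(1) *(1) assms(2)] plug_filler[OF D(10) *(2) assms(2)]
  have [simp]: "A' \<in> types S" "B' \<in> types S" using denD(3)[OF den_ap.hyps(1)] by auto
  show ?case
    using den.den_ap[OF den_ap.IH(1)[OF *(1)] den_ap.IH(2)[OF *(2)]] den_ap.prems
    by simp
next
  case (den_pm_cofinite a v A' B' m L c u D n')
  let ?f = "hole x b" and ?g = "filler x n"
  have *: "only_type x A a" "only_type x A c"
    using den_pm_cofinite.prems by auto
  \<comment> \<open>Bound names are kept apart from \<open>x\<close> and from the names of the
    context both before and after grafting.\<close>
  let ?L = "L \<union> {x} \<union> names c \<union> names (graft ?f c)"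
  have finL: "finite ?L" using den_pm_cofinite.hyps by simp
  obtain y1 y2 where y: "y1 \<notin> ?L" "y2 \<notin> ?L" "y1 \<noteq> y2" by (rule fresh2[OF finL])
  then have "den (Node (Node (Leaf (y1, A')) (Leaf (y2, B'))) c) (opn 1 y1 (opn 0 y2 u)) D n'"
    using den_pm_cofinite.IH(2) by blast
  note U = denD[OF this]
  then have n' [simp]: "n' \<in> Arr C" "Dom C n' = (ty A' \<boxtimes> ty B') \<boxtimes> tobj c" "Cod C n' = ty D"
    "wt_tree c" "A' \<in> types S" "B' \<in> types S" by auto
  note F = fills_hole[OF denD(1)[OF den_pm_cofinite.hyps(1)] *(1) assms(2)]
    fills_hole[OF n'(4) *(2) assms(2)]
  note [simp] = plug_arr[OF F(1)] plug_arr[OF F(2)] denD[OF den_pm_cofinite.hyps(1)]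
  have "den (Node (graft ?f a) (graft ?f c)) (PM (v[w//x]) (u[w//x])) D
      ((n' \<cdot> (ident C (ty A' \<boxtimes> ty B') \<otimes> plug ?g c)) \<cdot> ((m \<cdot> plug ?g a) \<otimes> ident C (tobj (graft ?f c))))"
  proof (rule den.den_pm_cofinite[OF den_pm_cofinite.IH(1)[OF *(1)] finL])
    show "\<forall>y z. y \<notin> ?L \<longrightarrow> z \<notin> ?L \<longrightarrow> y \<noteq> z \<longrightarrow>
        den (Node (Node (Leaf (y, A')) (Leaf (z, B'))) (graft ?f c)) (opn 1 y (opn 0 z (u[w//x]))) D
          (n' \<cdot> (ident C (ty A' \<boxtimes> ty B') \<otimes> plug ?g c))"
    proof (intro allI impI)
      fix y z assume yz: "y \<notin> ?L" "z \<notin> ?L" "y \<noteq> z"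
      let ?t = "Node (Node (Leaf (y, A')) (Leaf (z, B'))) c"
      have "den (graft ?f ?t) ((opn 1 y (opn 0 z u))[w//x]) D (n' \<cdot> plug ?g ?t)"
      proof -
        have "den ?t (opn 1 y (opn 0 z u)) D n' \<and>
            (only_type x A ?t \<longrightarrow> ndist (graft ?f ?t) \<longrightarrow>
             den (graft ?f ?t) ((opn 1 y (opn 0 z u))[w//x]) D (n' \<cdot> plug ?g ?t))"
          using den_pm_cofinite.IH(2) yz by blast
        moreover have "only_type x A ?t" using yz *(2) by auto
        moreover have "ndist (graft ?f ?t)" using yz den_pm_cofinite.prems(2) by auto
        ultimately show ?thesis by blast
      qed
      then show "den (Node (Node (Leaf (y, A')) (Leaf (z, B'))) (graft ?f c)) (opn 1 y (opn 0 z (u[w//x]))) D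
          (n' \<cdot> (ident C (ty A' \<boxtimes> ty B') \<otimes> plug ?g c))"
        using yz denD(7)[OF assms(2)] by (simp add: opn_subst)
    qed
  qed (use den_pm_cofinite.prems in auto)
  then show ?case by simp
next
  case (den_lam_cofinite L a A' v B' m)
  let ?f = "hole x b" and ?g = "filler x n"
  let ?L = "L \<union> {x} \<union> names a \<union> names (graft ?f a)"
  have finL: "finite ?L" using den_lam_cofinite.hyps by simp
  obtain y where y: "y \<notin> ?L" by (rule fresh2[OF finL])
  then have "den (Node a (Leaf (y, A'))) (opn 0 y v) B' m"
    using den_lam_cofinite.IH by blast
  note U = denD[OF this]
  then have m [simp]: "m \<in> Arr C" "Dom C m = tobj a \<boxtimes> ty A'" "Cod C m = ty B'"
    "wt_tree a" "A' \<in> types S" "B' \<in> types S" by auto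
  note F = fills_hole[OF m(4) den_lam_cofinite.prems(1) assms(2)]
  note [simp] = plug_arr[OF F]
  have "den (graft ?f a) (Lam A' (v[w//x])) (Lolli A' B')
      (curry C (tobj (graft ?f a)) (ty A') (ty B') (m \<cdot> (plug ?g a \<otimes> ident C (ty A'))))"
  proof (rule den.den_lam_cofinite[OF finL], intro allI impI)
    fix y assume y: "y \<notin> ?L"
    let ?t = "Node a (Leaf (y, A'))"
    have "den (graft ?f ?t) ((opn 0 y v)[w//x]) B' (m \<cdot> plug ?g ?t)"
    proof -
      have "den ?t (opn 0 y v) B' m \<and>
          (only_type x A ?t \<longrightarrow> ndist (graft ?f ?t) \<longrightarrow>
           den (graft ?f ?t) ((opn 0 y v)[w//x]) B' (m \<cdot> plug ?g ?t))"
        using den_lam_cofinite.IH y by blast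
      moreover have "only_type x A ?t"
        using y den_lam_cofinite.prems by auto
      moreover have "ndist (graft ?f ?t)" using y den_lam_cofinite.prems by auto
      ultimately show ?thesis by blast
    qed
    then show "den (Node (graft ?f a) (Leaf (y, A'))) (opn 0 y (v[w//x])) B'
        (m \<cdot> (plug ?g a \<otimes> ident C (ty A')))"
      using y denD(7)[OF assms(2)] by (simp add: opn_subst)
  qed
  then show ?case by (simp add: curry_nat)
next
  case (den_op f as vs ms)
  let ?f = "hole x b" and ?g = "filler x n" and ?n = "length (args S f)"
  have len: "length as = ?n" "length vs = ?n" "length ms = ?n" using den_op.hyps by auto
  have *: "only_type x A (as ! i)" if "i < ?n" for i
  proof -
    have "as ! i \<in> set as" using that len by simp
    then have "set (leaves (as ! i)) \<subseteq> set (leaves (nodes as))" by (auto simp: leaves_nodes)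
    then show ?thesis using den_op.prems(1) by blast
  qed
  have nd: "ndist (graft ?f (as ! i))" if "i < ?n" for i
    using ndist_nodesD[OF den_op.prems(2)[unfolded graft_nodes], of "graft ?f (as ! i)"] that len by simp
  have den: "den (as ! i) (vs ! i) (args S f ! i) (ms ! i)" if "i < ?n" for i
    using den_op.IH that by blast
  note D = denD[OF den]
  note P = plug_arr[OF fills_hole[OF D(1) * assms(2)]]
  let ?ns = "map2 (comp C) ms (map (plug ?g) as)"
  have "den (nodes (map (graft ?f) as)) (Op f (map (\<lambda>v. v[w//x]) vs)) (res S f) (oarr M f \<cdot> tensM C ?ns)"
  proof (rule den.den_op)
    show "\<forall>i<?n. den (map (graft ?f) as ! i) (map (\<lambda>v. v[w//x]) vs ! i) (args S f ! i) (?ns ! i)"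
      using den_op.IH * nd len by auto
  qed (use den_op.hyps den_op.prems in \<open>auto simp: graft_nodes\<close>)
  moreover have "tensM C ?ns = tensM C ms \<cdot> plug ?g (nodes as)"
    unfolding plug_nodes
    by (rule tensM_comp[symmetric]) (use D P len in \<open>auto simp: list_all2_conv_all_nth\<close>)
  moreover have "oarr M f \<cdot> (tensM C ms \<cdot> plug ?g (nodes as)) = (oarr M f \<cdot> tensM C ms) \<cdot> plug ?g (nodes as)"
  proof -
    have "set ms \<subseteq> Arr C" "map (Dom C) ms = map tobj as" "map (Cod C) ms = map ty (args S f)"
      using D len by (auto simp: in_set_conv_nth intro!: nth_equalityI)
    moreover have "wt_tree (nodes as)"
      using denD(1)[OF den.den_op[OF den_op.hyps(1-4) _ den_op.hyps(5)]] den_op.IH by blast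
    note plug_arr[OF fills_hole[OF this den_op.prems(1) assms(2)]]
    ultimately show ?thesis
      using tensM_arr[of ms] oarr[OF den_op.hyps(1)] by (simp add: hom_iff tobj_nodes)
  qed
  ultimately show ?case by (simp add: graft_nodes)
qed

lemma den_subst_left:
  assumes "den (Node (Leaf (x, A)) a) v B m" "den b w A n" "ndist (Node b a)"
  shows "den (Node b a) (v[w//x]) B (m \<cdot> (n \<otimes> ident C (tobj a)))"
proof -
  have "x \<notin> names a" "wf_tree a" using denD(2,9)[OF assms(1)] by auto
  moreover from this have "only_type x A a" by force
  ultimately show ?thesis
    using den_subst[OF assms(1,2), of x] assms(3) by (auto simp: graft_hole_fresh plug_fresh)
qed

lemma den_subst_right:
  assumes "den (Node a (Leaf (x, A))) v B m" "den b w A n" "ndist (Node a b)"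
  shows "den (Node a b) (v[w//x]) B (m \<cdot> (ident C (tobj a) \<otimes> n))"
proof -
  have "x \<notin> names a" "wf_tree a" using denD(2,9)[OF assms(1)] by auto
  moreover from this have "only_type x A a" by force
  ultimately show ?thesis
    using den_subst[OF assms(1,2), of x] assms(3) by (auto simp: graft_hole_fresh plug_fresh)
qed

lemma den_subst_leaf:
  assumes "den (Leaf (x, A)) v B m" "den b w A n"
  shows "den b (v[w//x]) B (m \<cdot> n)"
  using den_subst[OF assms, of x] denD(2)[OF assms(2)] by simp

text \<open>A substitution whose plugged arrow is an identity, so the denotation does not change
  with the name.\<close>

lemma den_rename:
  assumes "den a v B m" "(x, A) \<in> set (leaves a)" "ndist (graft (hole x (Leaf (y, A))) a)"
  shows "den (graft (hole x (Leaf (y, A))) a) (v[Var y//x]) B m"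
proof -
  note D = denD[OF assms(1)]
  have "snd (x, A) \<in> types S" using D(1) assms(2) unfolding wt_tree_def by blast
  then have A: "A \<in> types S" "only_type x A a"
    using ndist_leaf_unique[OF D(2) assms(2)] by auto
  have "m \<cdot> plug (filler x (ident C (ty A))) a = m"
    using plug_ident[OF D(9) A(2)] D by simp
  then show ?thesis
    using den_subst[OF assms(1) den_var[OF A(1), of y] A(2) assms(3)] by simp
qed

text \<open>Passes from one pair of names to all fresh pairs: since renaming preserves the
  denotation, the same \<open>n\<close> serves for every pair.\<close>

lemma den_pm:
  assumes "den a v (Tensor A B) m" "den (Node (Node (Leaf (x, A)) (Leaf (y, B))) b) w D n"
    "ndist (Node a b)"
  shows "den (Node a b) (pm v x y w) D (n \<cdot> (m \<otimes> ident C (tobj b)))"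
  unfolding pm_def
proof (rule den_pm_cofinite[OF assms(1) _ _ assms(3)])
  let ?L = "insert x (insert y (names b))"
  note D = denD[OF assms(2)]
  have xy: "x \<noteq> y" "x \<notin> names b" "y \<notin> names b" using D(2) by auto
  show "finite ?L" by simp
  show "\<forall>x' y'. x' \<notin> ?L \<longrightarrow> y' \<notin> ?L \<longrightarrow> x' \<noteq> y' \<longrightarrow>
      den (Node (Node (Leaf (x', A)) (Leaf (y', B))) b) (opn 1 x' (opn 0 y' (close 1 x (close 0 y w)))) D n"
  proof (intro allI impI)
    fix x' y' assume z: "x' \<notin> ?L" "y' \<notin> ?L" "x' \<noteq> y'"
    \<comment> \<open>The names are replaced one at a time, in the order in which
      \<open>opn_pm\<close> produces the renamings.\<close>
    have "den (Node (Node (Leaf (x, A)) (Leaf (y', B))) b) (w[Var y'//y]) D n"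
      using den_rename[OF assms(2), of y B y'] D(2) z xy by (auto simp: graft_hole_fresh)
    from den_rename[OF this, of x A x']
    have "den (Node (Node (Leaf (x', A)) (Leaf (y', B))) b) (w[Var y'//y][Var x'//x]) D n"
      using D(2) z xy by (auto simp: graft_hole_fresh)
    then show "den (Node (Node (Leaf (x', A)) (Leaf (y', B))) b)
        (opn 1 x' (opn 0 y' (close 1 x (close 0 y w)))) D n"
      using opn_pm[OF D(7), of y' x x' y] z by simp
  qed
qed

lemma den_lam:
  assumes "den (Node a (Leaf (x, A))) v B m"
  shows "den a (lam x A v) (Lolli A B) (curry C (tobj a) (ty A) (ty B) m)"
  unfolding lam_def
proof (rule den_lam_cofinite)
  let ?L = "insert x (names a)"
  note D = denD[OF assms(1)]
  show "finite ?L" by simp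
  show "\<forall>y. y \<notin> ?L \<longrightarrow> den (Node a (Leaf (y, A))) (opn 0 y (close 0 x v)) B m"
  proof (intro allI impI)
    fix y assume y: "y \<notin> ?L"
    have "x \<notin> names a" using D(2) by auto
    then show "den (Node a (Leaf (y, A))) (opn 0 y (close 0 x v)) B m"
      using den_rename[OF assms(1), of x A y] D(2) y opn_close[OF D(7), of y x]
      by (auto simp: graft_hole_fresh)
  qed
qed

lemma den_PM_arr:
  assumes "finite L" "\<forall>x y. x \<notin> L \<longrightarrow> y \<notin> L \<longrightarrow> x \<noteq> y \<longrightarrow>
      den (Node (Node (Leaf (x, A)) (Leaf (y, B))) b) (opn 1 x (opn 0 y w)) D n"
  shows "n \<in> Arr C" "Dom C n = (ty A \<boxtimes> ty B) \<boxtimes> tobj b" "Cod C n = ty D"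
    "wt_tree b" "A \<in> types S" "B \<in> types S" "D \<in> types S" "names b = fv w"
proof -
  let ?L = "L \<union> names b \<union> fv w"
  have "finite ?L" using assms(1) by simp
  then obtain x y where xy: "x \<notin> ?L" "y \<notin> ?L" "x \<noteq> y" by (rule fresh2)
  then have "den (Node (Node (Leaf (x, A)) (Leaf (y, B))) b) (opn 1 x (opn 0 y w)) D n"
    using assms(2) by blast
  note D = denD[OF this]
  then show "n \<in> Arr C" "Dom C n = (ty A \<boxtimes> ty B) \<boxtimes> tobj b" "Cod C n = ty D"
    "wt_tree b" "A \<in> types S" "B \<in> types S" "D \<in> types S" by auto
  have "fv w \<subseteq> fv (opn 1 x (opn 0 y w))"
    by (rule order.trans[OF fv_opn(1) fv_opn(1)])
  moreover have "fv (opn 1 x (opn 0 y w)) \<subseteq> insert x (insert y (fv w))"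
    by (rule order.trans[OF fv_opn(2) insert_mono[OF fv_opn(2)]])
  moreover have "{x, y} \<union> names b = fv (opn 1 x (opn 0 y w))" using D(8) by simp
  ultimately show "names b = fv w" using xy by auto
qed

lemma den_Lam_arr:
  assumes "finite L" "\<forall>x. x \<notin> L \<longrightarrow> den (Node a (Leaf (x, A))) (opn 0 x v) B m"
  shows "m \<in> Arr C" "Dom C m = tobj a \<boxtimes> ty A" "Cod C m = ty B" "wt_tree a" "A \<in> types S" "B \<in> types S"
proof -
  obtain x where x: "x \<notin> L" using fresh2[OF assms(1)] by blast
  then have "den (Node a (Leaf (x, A))) (opn 0 x v) B m" using assms(2) by blast
  from denD[OF this] show "m \<in> Arr C" "Dom C m = tobj a \<boxtimes> ty A" "Cod C m = ty B"
    "wt_tree a" "A \<in> types S" "B \<in> types S" by auto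
qed

text \<open>The rules of \<open>den\<close> apart from \<open>den_struct\<close>. They are directed
  by the head constructor of the term, which makes case analysis informative.\<close>

inductive den_head :: "(var \<times> 'g ty) tree \<Rightarrow> ('g, 'f) tm \<Rightarrow> 'g ty \<Rightarrow> 'm \<Rightarrow> bool" where
  "A \<in> types S \<Longrightarrow> den_head (Leaf (x, A)) (Var x) A (ident C (ty A))"
| "den_head Empty Star Unit (ident C (unitO C))"
| "den a v Unit m \<Longrightarrow> den b w A n \<Longrightarrow> ndist (Node a b) \<Longrightarrow>
    den_head (Node a b) (ToStar v w) A (lun C (ty A) \<cdot> (m \<otimes> n))"
| "den a v A m \<Longrightarrow> den b w B n \<Longrightarrow> ndist (Node a b) \<Longrightarrow>
    den_head (Node a b) (TPair v w) (Tensor A B) (m \<otimes> n)"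
| "den a v (Tensor A B) m \<Longrightarrow> finite L \<Longrightarrow>
    (\<forall>x y. x \<notin> L \<longrightarrow> y \<notin> L \<longrightarrow> x \<noteq> y \<longrightarrow>
      den (Node (Node (Leaf (x, A)) (Leaf (y, B))) b) (opn 1 x (opn 0 y w)) D n) \<Longrightarrow>
    ndist (Node a b) \<Longrightarrow> den_head (Node a b) (PM v w) D (n \<cdot> (m \<otimes> ident C (tobj b)))"
| "finite L \<Longrightarrow> (\<forall>x. x \<notin> L \<longrightarrow> den (Node a (Leaf (x, A))) (opn 0 x v) B m) \<Longrightarrow>
    den_head a (Lam A v) (Lolli A B) (curry C (tobj a) (ty A) (ty B) m)"
| "den a v (Lolli A B) m \<Longrightarrow> den b w A n \<Longrightarrow> ndist (Node a b) \<Longrightarrow>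
    den_head (Node a b) (Ap v w) B (app C (ty A) (ty B) \<cdot> (m \<otimes> n))"
| "f \<in> ops S \<Longrightarrow> length as = length (args S f) \<Longrightarrow> length vs = length (args S f) \<Longrightarrow>
    length ms = length (args S f) \<Longrightarrow>
    (\<forall>i < length (args S f). den (as ! i) (vs ! i) (args S f ! i) (ms ! i)) \<Longrightarrow>
    ndist (nodes as) \<Longrightarrow> den_head (nodes as) (Op f vs) (res S f) (oarr M f \<cdot> tensM C ms)"

inductive_cases den_headE:
  "den_head c (Var x) A k" "den_head c Star A k" "den_head c (ToStar v w) A k"
  "den_head c (TPair v w) A k" "den_head c (PM v w) A k" "den_head c (Lam B v) A k"
  "den_head c (Ap v w) A k" "den_head c (Op f vs) A k"

lemma den_head_den: "den_head a v A m \<Longrightarrow> den a v A m"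
  by (induction rule: den_head.induct) (blast intro: den.intros)+

lemma den_head_id:
  assumes "den_head a v A m"
  shows "\<exists>c n s. den_head c v A n \<and> struct a c s \<and> m = n \<cdot> s"
  using assms denD[OF den_head_den[OF assms]] struct_id
  by (intro exI[of _ a] exI[of _ m] exI[of _ "ident C (tobj a)"]) simp

text \<open>Structural arrows compose, so any run of \<open>den_struct\<close> steps at the root
  collapses into one.\<close>

lemma den_inversion:
  "den c v A k \<Longrightarrow> \<exists>a m s. den_head a v A m \<and> struct c a s \<and> k = m \<cdot> s"
proof (induction rule: den.induct)
  case (den_struct a v A k b s)
  then obtain c m t where *: "den_head c v A m" "struct a c t" "k = m \<cdot> t" by blast
  have "k \<cdot> s = m \<cdot> (t \<cdot> s)"
    using * denD[OF den_head_den[OF *(1)]] struct_simps[OF *(2)] struct_simps[OF den_struct.hyps(2)]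
    by simp
  then show ?case using *(1) struct_comp[OF den_struct.hyps(2) *(2)] by blast
qed (blast intro: den_head_id den_head.intros)+

end


section \<open>The interpretation of judgements\<close>

definition ctree :: "'l list \<Rightarrow> 'l tree" where
  "ctree xs = nodes (map Leaf xs)"

lemma ctree_simps [simp]:
  "ctree [] = Empty" "ctree [x] = Leaf x" "ctree [x, y] = Node (Leaf x) (Leaf y)"
  by (simp_all add: ctree_def)

lemma leaves_ctree [simp]: "leaves (ctree xs) = xs"
  by (induction xs rule: rev_induct) (auto simp: leaves_nodes ctree_def)

lemma ctree_snoc: "xs \<noteq> [] \<Longrightarrow> ctree (xs @ [x]) = Node (ctree xs) (Leaf x)"
  using nodes_snoc[of "map Leaf xs"] by (simp add: ctree_def)

lemma Sf_mset: "E \<in> Sf \<Gamma>s \<Longrightarrow> mset E = mset (concat \<Gamma>s)"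
  by (induction \<Gamma>s arbitrary: E) (auto simp: mset_shuffles)

lemma remove1_split:
  assumes "a \<in> set E"
  shows "E = takeWhile (\<lambda>b. b \<noteq> a) E @ [a] @ tl (dropWhile (\<lambda>b. b \<noteq> a) E)"
    and "remove1 a E = takeWhile (\<lambda>b. b \<noteq> a) E @ tl (dropWhile (\<lambda>b. b \<noteq> a) E)"
  using assms by (induction E) auto

text \<open>Reconciles two readings of unit elimination: \<open>den\<close> tensors both arrows and
  then applies \<open>lun\<close>, whereas \<open>interp\<close> applies \<open>lun\<close> at the
  context of the second term.\<close>

lemma (in enriched_autonomous_category) lun_ten:
  assumes "m \<in> Arr C" "n \<in> Arr C" "Cod C m = unitO C"
  shows "lun C (Cod C n) \<cdot> (m \<otimes> n) = n \<cdot> lun C (Dom C n) \<cdot> (m \<otimes> ident C (Dom C n))"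
proof -
  have "lun C (Cod C n) \<cdot> (m \<otimes> n) =
      (lun C (Cod C n) \<cdot> (ident C (unitO C) \<otimes> n)) \<cdot> (m \<otimes> ident C (Dom C n))"
    using assms by simp
  also have "\<dots> = n \<cdot> lun C (Dom C n) \<cdot> (m \<otimes> ident C (Dom C n))"
    by (subst lun_nat) (use assms in simp_all)
  finally show ?thesis .
qed

text \<open>A list without repetitions is a shuffle of the sublists it induces on the blocks of a
  partition. These sublists are the contexts of the subterms when a tree derivation is turned into a
  typing derivation.\<close>

lemma shuffle_filter:
  assumes "distinct (concat xss)" "set (concat xss) = set E" "distinct E"
  shows "E \<in> Sf (map (\<lambda>xs. filter (\<lambda>l. l \<in> set xs) E) xss)"
  using assms
proof (induction xss arbitrary: E)
  case (Cons xs xss)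
  let ?D = "filter (\<lambda>l. l \<notin> set xs) E"
  have D: "?D \<in> Sf (map (\<lambda>xs. filter (\<lambda>l. l \<in> set xs) ?D) xss)"
    using Cons.prems by (intro Cons.IH) auto
  have eq: "map (\<lambda>xs. filter (\<lambda>l. l \<in> set xs) ?D) xss = map (\<lambda>xs. filter (\<lambda>l. l \<in> set xs) E) xss"
    using Cons.prems(1) by (auto intro!: filter_cong)
  show ?case
    using partition_in_shuffles[of E "\<lambda>l. l \<in> set xs"] D unfolding eq list.map Sf.simps by blast
qed simp

lemma shuffle_filter2:
  assumes "nonrep E" "ndist (Node a b)" "set E = set (leaves (Node a b))"
  shows "E \<in> Sf [filter (\<lambda>l. l \<in> set (leaves a)) E, filter (\<lambda>l. l \<in> set (leaves b)) E]"
  using shuffle_filter[of "[leaves a, leaves b]" E] ndist_distinct[OF assms(2)] assms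
  by (simp add: distinct_map)

section \<open>The arrows \<open>split\<close>, \<open>joined\<close> and \<open>exch\<close> are
  structural\<close>

context labelled_category
begin

abbreviation obs :: "'l list \<Rightarrow> 'o list" where
  "obs xs \<equiv> map ob xs"

lemma tens_obs: "tens C (obs xs) = tobj (ctree xs)"
  by (simp add: ctree_def tobj_nodes o_def)

lemma wf_ctree [simp]: "wf_tree (ctree xs) \<longleftrightarrow> (\<forall>x\<in>set xs. ob x \<in> Obj C)"
  by (simp add: wf_tree_def)

text \<open>With \<open>xs\<close> nonempty, adding one variable at the end is one tensoring on the
  right, so each recursion step is a single inverse associator. The empty list goes through
  \<open>lun\<close> in \<open>split2\<close>.\<close>

lemma struct_split2_rev:
  "xs \<noteq> [] \<Longrightarrow> wf_tree (ctree xs) \<Longrightarrow> wf_tree (ctree ys) \<Longrightarrow>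
    struct (ctree (xs @ rev ys)) (Node (ctree xs) (ctree (rev ys))) (split2_rev C (obs xs) (obs ys))"
proof (induction ys rule: induct_list012)
  case 1
  then show ?case using struct_inv[OF struct_run[of "ctree xs"]] by (simp add: tens_obs)
next
  case (2 y)
  then show ?case using struct_id[of "Node (ctree xs) (Leaf y)"] by (simp add: tens_obs ctree_snoc)
next
  case (3 y y' ys)
  have *: "tens C (rev (obs ys) @ [ob y']) = tobj (ctree (rev ys @ [y']))"
    using tens_obs[of "rev ys @ [y']"] by (simp add: rev_map)
  have "struct (ctree (xs @ rev (y' # ys))) (Node (ctree xs) (ctree (rev (y' # ys))))
      (split2_rev C (obs xs) (obs (y' # ys)))"
    using 3 by simp
  from struct_comp[OF struct_ten[OF this struct_id[of "Leaf y"]]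
      struct_inv[OF struct_asc[of "ctree xs" "ctree (rev (y' # ys))" "Leaf y"]]]
  show ?case
    using 3 ctree_snoc[of "xs @ rev ys @ [y']" y] ctree_snoc[of "rev ys @ [y']" y] tens_obs[of xs] *
    by simp
qed

lemma struct_split2:
  assumes "wf_tree (ctree xs)" "wf_tree (ctree ys)"
  shows "struct (ctree (xs @ ys)) (Node (ctree xs) (ctree ys)) (split2 C (obs xs) (obs ys))"
proof (cases "xs = []")
  case True
  then show ?thesis
    using struct_inv[OF struct_lun[OF assms(2)]] by (simp add: split2_def tens_obs)
next
  case False
  then show ?thesis
    using struct_split2_rev[of xs "rev ys"] assms by (simp add: split2_def rev_map)
qed

lemma struct_split_rev:
  "(\<forall>xs\<in>set xss. wf_tree (ctree xs)) \<Longrightarrow>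
    struct (ctree (concat (rev xss))) (nodes (map ctree (rev xss))) (split_rev C (map obs xss))"
proof (induction xss rule: induct_list012)
  case 1
  then show ?case using struct_id[of Empty] by simp
next
  case (2 xs)
  then show ?case using struct_id[of "ctree xs"] by (simp add: tens_obs)
next
  case (3 xs xs' xss)
  have IH: "struct (ctree (concat (rev (xs' # xss)))) (nodes (map ctree (rev (xs' # xss))))
      (split_rev C (map obs (xs' # xss)))"
    using 3 by simp
  have "struct (ctree (concat (rev (xs' # xss)) @ xs)) (Node (ctree (concat (rev (xs' # xss)))) (ctree xs))
      (split2 C (obs (concat (rev (xs' # xss)))) (obs xs))"
    using struct_wf[OF IH] 3 by (intro struct_split2) auto
  from struct_comp[OF this struct_ten[OF IH struct_id[of "ctree xs"]]]
  show ?case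
    using 3 nodes_snoc[of "map ctree (rev (xs' # xss))" "ctree xs"] by (simp add: tens_obs map_concat rev_map)
qed

lemma struct_split:
  assumes "\<forall>xs\<in>set xss. wf_tree (ctree xs)"
  shows "struct (ctree (concat xss)) (nodes (map ctree xss)) (split C (map obs xss))"
  using struct_split_rev[of "rev xss"] assms by (simp add: split_def rev_map)

lemma struct_joined:
  assumes "\<forall>xs\<in>set xss. wf_tree (ctree xs)"
  shows "struct (nodes (map ctree xss)) (ctree (concat xss)) (joined C (map obs xss))"
  unfolding joined_def by (rule struct_inv[OF struct_split[OF assms]])

lemma struct_exch:
  assumes "wf_tree (ctree (p @ [x, y] @ r))"
  shows "struct (ctree (p @ [x, y] @ r)) (ctree (p @ [y, x] @ r)) (exch C (obs p) (ob x) (ob y) (obs r))"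
proof -
  have s: "struct (ctree (p @ [x, y] @ r)) (Node (Node (ctree p) (Node (Leaf x) (Leaf y))) (ctree r))
      (split C [obs p, [ob x, ob y], obs r])"
    using struct_split[of "[p, [x, y], r]"] assms by simp
  have j: "struct (Node (Node (ctree p) (Node (Leaf y) (Leaf x))) (ctree r)) (ctree (p @ [y, x] @ r))
      (joined C [obs p, [ob y, ob x], obs r])"
    using struct_joined[of "[p, [y, x], r]"] assms by simp
  have t: "struct (Node (Node (ctree p) (Node (Leaf x) (Leaf y))) (ctree r))
      (Node (Node (ctree p) (Node (Leaf y) (Leaf x))) (ctree r))
      ((ident C (tobj (ctree p)) \<otimes> sw C (ob x) (ob y)) \<otimes> ident C (tobj (ctree r)))"
    using struct_ten[OF struct_ten[OF struct_id[of "ctree p"] struct_sw[of "Leaf x" "Leaf y"]]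
      struct_id[of "ctree r"]] assms by simp
  from struct_comp[OF struct_comp[OF s t] j]
  show ?thesis
    using struct_simps[OF s] struct_simps[OF j] struct_simps[OF t] by (simp add: exch_def tens_obs)
qed

end

section \<open>Passage between list judgements and tree derivations\<close>

context signature_interpretation
begin

lemma split_ty: "(\<lambda>(x, A). ty A) = (\<lambda>l. ty (snd l))"
  by auto

lemma ctxOs_obs: "ctxOs C M \<Gamma> = obs \<Gamma>"
  by (simp add: split_ty)

lemma den_list_arr:
  assumes "length as = n" "length As = n" "length ms = n"
    "\<And>i. i < n \<Longrightarrow> den (as ! i) (vs ! i) (As ! i) (ms ! i)"
  shows "set ms \<subseteq> Arr C" "tensM C ms \<in> Arr C" "Dom C (tensM C ms) = tobj (nodes as)"
    "Cod C (tensM C ms) = tens C (map ty As)"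
proof -
  show *: "set ms \<subseteq> Arr C"
    using denD(4)[OF assms(4)] assms(3) by (auto simp: in_set_conv_nth)
  have "map (Dom C) ms = map tobj as" "map (Cod C) ms = map ty As"
    using denD(5)[OF assms(4)] denD(6)[OF assms(4)] assms(1-3) by (auto intro!: nth_equalityI)
  then show "tensM C ms \<in> Arr C" "Dom C (tensM C ms) = tobj (nodes as)"
    "Cod C (tensM C ms) = tens C (map ty As)"
    using tensM_arr[OF *] by (simp_all add: tobj_nodes)
qed

lemma ctxO_ctree: "ctxO C M \<Gamma> = tobj (ctree \<Gamma>)"
  by (simp add: ctxO_def ctxOs_obs tens_obs del: map_eq_conv)

lemma struct_to_front:
  "wf_tree (ctree (P @ E @ [a] @ R)) \<Longrightarrow>
    struct (ctree (P @ E @ [a] @ R)) (ctree (P @ [a] @ E @ R)) (to_front C M P E a R)"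
proof (induction E arbitrary: P)
  case Nil
  then show ?case using struct_id[of "ctree (P @ [a] @ R)"] by (simp add: ctxO_ctree)
next
  case (Cons b E)
  have "struct (ctree ((P @ [b]) @ E @ [a] @ R)) (ctree ((P @ [b]) @ [a] @ E @ R))
      (to_front C M (P @ [b]) E a R)"
    using Cons.prems by (intro Cons.IH) auto
  moreover have "struct (ctree (P @ [b, a] @ E @ R)) (ctree (P @ [a, b] @ E @ R))
      (exch C (obs P) (ty (snd b)) (ty (snd a)) (obs (E @ R)))"
    using Cons.prems by (intro struct_exch) auto
  ultimately show ?case
    using struct_comp by (simp add: ctxOs_obs del: map_append)
qed

lemma struct_shuf:
  "wf_tree (ctree (P @ E)) \<Longrightarrow> mset \<Gamma> = mset E \<Longrightarrow>
    struct (ctree (P @ E)) (ctree (P @ \<Gamma>)) (shuf C M P E \<Gamma>)"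
proof (induction \<Gamma> arbitrary: P E)
  case Nil
  then show ?case using struct_id[of "ctree P"] by (simp add: ctxO_ctree)
next
  case (Cons a \<Gamma>)
  let ?F = "takeWhile (\<lambda>b. b \<noteq> a) E" and ?R = "tl (dropWhile (\<lambda>b. b \<noteq> a) E)"
  have "a \<in> set E" using Cons.prems(2) by (metis list.set_intros(1) mset_eq_setD)
  note E = remove1_split[OF this]
  have wfE: "\<forall>x\<in>set E. ty (snd x) \<in> Obj C" using Cons.prems(1) by auto
  have "struct (ctree (P @ ?F @ [a] @ ?R)) (ctree (P @ [a] @ ?F @ ?R)) (to_front C M P ?F a ?R)"
  proof (rule struct_to_front)
    show "wf_tree (ctree (P @ ?F @ [a] @ ?R))" using Cons.prems(1) E(1) by metis
  qed
  moreover have "struct (ctree ((P @ [a]) @ remove1 a E)) (ctree ((P @ [a]) @ \<Gamma>))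
      (shuf C M (P @ [a]) (remove1 a E) \<Gamma>)"
  proof (rule Cons.IH)
    show "wf_tree (ctree ((P @ [a]) @ remove1 a E))"
      using Cons.prems(1) wfE \<open>a \<in> set E\<close> notin_set_remove1 by fastforce
    show "mset \<Gamma> = mset (remove1 a E)"
      using Cons.prems(2) by (metis add_mset_remove_trivial mset.simps(2) mset_remove1)
  qed
  ultimately show ?case
    using struct_comp E by (metis append.assoc append_Cons append_Nil shuf.simps(2))
qed

text \<open>From here on it is enough to know that \<open>unshuffle\<close> is structural: on
  distinct leaves coherence determines it, whatever composite of exchanges produced it.\<close>

lemma struct_unshuffle:
  assumes "E \<in> Sf \<Gamma>s" "wf_tree (ctree (concat \<Gamma>s))"
  shows "struct (ctree E) (nodes (map ctree \<Gamma>s)) (unshuffle C M E \<Gamma>s)"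
proof -
  have m: "mset (concat \<Gamma>s) = mset E" using Sf_mset[OF assms(1)] by simp
  have "struct (ctree ([] @ E)) (ctree ([] @ concat \<Gamma>s)) (shuf C M [] E (concat \<Gamma>s))"
    using assms(2) mset_eq_setD[OF m] m by (intro struct_shuf) auto
  moreover have "struct (ctree (concat \<Gamma>s)) (nodes (map ctree \<Gamma>s)) (split C (map obs \<Gamma>s))"
    using assms(2) by (intro struct_split) auto
  ultimately have "struct (ctree E) (nodes (map ctree \<Gamma>s))
      (split C (map obs \<Gamma>s) \<cdot> shuf C M [] E (concat \<Gamma>s))"
    using struct_comp by simp
  then show ?thesis
    by (simp add: unshuffle_def split_ty)
qed

lemma struct_unshuffle2:
  assumes "E \<in> Sf [\<Gamma>, \<Delta>]" "wf_tree (ctree \<Gamma>)" "wf_tree (ctree \<Delta>)"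
  shows "struct (ctree E) (Node (ctree \<Gamma>) (ctree \<Delta>)) (unshuffle C M E [\<Gamma>, \<Delta>])"
  using struct_unshuffle[OF assms(1)] assms(2,3) by auto

text \<open>Each rule of \<open>interp\<close> with separate subcontexts is the tree rule at a node,
  precomposed with \<open>unshuffle\<close> by means of \<open>den_struct\<close>.\<close>

lemma interp_den: "interp S C M \<Gamma> v A m \<Longrightarrow> den (ctree \<Gamma>) v A m"
proof (induction rule: interp.induct)
  case (op f \<Gamma>s vs ms E)
  let ?n = "length (args S f)"
  have den: "den (ctree (\<Gamma>s ! i)) (vs ! i) (args S f ! i) (ms ! i)" if "i < ?n" for i
    using op.IH that by blast
  have "\<forall>\<Gamma>\<in>set \<Gamma>s. wf_tree (ctree \<Gamma>)"
    using denD(9)[OF den] op.hyps(2) by (metis in_set_conv_nth)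
  then have wf: "wf_tree (ctree (concat \<Gamma>s))" by auto
  have s: "struct (ctree E) (nodes (map ctree \<Gamma>s)) (unshuffle C M E \<Gamma>s)"
    by (rule struct_unshuffle[OF op.hyps(5) wf])
  have nd: "ndist (nodes (map ctree \<Gamma>s))"
    using ndist_cong[OF struct_mset[OF s]] op.hyps(6) by simp
  have "den (nodes (map ctree \<Gamma>s)) (Op f vs) (res S f) (oarr M f \<cdot> tensM C ms)"
    by (rule den_op) (use op.hyps den nd in auto)
  from den_struct[OF this s]
  show ?case
    using struct_simps[OF s] den_list_arr[of "map ctree \<Gamma>s" ?n "args S f" ms vs] den op.hyps oarr[OF op.hyps(1)]
    by (simp add: hom_iff)
next
  case (hyp A x)
  then show ?case using den_var by simp
next
  case unit_intro
  then show ?case using den_star by simp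
next
  case (unit_elim \<Gamma> v m \<Delta> w A n E)
  note D = denD[OF unit_elim.IH(1)] denD[OF unit_elim.IH(2)]
  have s: "struct (ctree E) (Node (ctree \<Gamma>) (ctree \<Delta>)) (unshuffle C M E [\<Gamma>, \<Delta>])"
    by (rule struct_unshuffle2[OF unit_elim.hyps(3)]) (use D in auto)
  have "ndist (Node (ctree \<Gamma>) (ctree \<Delta>))"
    using ndist_cong[OF struct_mset[OF s]] unit_elim.hyps(4) by simp
  from den_struct[OF den_to_star[OF unit_elim.IH this] s]
  have "den (ctree E) (ToStar v w) A ((n \<cdot> lun C (tobj (ctree \<Delta>)) \<cdot>
      (m \<otimes> ident C (tobj (ctree \<Delta>)))) \<cdot> unshuffle C M E [\<Gamma>, \<Delta>])"
    using D lun_ten[of m n] by simp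
  then show ?case
    using D struct_simps[OF s] by (simp add: ctxO_ctree)
next
  case (tensor_intro \<Gamma> v A m \<Delta> w B n E)
  note D = denD[OF tensor_intro.IH(1)] denD[OF tensor_intro.IH(2)]
  have s: "struct (ctree E) (Node (ctree \<Gamma>) (ctree \<Delta>)) (unshuffle C M E [\<Gamma>, \<Delta>])"
    by (rule struct_unshuffle2[OF tensor_intro.hyps(3)]) (use D in auto)
  have "ndist (Node (ctree \<Gamma>) (ctree \<Delta>))"
    using ndist_cong[OF struct_mset[OF s]] tensor_intro.hyps(4) by simp
  from den_struct[OF den_pair[OF tensor_intro.IH this] s] show ?case .
next
  case (tensor_elim \<Gamma> v A B m \<Delta> x y w D n E)
  note D = denD[OF tensor_elim.IH(1)] denD[OF tensor_elim.IH(2)]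
  have [simp]: "A \<in> types S" "B \<in> types S" using D(3) by auto
  have wf: "wf_tree (ctree \<Delta>)" "wt_tree (ctree \<Delta>)" using D(18,10) by (auto simp: wt_tree_def)
  have s: "struct (ctree E) (Node (ctree \<Gamma>) (ctree \<Delta>)) (unshuffle C M E [\<Gamma>, \<Delta>])"
    by (rule struct_unshuffle2[OF tensor_elim.hyps(3)]) (use D wf in auto)
  have nd: "ndist (Node (ctree \<Gamma>) (ctree \<Delta>))"
    using ndist_cong[OF struct_mset[OF s]] tensor_elim.hyps(4) by simp
  let ?x = "Leaf (x, A)" and ?y = "Leaf (y, B)"
  have j: "struct (Node (Node (ctree \<Delta>) ?x) ?y) (ctree (\<Delta> @ [(x, A), (y, B)]))
      (joined C [obs \<Delta>, [ty A], [ty B]])"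
    using struct_joined[of "[\<Delta>, [(x, A)], [(y, B)]]"] wf by simp
  have a: "struct (Node (ctree \<Delta>) (Node ?x ?y)) (Node (Node (ctree \<Delta>) ?x) ?y)
      (asc C (tobj (ctree \<Delta>)) (ty A) (ty B))"
    using struct_asc[of "ctree \<Delta>" ?x ?y] wf by simp
  have w: "struct (Node (Node ?x ?y) (ctree \<Delta>)) (Node (ctree \<Delta>) (Node ?x ?y))
      (sw C (ty A \<boxtimes> ty B) (tobj (ctree \<Delta>)))"
    using struct_sw[of "Node ?x ?y" "ctree \<Delta>"] wf by simp
  \<comment> \<open>Precomposition with \<open>joined\<close>, \<open>asc\<close> and
    \<open>sw\<close> brings the body from its list context to the bracketing with the two bound
    leaves in front, as \<open>den_pm\<close> expects.\<close>
  from den_struct[OF den_pm[OF tensor_elim.IH(1)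
      den_struct[OF den_struct[OF den_struct[OF tensor_elim.IH(2) j] a] w] nd] s]
  show ?case
    using D struct_simps[OF s] struct_simps[OF j] wf
    by (simp add: ctxO_ctree ctxOs_obs)
next
  case (lolli_intro \<Gamma> x A v B m)
  note D = denD[OF lolli_intro.IH]
  have wf: "\<forall>l\<in>set \<Gamma>. ty (snd l) \<in> Obj C" "ty A \<in> Obj C" using D(9) by auto
  have "struct (Node (ctree \<Gamma>) (Leaf (x, A))) (ctree (\<Gamma> @ [(x, A)])) (joined C [obs \<Gamma>, [ty A]])"
    using struct_joined[of "[\<Gamma>, [(x, A)]]"] wf by simp
  from den_lam[OF den_struct[OF lolli_intro.IH this]]
  show ?case by (simp add: ctxO_ctree ctxOs_obs)
next
  case (lolli_elim \<Gamma> v A B m \<Delta> w n E)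
  note D = denD[OF lolli_elim.IH(1)] denD[OF lolli_elim.IH(2)]
  have [simp]: "A \<in> types S" "B \<in> types S" using D(3) by auto
  have s: "struct (ctree E) (Node (ctree \<Gamma>) (ctree \<Delta>)) (unshuffle C M E [\<Gamma>, \<Delta>])"
    by (rule struct_unshuffle2[OF lolli_elim.hyps(3)]) (use D in auto)
  have "ndist (Node (ctree \<Gamma>) (ctree \<Delta>))"
    using ndist_cong[OF struct_mset[OF s]] lolli_elim.hyps(4) by simp
  from den_struct[OF den_ap[OF lolli_elim.IH this] s]
  show ?case using D struct_simps[OF s] by simp
qed

lemma typed_interp: "typed S \<Gamma> v A \<Longrightarrow> \<exists>m. interp S C M \<Gamma> v A m"
proof (induction rule: typed.induct)
  case (op f \<Gamma>s vs E)
  have "\<forall>i<length (args S f). \<exists>m. interp S C M (\<Gamma>s ! i) (vs ! i) (args S f ! i) m"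
    using op.IH by blast
  then obtain ms where "length ms = length (args S f)"
    "\<forall>i<length (args S f). interp S C M (\<Gamma>s ! i) (vs ! i) (args S f ! i) (ms ! i)"
    unfolding Skolem_list_nth by blast
  then show ?case using interp.op[OF op.hyps(1-3) _ _ op.hyps(4,5)] by blast
qed (blast intro: interp.intros)+

text \<open>The claim covers every ordering of the leaves, so the structural rule is immediate. In
  effect the list calculus admits exchange.\<close>

lemma den_typed: "den a v A m \<Longrightarrow> nonrep \<Gamma> \<Longrightarrow> set \<Gamma> = set (leaves a) \<Longrightarrow> typed S \<Gamma> v A"
proof (induction arbitrary: \<Gamma> rule: den.induct)
  case (den_struct a v A m b s)
  then show ?case using struct_set[OF den_struct.hyps(2)] by simp
next
  case (den_var A x)
  then obtain l \<Gamma>' where \<Gamma>: "\<Gamma> = l # \<Gamma>'" by (cases \<Gamma>) auto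
  then have "l = (x, A)" "set \<Gamma>' \<subseteq> {(x, A)}" "(x, A) \<notin> set \<Gamma>'" using den_var.prems by force+
  then have "set \<Gamma>' = {}" using subset_singletonD[of "set \<Gamma>'" "(x, A)"] by auto
  then have "\<Gamma> = [(x, A)]" using \<Gamma> \<open>l = (x, A)\<close> by simp
  then show ?case using den_var typed.hyp by simp
next
  case den_star
  then show ?case using typed.unit_intro by simp
next
  case (den_to_star a v m b w A n)
  show ?case
    by (rule typed.unit_elim[OF den_to_star.IH shuffle_filter2[OF den_to_star.prems(1) den_to_star.hyps(3)]])
      (use den_to_star.prems in \<open>auto simp: distinct_map_filter\<close>)
next
  case (den_pair a v A m b w B n)
  show ?case
    by (rule typed.tensor_intro[OF den_pair.IH shuffle_filter2[OF den_pair.prems(1) den_pair.hyps(3)]])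
      (use den_pair.prems in \<open>auto simp: distinct_map_filter\<close>)
next
  case (den_ap a v A B m b w n)
  show ?case
    by (rule typed.lolli_elim[OF den_ap.IH shuffle_filter2[OF den_ap.prems(1) den_ap.hyps(3)]])
      (use den_ap.prems in \<open>auto simp: distinct_map_filter\<close>)
next
  case (den_pm_cofinite a v A B m L b w D n)
  let ?L = "L \<union> names b \<union> fv w"
  have "finite ?L" using den_pm_cofinite.hyps by simp
  then obtain x y where xy: "x \<notin> ?L" "y \<notin> ?L" "x \<noteq> y" by (rule fresh2)
  let ?\<Delta> = "filter (\<lambda>l. l \<in> set (leaves b)) \<Gamma>"
  have D: "set ?\<Delta> = set (leaves b)" using den_pm_cofinite.prems(2) by auto
  have ndD: "nonrep ?\<Delta>" using den_pm_cofinite.prems(1) by (simp add: distinct_map_filter)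
  have "typed S (?\<Delta> @ [(x, A), (y, B)]) (opn 1 x (opn 0 y w)) D"
  proof -
    have "nonrep (?\<Delta> @ [(x, A), (y, B)])"
      using ndD xy D by auto
    moreover have "set (?\<Delta> @ [(x, A), (y, B)]) = set (leaves (Node (Node (Leaf (x, A)) (Leaf (y, B))) b))"
      using D by auto
    ultimately show ?thesis using den_pm_cofinite.IH(2) xy by blast
  qed
  then have "typed S \<Gamma> (pm v x y (opn 1 x (opn 0 y w))) D"
    by (rule typed.tensor_elim[OF den_pm_cofinite.IH(1) _ shuffle_filter2[OF den_pm_cofinite.prems(1) den_pm_cofinite.hyps(3)], rotated 2])
      (use den_pm_cofinite.prems in \<open>auto simp: distinct_map_filter\<close>)
  then show ?case using pm_opn[of x w y v] xy by simp
next
  case (den_lam_cofinite L a A v B m)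
  let ?L = "L \<union> names a \<union> fv v"
  have "finite ?L" using den_lam_cofinite.hyps by simp
  then obtain x where x: "x \<notin> ?L" by (rule fresh2)
  have "nonrep (\<Gamma> @ [(x, A)])"
    using den_lam_cofinite.prems x by auto
  moreover have "set (\<Gamma> @ [(x, A)]) = set (leaves (Node a (Leaf (x, A))))"
    using den_lam_cofinite.prems by auto
  ultimately have "typed S (\<Gamma> @ [(x, A)]) (opn 0 x v) B"
    using den_lam_cofinite.IH x by blast
  from typed.lolli_intro[OF this] show ?case using lam_opn[of x v A] x by simp
next
  case (den_op f as vs ms)
  let ?n = "length (args S f)"
  let ?\<Gamma>s = "map (\<lambda>xs. filter (\<lambda>l. l \<in> set xs) \<Gamma>) (map leaves as)"
  have sub: "set (leaves (as ! i)) \<subseteq> set \<Gamma>" if "i < ?n" for i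
  proof -
    have "as ! i \<in> set as" using that den_op.hyps(2) by simp
    then show ?thesis using den_op.prems(2) by (auto simp: leaves_nodes)
  qed
  show ?case
  proof (rule typed.op[OF den_op.hyps(1), of ?\<Gamma>s])
    show "\<forall>i<?n. typed S (?\<Gamma>s ! i) (vs ! i) (args S f ! i)"
    proof (intro allI impI)
      fix i assume i: "i < ?n"
      have "set (?\<Gamma>s ! i) = set (leaves (as ! i))" using sub[OF i] i den_op.hyps(2) by auto
      moreover have "nonrep (?\<Gamma>s ! i)"
        using den_op.prems(1) i den_op.hyps(2) by (simp add: distinct_map_filter)
      ultimately show "typed S (?\<Gamma>s ! i) (vs ! i) (args S f ! i)"
        using den_op.IH i by blast
    qed
    show "\<Gamma> \<in> Sf ?\<Gamma>s"
      by (rule shuffle_filter)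
        (use den_op.prems ndist_distinct[OF den_op.hyps(5)] in \<open>auto simp: leaves_nodes distinct_map\<close>)
  qed (use den_op.hyps den_op.prems in auto)
qed

end


section \<open>Uniqueness and soundness for the equations of the calculus\<close>

lemma in_fst_image: "(x, A) \<in> X \<Longrightarrow> x \<in> fst ` X"
  by force

text \<open>Without repeated names each name carries a single type, so equality of free variables
  can be lifted to equality of leaves.\<close>

lemma same_names_same_leaves:
  assumes "ndist t" "set (leaves a) \<subseteq> set (leaves t)" "set (leaves b) \<subseteq> set (leaves t)" "names a = names b"
  shows "set (leaves a) = set (leaves b)"
proof -
  have "set (leaves c) \<subseteq> set (leaves d)"
    if "set (leaves c) \<subseteq> set (leaves t)" "set (leaves d) \<subseteq> set (leaves t)" "names c = names d" for c d
  proof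
    fix l assume l: "l \<in> set (leaves c)"
    then have "fst l \<in> names d" using that(3) by blast
    then obtain k where k: "k \<in> set (leaves d)" "fst k = fst l" by force
    then have "snd k = snd l"
      using ndist_leaf_unique[OF assms(1), of "fst l" "snd l" "snd k"] l that(1,2)
      by (metis prod.collapse subsetD)
    then show "l \<in> set (leaves d)" using k by (metis prod.collapse)
  qed
  then show ?thesis using assms(2-4) by blast
qed

lemma nonrep_Sf:
  assumes "E \<in> Sf \<Gamma>s" "nonrep E"
  shows "nonrep (concat \<Gamma>s)"
  using ndist_cong[of "ctree E" "ctree (concat \<Gamma>s)"] Sf_mset[OF assms(1)] assms(2) by simp

section \<open>Determinacy of the tree semantics, and the equations of the calculus\<close>

context signature_interpretation
begin

lemma struct_between:
  assumes "wf_tree a" "ndist a" "ndist b" "set (leaves a) = set (leaves b)"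
  shows "\<exists>s. struct a b s"
  using assms by (intro struct_exists) (simp_all add: set_eq_iff_mset_eq_distinct[symmetric] ndist_distinct)

lemma same_leaves2:
  assumes "struct c (Node a' b') s" "set (leaves c) = set (leaves (Node a b))" "ndist (Node a b)"
    "names a' = names a" "names b' = names b"
  shows "set (leaves a') = set (leaves a)" "set (leaves b') = set (leaves b)"
  using same_names_same_leaves[OF assms(3), of a' a] same_names_same_leaves[OF assms(3), of b' b]
    struct_set[OF assms(1)] assms(2,4,5) by auto

text \<open>The two trees may differ in shape, as they do after inverting a second derivation of the
  same term; free variables force the same distribution of leaves at each node. The type belongs to
  the claim because a term such as \<open>Ap v w\<close> does not display the type of its
  argument.\<close>

theorem den_determ:
  "den a v A m \<Longrightarrow> den b v A' m' \<Longrightarrow> set (leaves b) = set (leaves a) \<Longrightarrow>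
    A' = A \<and> (\<exists>s. struct b a s \<and> m' = m \<cdot> s)"
proof (induction arbitrary: b A' m' rule: den.induct)
  case (den_struct a v A m c s)
  then have "A' = A \<and> (\<exists>s. struct b a s \<and> m' = m \<cdot> s)"
    using struct_set[OF den_struct.hyps(2)] by simp
  then obtain s1 where s1: "A' = A" "struct b a s1" "m' = m \<cdot> s1" by blast
  have "ndist c" using denD(2)[OF den.den_struct[OF den_struct.hyps]] .
  then obtain s2 where s2: "struct b c s2"
    using struct_between[of b c] denD(2,9)[OF den_struct.prems(1)] den_struct.prems(2) by blast
  \<comment> \<open>Both are structural from \<open>b\<close> to \<open>a\<close>, so coherence
    identifies them.\<close>
  have "s \<cdot> s2 = s1"
    by (rule struct_unique[OF struct_comp[OF s2 den_struct.hyps(2)] s1(2)])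
      (rule ndist_distinct[OF denD(2)[OF den_struct.prems(1)]])
  then show ?case
    using s1 s2 denD[OF den_struct.hyps(1)] struct_simps[OF s2] struct_simps[OF den_struct.hyps(2)]
    by auto
next
  case (den_var A x)
  obtain s where s: "struct b (Leaf (x, A')) s" "m' = ident C (ty A') \<cdot> s"
    using den_inversion[OF den_var.prems(1)] by (blast elim: den_headE)
  have "A' = A" using struct_set[OF s(1)] den_var.prems(2) by simp
  then show ?case using s by blast
next
  case den_star
  then show ?case using den_inversion[OF den_star.prems(1)] by (blast elim: den_headE)
next
  case (den_to_star a v m c w A n)
  obtain a' c' m1 n1 s where *: "den a' v Unit m1" "den c' w A' n1" "struct b (Node a' c') s"
    "m' = (lun C (ty A') \<cdot> (m1 \<otimes> n1)) \<cdot> s"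
    using den_inversion[OF den_to_star.prems(1)] by (blast elim: den_headE)
  note D = denD[OF *(1)] denD[OF *(2)] denD[OF den_to_star.hyps(1)] denD[OF den_to_star.hyps(2)]
  have names: "names a' = names a" "names c' = names c" using D(8,17,26,35) by auto
  note leaves = same_leaves2[OF *(3) den_to_star.prems(2) den_to_star.hyps(3) names]
  obtain s1 s2 where s1: "struct a' a s1" "m1 = m \<cdot> s1" and s2: "struct c' c s2" "n1 = n \<cdot> s2" "A' = A"
    using den_to_star.IH(1)[OF *(1) leaves(1)] den_to_star.IH(2)[OF *(2) leaves(2)] by blast
  show ?case
    using struct_comp[OF *(3) struct_ten[OF s1(1) s2(1)]] *(4) s1 s2 D
      struct_simps[OF s1(1)] struct_simps[OF s2(1)] struct_simps[OF *(3)]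
    by (intro conjI exI[of _ "(s1 \<otimes> s2) \<cdot> s"]) simp_all
next
  case (den_pair a v A m c w B n)
  obtain a' c' m1 n1 s A1 B1 where *: "A' = Tensor A1 B1" "den a' v A1 m1" "den c' w B1 n1"
    "struct b (Node a' c') s" "m' = (m1 \<otimes> n1) \<cdot> s"
    using den_inversion[OF den_pair.prems(1)] by (blast elim: den_headE)
  note D = denD[OF *(2)] denD[OF *(3)] denD[OF den_pair.hyps(1)] denD[OF den_pair.hyps(2)]
  have names: "names a' = names a" "names c' = names c" using D(8,17,26,35) by auto
  note leaves = same_leaves2[OF *(4) den_pair.prems(2) den_pair.hyps(3) names]
  obtain s1 s2 where s1: "struct a' a s1" "m1 = m \<cdot> s1" "A1 = A" and s2: "struct c' c s2" "n1 = n \<cdot> s2" "B1 = B"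
    using den_pair.IH(1)[OF *(2) leaves(1)] den_pair.IH(2)[OF *(3) leaves(2)] by blast
  show ?case
    using struct_comp[OF *(4) struct_ten[OF s1(1) s2(1)]] *(1,5) s1 s2 D
      struct_simps[OF s1(1)] struct_simps[OF s2(1)] struct_simps[OF *(4)]
    by (intro conjI exI[of _ "(s1 \<otimes> s2) \<cdot> s"]) simp_all
next
  case (den_ap a v A B m c w n)
  obtain a' c' m1 n1 s A1 where *: "den a' v (Lolli A1 A') m1" "den c' w A1 n1"
    "struct b (Node a' c') s" "m' = (app C (ty A1) (ty A') \<cdot> (m1 \<otimes> n1)) \<cdot> s"
    using den_inversion[OF den_ap.prems(1)] by (blast elim: den_headE)
  note D = denD[OF *(1)] denD[OF *(2)] denD[OF den_ap.hyps(1)] denD[OF den_ap.hyps(2)]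
  have [simp]: "A \<in> types S" "B \<in> types S" using D(21) by auto
  have names: "names a' = names a" "names c' = names c" using D(8,17,26,35) by auto
  note leaves = same_leaves2[OF *(3) den_ap.prems(2) den_ap.hyps(3) names]
  obtain s1 s2 where s1: "struct a' a s1" "m1 = m \<cdot> s1" "A1 = A" "A' = B"
    and s2: "struct c' c s2" "n1 = n \<cdot> s2"
    using den_ap.IH(1)[OF *(1) leaves(1)] den_ap.IH(2)[OF *(2) leaves(2)] by blast
  show ?case
    using struct_comp[OF *(3) struct_ten[OF s1(1) s2(1)]] *(4) s1 s2 D
      struct_simps[OF s1(1)] struct_simps[OF s2(1)] struct_simps[OF *(3)]
    by (intro conjI exI[of _ "(s1 \<otimes> s2) \<cdot> s"]) simp_all
next
  case (den_pm_cofinite a v A B m L c w D n)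
  obtain t k s where h: "den_head t (PM v w) A' k" "struct b t s" "m' = k \<cdot> s"
    using den_inversion[OF den_pm_cofinite.prems(1)] by blast
  from h(1) obtain a' A1 B1 m1 L1 c' n1 where t: "t = Node a' c'"
    and k: "k = n1 \<cdot> (m1 \<otimes> ident C (tobj c'))" and m1: "den a' v (Tensor A1 B1) m1" "finite L1"
    and n1: "\<forall>x y. x \<notin> L1 \<longrightarrow> y \<notin> L1 \<longrightarrow> x \<noteq> y \<longrightarrow>
      den (Node (Node (Leaf (x, A1)) (Leaf (y, B1))) c') (opn 1 x (opn 0 y w)) A' n1"
    by (rule den_headE(5)) (simp only: One_nat_def, blast)
  note * = m1 n1 h(2)[unfolded t] h(3)[unfolded k]
  have hyp: "\<forall>x y. x \<notin> L \<longrightarrow> y \<notin> L \<longrightarrow> x \<noteq> y \<longrightarrow>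
      den (Node (Node (Leaf (x, A)) (Leaf (y, B))) c) (opn 1 x (opn 0 y w)) D n"
    using den_pm_cofinite.IH(2) by blast
  note D = denD[OF *(1)] denD[OF den_pm_cofinite.hyps(1)]
  note P = den_PM_arr[OF *(2,3)] den_PM_arr[OF den_pm_cofinite.hyps(2) hyp]
  have names: "names a' = names a" "names c' = names c" using D(8,17) P(8,16) by auto
  note leaves = same_leaves2[OF *(4) den_pm_cofinite.prems(2) den_pm_cofinite.hyps(3) names]
  obtain s1 where s1: "struct a' a s1" "m1 = m \<cdot> s1" "A1 = A" "B1 = B"
    using den_pm_cofinite.IH(1)[OF *(1) leaves(1)] by blast
  let ?L = "L \<union> L1 \<union> names c \<union> names c'"
  have "finite ?L" using *(2) den_pm_cofinite.hyps(2) by simp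
  then obtain x y where xy: "x \<notin> ?L" "y \<notin> ?L" "x \<noteq> y" by (rule fresh2)
  let ?t = "Node (Leaf (x, A)) (Leaf (y, B))"
  have den1: "den (Node ?t c') (opn 1 x (opn 0 y w)) A' n1" using *(3) xy s1 by blast
  have "set (leaves (Node ?t c')) = set (leaves (Node ?t c))" using leaves(2) by simp
  then obtain s' where s': "A' = D" "struct (Node ?t c') (Node ?t c) s'" "n1 = n \<cdot> s'"
    using den_pm_cofinite.IH(2) xy den1 by blast
  have nd: "ndist c'" "ndist c" using denD(2)[OF den1] den_pm_cofinite.hyps(3) by auto
  obtain s2 where s2: "struct c' c s2"
    using struct_between[OF _ nd leaves(2)] P(4) by auto
  have "wf_tree ?t" using P by simp
  \<comment> \<open>The induction hypothesis yields some structural arrow between the trees with the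
    bound leaves. Coherence forces it to fix these leaves, so it can be moved out of the
    binder.\<close>
  from struct_unique[OF s'(2) struct_ten[OF struct_id[OF this] s2] ndist_distinct[OF denD(2)[OF den1]]]
  have "s' = ident C (ty A \<boxtimes> ty B) \<otimes> s2" by simp
  then show ?case
    using struct_comp[OF *(4) struct_ten[OF s1(1) s2]] *(5) s1 s'(1,3) D P
      struct_simps[OF s1(1)] struct_simps[OF s2] struct_simps[OF *(4)]
    by (intro conjI exI[of _ "(s1 \<otimes> s2) \<cdot> s"]) simp_all
next
  case (den_lam_cofinite L a A v B m)
  obtain a' m1 s B1 L1 where *: "A' = Lolli A B1" "finite L1"
    "\<forall>x. x \<notin> L1 \<longrightarrow> den (Node a' (Leaf (x, A))) (opn 0 x v) B1 m1"
    "struct b a' s" "m' = curry C (tobj a') (ty A) (ty B1) m1 \<cdot> s"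
    using den_inversion[OF den_lam_cofinite.prems(1)] by (blast elim: den_headE)
  have hyp: "\<forall>x. x \<notin> L \<longrightarrow> den (Node a (Leaf (x, A))) (opn 0 x v) B m"
    using den_lam_cofinite.IH by blast
  note P = den_Lam_arr[OF *(2,3)] den_Lam_arr[OF den_lam_cofinite.hyps(1) hyp]
  have leaves: "set (leaves a') = set (leaves a)" using struct_set[OF *(4)] den_lam_cofinite.prems(2) by simp
  have "finite (L \<union> L1)" using *(2) den_lam_cofinite.hyps by simp
  then obtain x where x: "x \<notin> L \<union> L1" by (rule fresh2)
  let ?x = "Leaf (x, A)"
  have den1: "den (Node a' ?x) (opn 0 x v) B1 m1" using *(3) x by blast
  have "set (leaves (Node a' ?x)) = set (leaves (Node a ?x))" using leaves by simp
  then obtain s' where s': "B1 = B" "struct (Node a' ?x) (Node a ?x) s'" "m1 = m \<cdot> s'"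
    using den_lam_cofinite.IH x den1 by blast
  have "den (Node a ?x) (opn 0 x v) B m" using hyp x by blast
  then have nd: "ndist a'" "ndist a" using denD(2)[OF den1] denD(2) by force+
  obtain s1 where s1: "struct a' a s1"
    using struct_between[OF _ nd leaves] P(4) by auto
  have "wf_tree ?x" using P by simp
  \<comment> \<open>As for \<open>PM\<close>: coherence isolates \<open>s1\<close> on the context,
    and naturality of currying lets it leave the abstraction.\<close>
  from struct_unique[OF s'(2) struct_ten[OF s1 struct_id[OF this]] ndist_distinct[OF denD(2)[OF den1]]]
  have "s' = s1 \<otimes> ident C (ty A)" by simp
  then have m1: "m1 = m \<cdot> (s1 \<otimes> ident C (ty A))" using s'(3) by simp
  note ar = struct_simps[OF s1] struct_simps[OF *(4)]
  have "curry C (tobj a) (ty A) (ty B) m \<cdot> s1 =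
      curry C (Dom C s1) (ty A) (ty B) (m \<cdot> (s1 \<otimes> ident C (ty A)))"
    by (rule curry_nat) (use P(7-12) ar in simp_all)
  then have "m' = (curry C (tobj a) (ty A) (ty B) m \<cdot> s1) \<cdot> s"
    unfolding *(5) m1 s'(1) using ar by simp
  also have "\<dots> = curry C (tobj a) (ty A) (ty B) m \<cdot> (s1 \<cdot> s)"
    by (rule assoc) (use P(7-12) ar in simp_all)
  finally show ?case
    using struct_comp[OF *(4) s1] *(1) s'(1) by blast
next
  case (den_op f as vs ms)
  let ?n = "length (args S f)"
  obtain as' ms' s where *: "f \<in> ops S" "A' = res S f" "length as' = ?n"
      "length vs = ?n" "length ms' = ?n"
      "\<forall>i<?n. den (as' ! i) (vs ! i) (args S f ! i) (ms' ! i)"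
      "ndist (nodes as')" "struct b (nodes as') s" "m' = (oarr M f \<cdot> tensM C ms') \<cdot> s"
    using den_inversion[OF den_op.prems(1)] by (blast elim: den_headE)
  have den: "den (as ! i) (vs ! i) (args S f ! i) (ms ! i)" if "i < ?n" for i
    using den_op.IH that by blast
  have sub: "set (leaves (as ! i)) \<subseteq> set (leaves (nodes as))" if "i < ?n" for i
  proof -
    have "as ! i \<in> set as" using that den_op.hyps by simp
    then show ?thesis by (auto simp: leaves_nodes)
  qed
  have sub': "set (leaves (as' ! i)) \<subseteq> set (leaves (nodes as))" if "i < ?n" for i
  proof -
    have "as' ! i \<in> set as'" using that *(3) by simp
    then have "set (leaves (as' ! i)) \<subseteq> set (leaves (nodes as'))" by (auto simp: leaves_nodes)
    then show ?thesis using struct_set[OF *(8)] den_op.prems(2) by simp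
  qed
  have "\<forall>i<?n. \<exists>s. struct (as' ! i) (as ! i) s \<and> ms' ! i = ms ! i \<cdot> s"
  proof (intro allI impI)
    fix i assume i: "i < ?n"
    have "names (as' ! i) = names (as ! i)" using denD(8)[OF den[OF i]] denD(8)[OF *(6)[rule_format, OF i]] by simp
    from same_names_same_leaves[OF den_op.hyps(5) sub'[OF i] sub[OF i] this]
    show "\<exists>s. struct (as' ! i) (as ! i) s \<and> ms' ! i = ms ! i \<cdot> s"
      using den_op.IH i *(6)[rule_format, OF i] by blast
  qed
  then obtain ss where ss: "length ss = ?n" "\<forall>i<?n. struct (as' ! i) (as ! i) (ss ! i) \<and> ms' ! i = ms ! i \<cdot> ss ! i"
    unfolding Skolem_list_nth by blast
  have st: "struct (nodes as') (nodes as) (tensM C ss)"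
    by (rule struct_nodes) (use ss * den_op.hyps in auto)
  have "ms' = map2 (comp C) ms ss"
    using ss *(5) den_op.hyps by (auto intro!: nth_equalityI)
  moreover have "tensM C ms \<cdot> tensM C ss = tensM C (map2 (comp C) ms ss)"
    by (rule tensM_comp) (use ss den_op.hyps denD[OF den] struct_simps in \<open>auto simp: list_all2_conv_all_nth\<close>)
  ultimately have "tensM C ms' = tensM C ms \<cdot> tensM C ss" by simp
  then show ?case
    using struct_comp[OF *(8) st] *(2,9) struct_simps[OF st] struct_simps[OF *(8)]
      den_list_arr[of as ?n "args S f" ms vs] den den_op.hyps oarr[OF *(1)]
    by (intro conjI exI[of _ "tensM C ss \<cdot> s"]) (simp_all add: hom_iff)
qed

lemma den_unique:
  assumes "den a v A m" "den a v A' m'"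
  shows "A' = A" "m' = m"
proof -
  obtain s where s: "A' = A" "struct a a s" "m' = m \<cdot> s" using den_determ[OF assms] by blast
  then show "A' = A" "m' = m"
    using struct_unique[OF s(2) struct_id] denD[OF assms(1)] by (auto dest: ndist_distinct)
qed

text \<open>Makes the description in \<open>sem\<close> meaningful: \<open>typed_interp\<close>
  gives existence, and \<open>interp_den\<close> with \<open>den_unique\<close> gives uniqueness
  over all choices of bound names.\<close>

lemma den_sem:
  assumes "den (ctree \<Gamma>) v A m"
  shows "sem S C M \<Gamma> v A = m"
proof -
  have "typed S \<Gamma> v A" using den_typed[OF assms] denD(2)[OF assms] by simp
  then obtain m' where m': "interp S C M \<Gamma> v A m'" using typed_interp by blast
  have "m'' = m" if "interp S C M \<Gamma> v A m''" for m''
    using den_unique(2)[OF assms interp_den[OF that]] .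
  with m' show ?thesis unfolding sem_def by (intro the_equality) auto
qed

lemma typed_den:
  assumes "typed S \<Gamma> v A"
  shows "den (ctree \<Gamma>) v A (sem S C M \<Gamma> v A)"
  using typed_interp[OF assms] interp_den den_sem by metis

lemma struct_ctree:
  assumes "mset \<Gamma> = mset (leaves a)" "wf_tree a"
  shows "\<exists>s. struct (ctree \<Gamma>) a s"
  using assms by (intro struct_exists) (auto simp: wf_tree_def dest: mset_eq_setD)

text \<open>Exchange and rebracketing for typed terms, so that the tree can be chosen to suit a
  computation.\<close>

lemma den_at:
  assumes "typed S \<Gamma> v A" "set \<Gamma> = set (leaves a)" "ndist a"
  shows "\<exists>m. den a v A m"
proof -
  note d = typed_den[OF assms(1)]
  have "wf_tree a" using denD(9)[OF d] assms(2) by (simp add: wf_tree_def)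
  then have "\<exists>s. struct a (ctree \<Gamma>) s"
    using assms denD(2)[OF d] by (intro struct_between) auto
  then show ?thesis using den_struct[OF d] by blast
qed

text \<open>Both terms are precomposed with the same structural arrow; hence an equation may be
  checked on any tree with the leaves of \<open>E\<close>.\<close>

lemma sound_from_tree:
  assumes "den a v A m" "den a w A m" "E \<in> Sf \<Gamma>s" "mset (concat \<Gamma>s) = mset (leaves a)"
  shows "\<exists>m. den (ctree E) v A m \<and> den (ctree E) w A m"
  using struct_ctree[of E a] den_struct[OF assms(1)] den_struct[OF assms(2)] denD(9)[OF assms(1)]
    Sf_mset[OF assms(3)] assms(4) by metis

text \<open>Equality is phrased as a common denotation, which records at the same time that both
  sides are well typed.\<close>

theorem lambda_eq_sound:
  "lambda_eq S E v w A \<Longrightarrow> \<exists>m. den (ctree E) v A m \<and> den (ctree E) w A m"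
proof (induction rule: lambda_eq.induct)
  case (beta_pm \<Gamma> v A \<Delta> w B \<Theta> x y u D E)
  let ?a = "ctree \<Gamma>" and ?b = "ctree \<Delta>" and ?c = "ctree \<Theta>"
  have nd: "nonrep (\<Gamma> @ \<Delta> @ \<Theta>)" using nonrep_Sf[OF beta_pm.hyps(4,5)] by simp
  obtain m n where m: "den ?a v A m" and n: "den ?b w B n" using beta_pm.hyps(1,2) typed_den by blast
  have "nonrep (\<Theta> @ [(x, A), (y, B)])" using denD(2)[OF typed_den[OF beta_pm.hyps(3)]] by simp
  then obtain p where p: "den (Node (Node (Leaf (x, A)) (Leaf (y, B))) ?c) u D p"
    using den_at[OF beta_pm.hyps(3), of "Node (Node (Leaf (x, A)) (Leaf (y, B))) ?c"] by auto
  note D = denD[OF m] denD[OF n] denD[OF p]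
  have xy: "x \<noteq> y" "x \<notin> vars \<Theta>" "y \<notin> vars \<Theta>" using D(20) by auto
  have types [simp]: "A \<in> types S" "B \<in> types S" "D \<in> types S" using D by auto
  let ?p = "p \<cdot> ((m \<otimes> n) \<otimes> ident C (tobj ?c))"
  have 1: "den (Node (Node ?a ?b) ?c) (pm (TPair v w) x y u) D ?p"
    by (rule den_pm[OF den_pair[OF m n] p]) (use nd in auto)
  have wf: "wf_tree ?c" using D(27) by simp
  let ?t1 = "Node (Node (Leaf (x, A)) (Leaf (y, B))) ?c" and ?t2 = "Node (Node ?a (Leaf (y, B))) ?c"
  have "den (graft (hole x ?a) ?t1) (u[v//x]) D (p \<cdot> plug (filler x m) ?t1)"
    by (rule den_subst[OF p m]) (use xy nd beta_pm.hyps(6) in \<open>auto simp: graft_hole_fresh dest: in_fst_image\<close>)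
  then have 2: "den ?t2 (u[v//x]) D (p \<cdot> ((m \<otimes> ident C (ty B)) \<otimes> ident C (tobj ?c)))"
    using xy plug_fresh[of x ?c m] wf by (simp add: graft_hole_fresh)
  \<comment> \<open>Because \<open>y \<notin> vars \<Gamma>\<close>, the second graft leaves the
    subtree \<open>?a\<close> inserted by the first one alone.\<close>
  have "den (graft (hole y ?b) ?t2) (u[v//x][w//y]) D
      ((p \<cdot> ((m \<otimes> ident C (ty B)) \<otimes> ident C (tobj ?c))) \<cdot> plug (filler y n) ?t2)"
    by (rule den_subst[OF 2 n]) (use xy nd beta_pm.hyps(6) in \<open>auto simp: graft_hole_fresh dest: in_fst_image\<close>)
  then have "den (Node (Node ?a ?b) ?c) (u[v//x][w//y]) D ?p"
    using xy plug_fresh[of y ?c n] plug_fresh[of y ?a n] wf beta_pm.hyps(6) D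
    by (simp add: graft_hole_fresh)
  from sound_from_tree[OF 1 this beta_pm.hyps(4)] show ?case by simp
next
  case (eta_pm \<Gamma> v A B \<Delta> z u D E x y)
  let ?a = "ctree \<Gamma>" and ?b = "ctree \<Delta>"
  have nd: "nonrep (\<Gamma> @ \<Delta>)" using nonrep_Sf[OF eta_pm.hyps(3,4)] by simp
  obtain m where m: "den ?a v (Tensor A B) m" using eta_pm.hyps(1) typed_den by blast
  have "nonrep (\<Delta> @ [(z, Tensor A B)])" using denD(2)[OF typed_den[OF eta_pm.hyps(2)]] by simp
  then obtain p where p: "den (Node (Leaf (z, Tensor A B)) ?b) u D p"
    using den_at[OF eta_pm.hyps(2), of "Node (Leaf (z, Tensor A B)) ?b"] by auto
  note D = denD[OF m] denD[OF p]
  have types [simp]: "A \<in> types S" "B \<in> types S" using D(3) by auto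
  let ?t = "Node (Leaf (x, A)) (Leaf (y, B))"
  \<comment> \<open>The pair of the two variables denotes an identity, so substituting it for
    \<open>z\<close> keeps the arrow \<open>p\<close>; both sides of the equation then arise from
    \<open>p\<close> and \<open>m\<close> alone.\<close>
  have t: "den ?t (TPair (Var x) (Var y)) (Tensor A B) (ident C (ty A \<boxtimes> ty B))"
    using den_pair[OF den_var[of A x] den_var[of B y]] eta_pm.hyps(5) by simp
  have "den (Node ?t ?b) (u[TPair (Var x) (Var y)//z]) D p"
    using den_subst_left[OF p t] nd eta_pm.hyps(5-7) D by simp
  from den_pm[OF m this] den_subst_left[OF p m] nd
  show ?case
    by (intro sound_from_tree[OF _ _ eta_pm.hyps(3), of "Node ?a ?b"]) auto
next
  case (beta_unit E v A)
  obtain m where m: "den (ctree E) v A m" using beta_unit typed_den by blast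
  note D = denD[OF m]
  have "den (Node Empty (ctree E)) (ToStar Star v) A (lun C (ty A) \<cdot> (ident C (unitO C) \<otimes> m))"
    using den_to_star[OF den_star m] D by simp
  from den_struct[OF this struct_inv[OF struct_lun[OF D(9)]]]
  have "den (ctree E) (ToStar Star v) A m" using D by (simp add: lun_nat reassoc[OF lun_nat])
  with m show ?case by blast
next
  case (eta_unit \<Gamma> v \<Delta> z w A E)
  let ?a = "ctree \<Gamma>" and ?b = "ctree \<Delta>"
  have nd: "nonrep (\<Gamma> @ \<Delta>)" using nonrep_Sf[OF eta_unit.hyps(3,4)] by simp
  obtain m where m: "den ?a v Unit m" using eta_unit.hyps(1) typed_den by blast
  have "nonrep (\<Delta> @ [(z, Unit)])" using denD(2)[OF typed_den[OF eta_unit.hyps(2)]] by simp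
  then obtain p where p: "den (Node (Leaf (z, Unit)) ?b) w A p"
    using den_at[OF eta_unit.hyps(2), of "Node (Leaf (z, Unit)) ?b"] by auto
  note D = denD[OF m] denD[OF p]
  have wf: "wf_tree ?b" using D(18) by simp
  have "den (Node Empty ?b) (w[Star//z]) A p"
    using den_subst_left[OF p den_star] nd D by simp
  \<comment> \<open>Substituting \<open>Star\<close> leaves an empty subtree. The inverse of
    \<open>lun\<close> removes it, and \<open>lun_ten\<close> cancels this against the
    \<open>lun\<close> of the elimination rule.\<close>
  from den_struct[OF this struct_inv[OF struct_lun[OF wf]]]
  have "den ?b (w[Star//z]) A (p \<cdot> inv_arrow C (lun C (tobj ?b)))" .
  from den_to_star[OF m this]
  have "den (Node ?a ?b) (ToStar v (w[Star//z])) A (p \<cdot> (m \<otimes> ident C (tobj ?b)))"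
    using nd D wf lun_ten[of m "p \<cdot> inv_arrow C (lun C (tobj ?b))"] by simp
  with den_subst_left[OF p m] nd show ?case
    by (intro sound_from_tree[OF _ _ eta_unit.hyps(3), of "Node ?a ?b"]) auto
next
  case (beta_lam \<Gamma> x A v B \<Delta> w E)
  let ?a = "ctree \<Gamma>" and ?b = "ctree \<Delta>"
  have nd: "nonrep (\<Gamma> @ \<Delta>)" using nonrep_Sf[OF beta_lam.hyps(3,4)] by simp
  obtain n where n: "den ?b w A n" using beta_lam.hyps(2) typed_den by blast
  have "nonrep (\<Gamma> @ [(x, A)])" using denD(2)[OF typed_den[OF beta_lam.hyps(1)]] by simp
  then obtain p where p: "den (Node ?a (Leaf (x, A))) v B p"
    using den_at[OF beta_lam.hyps(1), of "Node ?a (Leaf (x, A))"] by auto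
  note D = denD[OF n] denD[OF p]
  from den_ap[OF den_lam[OF p] n] den_subst_right[OF p n] nd D
  show ?case
    by (intro sound_from_tree[OF _ _ beta_lam.hyps(3), of "Node ?a ?b"]) (auto simp: app_curry_ten)
next
  case (eta_lam E v A B x)
  let ?a = "ctree E"
  obtain m where m: "den ?a v (Lolli A B) m" using eta_lam.hyps(1) typed_den by blast
  note D = denD[OF m]
  have types [simp]: "A \<in> types S" "B \<in> types S" using D(3) by auto
  have "den ?a (lam x A (Ap v (Var x))) (Lolli A B)
      (curry C (tobj ?a) (ty A) (ty B) (app C (ty A) (ty B) \<cdot> (m \<otimes> ident C (ty A))))"
    by (rule den_lam[OF den_ap[OF m den_var]]) (use D eta_lam.hyps(2) in auto)
  moreover have "curry C (tobj ?a) (ty A) (ty B) (app C (ty A) (ty B) \<cdot> (m \<otimes> ident C (ty A))) = m"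
    using curry_app[of "ty A" "ty B" "tobj ?a" m] D by (simp add: hom_iff)
  ultimately show ?case using m by auto
next
  case (comm_unit \<Gamma> v \<Delta> w A \<Theta> z u D E)
  let ?a = "ctree \<Gamma>" and ?b = "ctree \<Delta>" and ?c = "ctree \<Theta>"
  have nd: "nonrep (\<Gamma> @ \<Delta> @ \<Theta>)" using nonrep_Sf[OF comm_unit.hyps(4,5)] by simp
  obtain m n where m: "den ?a v Unit m" and n: "den ?b w A n" using comm_unit.hyps(1,2) typed_den by blast
  have "nonrep (\<Theta> @ [(z, A)])" using denD(2)[OF typed_den[OF comm_unit.hyps(3)]] by simp
  then obtain p where p: "den (Node (Leaf (z, A)) ?c) u D p"
    using den_at[OF comm_unit.hyps(3), of "Node (Leaf (z, A)) ?c"] by auto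
  note D = denD[OF m] denD[OF n] denD[OF p]
  have wf [simp]: "wf_tree ?a" "wf_tree ?b" "wf_tree ?c" using D(9,18,27) by auto
  let ?i = "ident C (tobj ?c)"
  have "den (Node (Node ?a ?b) ?c) (u[ToStar v w//z]) D (p \<cdot> ((lun C (ty A) \<cdot> (m \<otimes> n)) \<otimes> ?i))"
    by (rule den_subst_left[OF p den_to_star[OF m n]]) (use nd in auto)
  from den_struct[OF this struct_asc[OF wf]]
  have 1: "den (Node ?a (Node ?b ?c)) (u[ToStar v w//z]) D
      ((p \<cdot> ((lun C (ty A) \<cdot> (m \<otimes> n)) \<otimes> ?i)) \<cdot> asc C (tobj ?a) (tobj ?b) (tobj ?c))" .
  have 2: "den (Node ?a (Node ?b ?c)) (ToStar v (u[w//z])) D (lun C (ty D) \<cdot> (m \<otimes> (p \<cdot> (n \<otimes> ?i))))"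
    by (rule den_to_star[OF m den_subst_left[OF p n]]) (use nd in auto)
  \<comment> \<open>Both sides live on the tree with \<open>?a\<close> alone in front;
    \<open>lun_asc\<close> carries the unit elimination across the associator and naturality of
    \<open>lun\<close> carries it past \<open>p\<close>.\<close>
  have "(p \<cdot> ((lun C (ty A) \<cdot> (m \<otimes> n)) \<otimes> ?i)) \<cdot> asc C (tobj ?a) (tobj ?b) (tobj ?c) =
      p \<cdot> (lun C (ty A) \<otimes> ?i) \<cdot> (((m \<otimes> n) \<otimes> ?i) \<cdot> asc C (tobj ?a) (tobj ?b) (tobj ?c))"
    using D by simp
  also have "\<dots> = p \<cdot> ((lun C (ty A) \<otimes> ?i) \<cdot> asc C (unitO C) (ty A) (tobj ?c)) \<cdot> (m \<otimes> (n \<otimes> ?i))"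
    using D by (simp add: asc_nat del: interchange interchange_assoc)
  also have "\<dots> = p \<cdot> lun C (ty A \<boxtimes> tobj ?c) \<cdot> (m \<otimes> (n \<otimes> ?i))"
    using D by (simp add: lun_asc)
  also have "\<dots> = (lun C (ty D) \<cdot> (ident C (unitO C) \<otimes> p)) \<cdot> (m \<otimes> (n \<otimes> ?i))"
    using D by (simp add: lun_nat del: interchange interchange_assoc)
  also have "\<dots> = lun C (ty D) \<cdot> (m \<otimes> (p \<cdot> (n \<otimes> ?i)))"
    using D by simp
  finally show ?case
    using sound_from_tree[OF 1 _ comm_unit.hyps(4)] 2 by simp
next
  case (comm_pm \<Gamma> v A B \<Delta> x y w D \<Theta> z u F E)
  let ?a = "ctree \<Gamma>" and ?b = "ctree \<Delta>" and ?c = "ctree \<Theta>"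
  have nd: "nonrep (\<Gamma> @ \<Delta> @ \<Theta>)" using nonrep_Sf[OF comm_pm.hyps(4,5)] by simp
  obtain m where m: "den ?a v (Tensor A B) m" using comm_pm.hyps(1) typed_den by blast
  let ?t = "Node (Leaf (x, A)) (Leaf (y, B))"
  have ndt: "nonrep (\<Delta> @ [(x, A), (y, B)])" using denD(2)[OF typed_den[OF comm_pm.hyps(2)]] by simp
  then obtain n where n: "den (Node ?t ?b) w D n"
    using den_at[OF comm_pm.hyps(2), of "Node ?t ?b"] by auto
  have "nonrep (\<Theta> @ [(z, D)])" using denD(2)[OF typed_den[OF comm_pm.hyps(3)]] by simp
  then obtain p where p: "den (Node (Leaf (z, D)) ?c) u F p"
    using den_at[OF comm_pm.hyps(3), of "Node (Leaf (z, D)) ?c"] by auto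
  note D = denD[OF m] denD[OF n] denD[OF p]
  have types [simp]: "A \<in> types S" "B \<in> types S" using D(3) by auto
  have wf [simp]: "wf_tree ?a" "wf_tree ?b" "wf_tree ?c" "wf_tree ?t" using D(9,18,27) by auto
  let ?i = "ident C (tobj ?c)" and ?j = "ident C (tobj ?b)"
  have "den (Node (Node ?a ?b) ?c) (u[pm v x y w//z]) F (p \<cdot> ((n \<cdot> (m \<otimes> ?j)) \<otimes> ?i))"
    by (rule den_subst_left[OF p den_pm[OF m n]]) (use nd in auto)
  from den_struct[OF this struct_asc[OF wf(1-3)]]
  have 1: "den (Node ?a (Node ?b ?c)) (u[pm v x y w//z]) F
      ((p \<cdot> ((n \<cdot> (m \<otimes> ?j)) \<otimes> ?i)) \<cdot> asc C (tobj ?a) (tobj ?b) (tobj ?c))" .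
  have "den (Node (Node ?t ?b) ?c) (u[w//z]) F (p \<cdot> (n \<otimes> ?i))"
    by (rule den_subst_left[OF p n]) (use nd ndt comm_pm.hyps(6,7) in auto)
  from den_struct[OF this struct_asc[OF wf(4,2,3)]]
  have "den (Node ?t (Node ?b ?c)) (u[w//z]) F ((p \<cdot> (n \<otimes> ?i)) \<cdot> asc C (tobj ?t) (tobj ?b) (tobj ?c))" .
  then have 2: "den (Node ?a (Node ?b ?c)) (pm v x y (u[w//z])) F
      (((p \<cdot> (n \<otimes> ?i)) \<cdot> asc C (tobj ?t) (tobj ?b) (tobj ?c)) \<cdot> (m \<otimes> ident C (tobj (Node ?b ?c))))"
    by (intro den_pm[OF m]) (use nd in auto)
  \<comment> \<open>The associator passes \<open>m\<close> by naturality, which moves the matching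
    outside the substitution.\<close>
  have "(p \<cdot> ((n \<cdot> (m \<otimes> ?j)) \<otimes> ?i)) \<cdot> asc C (tobj ?a) (tobj ?b) (tobj ?c) =
      p \<cdot> (n \<otimes> ?i) \<cdot> (((m \<otimes> ?j) \<otimes> ?i) \<cdot> asc C (tobj ?a) (tobj ?b) (tobj ?c))"
    using D by simp
  also have "\<dots> = p \<cdot> (n \<otimes> ?i) \<cdot> asc C (tobj ?t) (tobj ?b) (tobj ?c) \<cdot> (m \<otimes> (?j \<otimes> ?i))"
    using D by (simp add: asc_nat del: interchange interchange_assoc ten_ident)
  also have "\<dots> = ((p \<cdot> (n \<otimes> ?i)) \<cdot> asc C (tobj ?t) (tobj ?b) (tobj ?c)) \<cdot> (m \<otimes> ident C (tobj (Node ?b ?c)))"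
    using D by simp
  finally show ?case
    using sound_from_tree[OF 1 _ comm_pm.hyps(4)] 2 by simp
qed

end


section \<open>Soundness and the interpretation functor\<close>

text \<open>Monotonicity comes from distributivity over the join of two comparable elements.\<close>

lemma quantale_mult_mono:
  fixes a b c d :: "'v::integral_quantale"
  assumes "a \<le> b" "c \<le> d"
  shows "a * c \<le> b * d"
proof -
  have right: "z * x \<le> z * y" if "x \<le> y" for x y z :: 'v
  proof -
    have "z * y = Sup ((*) z ` {x, y})"
      using mult_Sup_distrib[of z "{x, y}"] that by (simp add: sup_absorb2)
    then show ?thesis by (metis Sup_upper image_eqI insertI1)
  qed
  have "a * c \<le> a * d" by (rule right[OF assms(2)])
  also have "\<dots> \<le> b * d" using right[OF assms(1), of d] by (simp add: mult.commute)
  finally show ?thesis .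
qed

text \<open>Distributing in each argument turns a rule that multiplies labels into an inequality
  between distances \<open>tdist\<close>, which are suprema of labels.\<close>

lemma Sup_mult_Sup_le:
  fixes x :: "'v::integral_quantale"
  assumes "\<And>a b. a \<in> S \<Longrightarrow> b \<in> R \<Longrightarrow> a * b \<le> x"
  shows "Sup S * Sup R \<le> x"
proof -
  have "a * Sup R \<le> x" if "a \<in> S" for a
    using assms that by (auto simp: mult_Sup_distrib intro: Sup_least)
  then have "Sup R * Sup S \<le> x"
    by (auto simp: mult_Sup_distrib mult.commute intro: Sup_least)
  then show ?thesis by (simp add: mult.commute)
qed

text \<open>Integrality makes the unit the greatest element, so the natural order of a hom is the
  relation of having distance 1.\<close>

lemma unit_le_iff: "1 \<le> (a :: 'v::integral_quantale) \<longleftrightarrow> a = 1"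
  by (simp add: one_eq_top top_unique)

section \<open>Distance estimates for composites and tensors\<close>

context enriched_autonomous_category
begin

definition parallel :: "'m \<Rightarrow> 'm \<Rightarrow> bool" where
  "parallel f g \<longleftrightarrow> f \<in> Arr C \<and> g \<in> Arr C \<and> Dom C f = Dom C g \<and> Cod C f = Cod C g"

lemma hdist_ident: "f \<in> Arr C \<Longrightarrow> hdist C f f = 1"
  using hdist_refl[of f] by (simp add: hom_iff unit_le_iff)

lemma hdist_comp_le:
  assumes "q \<le> hdist C g g'" "r \<le> hdist C f f'" "parallel g g'" "parallel f f'" "Dom C g = Cod C f"
  shows "q * r \<le> hdist C (g \<cdot> f) (g' \<cdot> f')"
  using order.trans[OF quantale_mult_mono[OF assms(1,2)] hdist_comp[of f "Dom C f" "Cod C f" f' g "Cod C g" g']]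
    assms(3-5) by (simp add: parallel_def hom_iff)

lemma hdist_comp_left:
  assumes "r \<le> hdist C f f'" "parallel f f'" "g \<in> Arr C" "Dom C g = Cod C f"
  shows "r \<le> hdist C (g \<cdot> f) (g \<cdot> f')"
  using hdist_comp_le[of 1 g g r f f'] assms by (simp add: parallel_def hdist_ident)

lemma hdist_comp_right:
  assumes "r \<le> hdist C f f'" "parallel f f'" "g \<in> Arr C" "Dom C f = Cod C g"
  shows "r \<le> hdist C (f \<cdot> g) (f' \<cdot> g)"
  using hdist_comp_le[of r f f' 1 g g] assms by (simp add: parallel_def hdist_ident)

lemma hdist_ten_le:
  assumes "q \<le> hdist C g g'" "r \<le> hdist C f f'" "parallel g g'" "parallel f f'"
  shows "q * r \<le> hdist C (g \<otimes> f) (g' \<otimes> f')"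
  using order.trans[OF quantale_mult_mono[OF assms(1,2)]
      hdist_tenM[of g "Dom C g" "Cod C g" g' f "Dom C f" "Cod C f" f']]
    assms(3,4) by (simp add: parallel_def hom_iff)

lemma parallel_ten: "parallel f g \<Longrightarrow> parallel f' g' \<Longrightarrow> parallel (f \<otimes> f') (g \<otimes> g')"
  by (simp add: parallel_def)

lemma hdist_ten_ident:
  assumes "r \<le> hdist C f f'" "parallel f f'" "X \<in> Obj C"
  shows "r \<le> hdist C (f \<otimes> ident C X) (f' \<otimes> ident C X)"
    and "r \<le> hdist C (ident C X \<otimes> f) (ident C X \<otimes> f')"
  using hdist_ten_le[of r f f' 1 "ident C X" "ident C X"] hdist_ten_le[of 1 "ident C X" "ident C X" r f f']
    assms by (simp_all add: parallel_def hdist_ident)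

lemma hdist_tensM:
  assumes "length ms = length qs" "length ns = length qs"
    "\<And>i. i < length qs \<Longrightarrow> parallel (ms ! i) (ns ! i) \<and> qs ! i \<le> hdist C (ms ! i) (ns ! i)"
  shows "parallel (tensM C ms) (tensM C ns) \<and> prod_list qs \<le> hdist C (tensM C ms) (tensM C ns)"
  using assms
proof (induction qs arbitrary: ms ns rule: rev_induct)
  case Nil
  then show ?case by (simp add: parallel_def hdist_ident)
next
  case (snoc q qs)
  obtain ms' m where ms: "ms = ms' @ [m]" "length ms' = length qs"
    using snoc.prems(1) by (metis length_append_singleton length_Suc_conv_rev)
  obtain ns' n where ns: "ns = ns' @ [n]" "length ns' = length qs"
    using snoc.prems(2) by (metis length_append_singleton length_Suc_conv_rev)
  have last: "parallel m n" "q \<le> hdist C m n"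
    using snoc.prems(3)[of "length qs"] ms ns by (metis length_append_singleton lessI nth_append_length)+
  show ?case
  proof (cases "qs = []")
    case True
    then show ?thesis using last ms ns by simp
  next
    case False
    have "parallel (tensM C ms') (tensM C ns') \<and> prod_list qs \<le> hdist C (tensM C ms') (tensM C ns')"
    proof (rule snoc.IH[OF ms(2) ns(2)])
      fix i assume "i < length qs"
      then show "parallel (ms' ! i) (ns' ! i) \<and> qs ! i \<le> hdist C (ms' ! i) (ns' ! i)"
        using snoc.prems(3)[of i] ms ns by (simp add: nth_append)
    qed
    moreover have "ms' \<noteq> []" "ns' \<noteq> []" using False ms ns by auto
    ultimately show ?thesis
      using hdist_ten_le[of "prod_list qs" _ _ q m n] last ms ns by (simp add: tensM_snoc parallel_ten)
  qed
qed

end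


locale theory_model = signature_interpretation C M T
  for C :: "('o, 'm, 'v::continuous_quantale, 'z) autcat_scheme" (structure)
    and M :: "('g, 'f, 'o, 'm) assignment"
    and T :: "('g, 'f, 'v) vtheory" +
  fixes \<B> :: "'v set"
  assumes basis: "quantale_basis \<B>"
    and thy: "vlambda_theory \<B> T"
    and mod: "model T C M"
begin

text \<open>Existence of both denotations is built in, so soundness of theorems yields typability of
  their two sides as well.\<close>

definition within :: "(var \<times> 'g ty) tree \<Rightarrow> ('g, 'f) tm \<Rightarrow> 'v \<Rightarrow> ('g, 'f) tm \<Rightarrow> 'g ty \<Rightarrow> bool" where
  "within a v q w A \<longleftrightarrow> (\<exists>m n. den a v A m \<and> den a w A n \<and> q \<le> hdist C m n)"

lemma den_parallel: "den a v A m \<Longrightarrow> den a w A n \<Longrightarrow> parallel m n"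
  by (simp add: parallel_def denD)

lemma withinI: "den a v A m \<Longrightarrow> den a w A n \<Longrightarrow> q \<le> hdist C m n \<Longrightarrow> within a v q w A"
  by (auto simp: within_def)

lemma within_struct:
  assumes "within a v q w A" "struct b a s"
  shows "within b v q w A"
proof -
  obtain m n where *: "den a v A m" "den a w A n" "q \<le> hdist C m n"
    using assms(1) by (auto simp: within_def)
  show ?thesis
    by (rule withinI[OF den_struct[OF *(1) assms(2)] den_struct[OF *(2) assms(2)]
          hdist_comp_right[OF *(3) den_parallel[OF *(1,2)]]])
      (use struct_simps[OF assms(2)] denD[OF *(1)] in simp_all)
qed

lemma within_hdist:
  assumes "within (ctree \<Gamma>) v q w A" "den (ctree \<Gamma>) v A m" "den (ctree \<Gamma>) w A n"
  shows "q \<le> hdist C m n"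
  using assms den_unique(2) by (metis within_def)

lemma within_ctree2:
  assumes "within (Node (ctree \<Gamma>) (ctree \<Delta>)) v q w A" "E \<in> Sf [\<Gamma>, \<Delta>]"
  shows "within (ctree E) v q w A"
proof -
  obtain m where "den (Node (ctree \<Gamma>) (ctree \<Delta>)) v A m" using assms(1) by (auto simp: within_def)
  from struct_ctree[of E, OF _ denD(9)[OF this]] obtain s
    where "struct (ctree E) (Node (ctree \<Gamma>) (ctree \<Delta>)) s"
    using Sf_mset[OF assms(2)] by auto
  then show ?thesis using within_struct[OF assms(1)] by blast
qed

lemma within_reshape:
  assumes "within (ctree \<Gamma>) v q w A" "mset (leaves b) = mset \<Gamma>"
  shows "within b v q w A"
proof -
  obtain m where m: "den (ctree \<Gamma>) v A m" using assms(1) by (auto simp: within_def)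
  have "wf_tree b" using denD(9)[OF m] mset_eq_setD[OF assms(2)] by (simp add: wf_tree_def)
  then obtain s where "struct b (ctree \<Gamma>) s" using struct_exists[of b "ctree \<Gamma>"] assms(2) by auto
  then show ?thesis using within_struct[OF assms(1)] by blast
qed

text \<open>Labels combine in the calculus as distances do under composition and tensor; the
  remaining rules use a property of the quantale or transport along a structural arrow.\<close>

theorem vthm_sound: "vthm \<B> T \<Gamma> v q w A \<Longrightarrow> within (ctree \<Gamma>) v q w A"
proof (induction rule: vthm.induct)
  case (axm \<Gamma> v q w A)
  then have "typed T \<Gamma> v A" "typed T \<Gamma> w A" using thy by (auto simp: vlambda_theory_def)
  moreover have "q \<le> hdist C (sem T C M \<Gamma> v A) (sem T C M \<Gamma> w A)"
    using axm mod by (auto simp: model_def)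
  ultimately show ?case using withinI typed_den by blast
next
  case (eq_left \<Gamma> v w A)
  then obtain m where m: "den (ctree \<Gamma>) v A m" "den (ctree \<Gamma>) w A m" using lambda_eq_sound by blast
  then show ?case using withinI[OF m] denD(4)[OF m(1)] by (simp add: hdist_ident one_eq_top)
next
  case (eq_right \<Gamma> v w A)
  then obtain m where m: "den (ctree \<Gamma>) v A m" "den (ctree \<Gamma>) w A m" using lambda_eq_sound by blast
  then show ?case using withinI[OF m(2,1)] denD(4)[OF m(1)] by (simp add: hdist_ident one_eq_top)
next
  case (refl \<Gamma> v A)
  then obtain m where m: "den (ctree \<Gamma>) v A m" using typed_den by blast
  then show ?case using withinI[OF m m] denD(4)[OF m(1)] by (simp add: hdist_ident one_eq_top)
next
  case (trans \<Gamma> v q w A r u)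
  obtain m n p where *: "den (ctree \<Gamma>) v A m" "den (ctree \<Gamma>) w A n" "q \<le> hdist C m n"
    "den (ctree \<Gamma>) u A p" "r \<le> hdist C n p"
    using trans.IH den_unique(2) by (metis within_def)
  note D = denD[OF *(1)] denD[OF *(2)] denD[OF *(4)]
  have "hdist C m n * hdist C n p \<le> hdist C m p"
    using hdist_trans[of m "Dom C m" "Cod C m" n p] D by (simp add: hom_iff)
  then show ?case
    using withinI[OF *(1,4)] quantale_mult_mono[OF *(3,5)] by (meson order.trans)
next
  case (weak \<Gamma> v q w A r)
  then show ?case unfolding within_def by (meson order.trans)
next
  case (arch \<Gamma> v A w q)
  note d = typed_den[OF arch.hyps(1)] typed_den[OF arch.hyps(2)]
  let ?h = "hdist C (sem T C M \<Gamma> v A) (sem T C M \<Gamma> w A)"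
  have "r \<le> ?h" if "r \<in> \<B> \<inter> {r. r \<lless> q}" for r
    using arch.IH that within_hdist[OF _ d] by blast
  then have "Sup (\<B> \<inter> {r. r \<lless> q}) \<le> ?h" by (rule Sup_least)
  \<comment> \<open>The basis elements way below \<open>q\<close> have join \<open>q\<close>, so the
    bounds obtained for them give the bound for \<open>q\<close>.\<close>
  moreover have "Sup (\<B> \<inter> {r. r \<lless> q}) = q" using basis by (simp add: quantale_basis_def)
  ultimately show ?case using withinI[OF d] by simp
next
  case (join \<Gamma> v A w Q)
  note d = typed_den[OF join.hyps(1)] typed_den[OF join.hyps(2)]
  have "Sup Q \<le> hdist C (sem T C M \<Gamma> v A) (sem T C M \<Gamma> w A)"
    using join.IH within_hdist[OF _ d] by (intro Sup_least) blast
  then show ?case using withinI[OF d] by blast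
next
  case (op f \<Gamma>s vs ws qs E)
  let ?n = "length (args T f)"
  have "\<forall>i<?n. \<exists>mn. den (ctree (\<Gamma>s ! i)) (vs ! i) (args T f ! i) (fst mn) \<and>
      den (ctree (\<Gamma>s ! i)) (ws ! i) (args T f ! i) (snd mn) \<and> qs ! i \<le> hdist C (fst mn) (snd mn)"
    using op.IH by (auto simp: within_def)
  then obtain mns where mns: "length mns = ?n"
    "\<forall>i<?n. den (ctree (\<Gamma>s ! i)) (vs ! i) (args T f ! i) (fst (mns ! i)) \<and>
      den (ctree (\<Gamma>s ! i)) (ws ! i) (args T f ! i) (snd (mns ! i)) \<and>
      qs ! i \<le> hdist C (fst (mns ! i)) (snd (mns ! i))"
    unfolding Skolem_list_nth by blast
  let ?ms = "map fst mns" and ?ns = "map snd mns"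
  have ms: "den (map ctree \<Gamma>s ! i) (vs ! i) (args T f ! i) (?ms ! i)"
    and ns: "den (map ctree \<Gamma>s ! i) (ws ! i) (args T f ! i) (?ns ! i)" if "i < ?n" for i
    using mns that op.hyps by auto
  have nd: "ndist (nodes (map ctree \<Gamma>s))"
    using nonrep_Sf[OF op.hyps(6,7)] by (simp add: leaves_nodes o_def)
  have d: "den (nodes (map ctree \<Gamma>s)) (Op f vs) (res T f) (oarr M f \<cdot> tensM C ?ms)"
    "den (nodes (map ctree \<Gamma>s)) (Op f ws) (res T f) (oarr M f \<cdot> tensM C ?ns)"
    by (rule den_op; use op.hyps mns ms ns nd in simp)+
  have *: "parallel (tensM C ?ms) (tensM C ?ns) \<and> prod_list qs \<le> hdist C (tensM C ?ms) (tensM C ?ns)"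
    by (rule hdist_tensM) (use mns op.hyps den_parallel in auto)
  have "prod_list qs \<le> hdist C (oarr M f \<cdot> tensM C ?ms) (oarr M f \<cdot> tensM C ?ns)"
    by (rule hdist_comp_left)
      (use * oarr[OF op.hyps(1)] den_list_arr[of "map ctree \<Gamma>s" ?n "args T f" ?ms vs] ms mns op.hyps
        in \<open>auto simp: hom_iff\<close>)
  from withinI[OF d this] obtain s where
    "within (nodes (map ctree \<Gamma>s)) (Op f vs) (prod_list qs) (Op f ws) (res T f)"
    "struct (ctree E) (nodes (map ctree \<Gamma>s)) s"
    using struct_ctree[of E "nodes (map ctree \<Gamma>s)"] Sf_mset[OF op.hyps(6)] denD(9)[OF d(1)]
    by (auto simp: leaves_nodes o_def)
  then show ?case by (rule within_struct)
next
  case (unit_elim \<Gamma> v q w \<Delta> v' r w' A E)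
  have nd: "ndist (Node (ctree \<Gamma>) (ctree \<Delta>))" using nonrep_Sf[OF unit_elim.hyps(3,4)] by simp
  obtain m n m' n' where *: "den (ctree \<Gamma>) v Unit m" "den (ctree \<Gamma>) w Unit n" "q \<le> hdist C m n"
    "den (ctree \<Delta>) v' A m'" "den (ctree \<Delta>) w' A n'" "r \<le> hdist C m' n'"
    using unit_elim.IH by (auto simp: within_def)
  note p = den_parallel[OF *(1,2)] den_parallel[OF *(4,5)]
  show ?case
    by (rule within_ctree2[OF withinI[OF den_to_star[OF *(1,4) nd] den_to_star[OF *(2,5) nd]
          hdist_comp_left[OF hdist_ten_le[OF *(3,6) p] parallel_ten[OF p]]] unit_elim.hyps(3)])
      (use denD[OF *(1)] denD[OF *(4)] in simp_all)
next
  case (tensor_intro \<Gamma> v q w A \<Delta> v' r w' B E)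
  have nd: "ndist (Node (ctree \<Gamma>) (ctree \<Delta>))" using nonrep_Sf[OF tensor_intro.hyps(3,4)] by simp
  obtain m n m' n' where *: "den (ctree \<Gamma>) v A m" "den (ctree \<Gamma>) w A n" "q \<le> hdist C m n"
    "den (ctree \<Delta>) v' B m'" "den (ctree \<Delta>) w' B n'" "r \<le> hdist C m' n'"
    using tensor_intro.IH by (auto simp: within_def)
  show ?case
    by (rule within_ctree2[OF withinI[OF den_pair[OF *(1,4) nd] den_pair[OF *(2,5) nd]
          hdist_ten_le[OF *(3,6) den_parallel[OF *(1,2)] den_parallel[OF *(4,5)]]] tensor_intro.hyps(3)])
next
  case (tensor_elim \<Gamma> v q w A B \<Delta> x y v' r w' D E)
  have nd: "ndist (Node (ctree \<Gamma>) (ctree \<Delta>))" using nonrep_Sf[OF tensor_elim.hyps(3,4)] by simp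
  let ?t = "Node (Node (Leaf (x, A)) (Leaf (y, B))) (ctree \<Delta>)"
  have "within ?t v' r w' D" by (rule within_reshape[OF tensor_elim.IH(2)]) simp
  then obtain m n m' n' where *: "den (ctree \<Gamma>) v (Tensor A B) m" "den (ctree \<Gamma>) w (Tensor A B) n"
    "q \<le> hdist C m n" "den ?t v' D m'" "den ?t w' D n'" "r \<le> hdist C m' n'"
    using tensor_elim.IH(1) by (auto simp: within_def)
  have D: "wf_tree (ctree \<Delta>)" using denD(9)[OF *(4)] by simp
  note p = den_parallel[OF *(1,2)] den_parallel[OF *(4,5)]
  have i: "parallel (ident C (tobj (ctree \<Delta>))) (ident C (tobj (ctree \<Delta>)))"
    using D by (simp add: parallel_def del: wf_ctree)
  \<comment> \<open>The body is the outer arrow of the composite, so its label comes first;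
    commutativity restores the order of the rule.\<close>
  have "r * q \<le> hdist C (m' \<cdot> (m \<otimes> ident C (tobj (ctree \<Delta>)))) (n' \<cdot> (n \<otimes> ident C (tobj (ctree \<Delta>))))"
    by (rule hdist_comp_le[OF *(6) hdist_ten_ident(1)[OF *(3) p(1)] p(2) parallel_ten[OF p(1) i]])
      (use D denD[OF *(1)] denD[OF *(4)] in \<open>simp_all del: wf_ctree\<close>)
  then show ?case
    using within_ctree2[OF withinI[OF den_pm[OF *(1,4) nd] den_pm[OF *(2,5) nd]] tensor_elim.hyps(3)]
    by (simp add: mult.commute)
next
  case (lolli_intro \<Gamma> x A v q w B)
  let ?t = "Node (ctree \<Gamma>) (Leaf (x, A))"
  have "within ?t v q w B" by (rule within_reshape[OF lolli_intro.IH]) simp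
  then obtain m n where *: "den ?t v B m" "den ?t w B n" "q \<le> hdist C m n" by (auto simp: within_def)
  have D: "wf_tree (ctree \<Gamma>)" "A \<in> types T" using denD(1,9)[OF *(1)] by auto
  \<comment> \<open>Currying is an isometry, hence abstraction keeps the label.\<close>
  have "hdist C (curry C (tobj (ctree \<Gamma>)) (ty A) (ty B) m) (curry C (tobj (ctree \<Gamma>)) (ty A) (ty B) n) = hdist C m n"
    by (rule hdist_curry) (use D denD[OF *(1)] denD[OF *(2)] in \<open>simp_all add: hom_iff del: wf_ctree\<close>)
  then show ?case using withinI[OF den_lam[OF *(1)] den_lam[OF *(2)]] *(3) by simp
next
  case (lolli_elim \<Gamma> v q w A B \<Delta> v' r w' E)
  have nd: "ndist (Node (ctree \<Gamma>) (ctree \<Delta>))" using nonrep_Sf[OF lolli_elim.hyps(3,4)] by simp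
  obtain m n m' n' where *: "den (ctree \<Gamma>) v (Lolli A B) m" "den (ctree \<Gamma>) w (Lolli A B) n" "q \<le> hdist C m n"
    "den (ctree \<Delta>) v' A m'" "den (ctree \<Delta>) w' A n'" "r \<le> hdist C m' n'"
    using lolli_elim.IH by (auto simp: within_def)
  note p = den_parallel[OF *(1,2)] den_parallel[OF *(4,5)]
  have "A \<in> types T" "B \<in> types T" using denD(3)[OF *(1)] by auto
  then show ?case
    by (intro within_ctree2[OF withinI[OF den_ap[OF *(1,4) nd] den_ap[OF *(2,5) nd]
          hdist_comp_left[OF hdist_ten_le[OF *(3,6) p] parallel_ten[OF p]]] lolli_elim.hyps(3)])
      (use denD[OF *(1)] denD[OF *(4)] in simp_all)
next
  case (subst \<Gamma> x A v q w B \<Delta> v' r w')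
  have nd: "ndist (Node (ctree \<Gamma>) (ctree \<Delta>))" using subst.hyps(3) by simp
  let ?t = "Node (ctree \<Gamma>) (Leaf (x, A))"
  have "within ?t v q w B" by (rule within_reshape[OF subst.IH(1)]) simp
  then obtain m n m' n' where *: "den ?t v B m" "den ?t w B n"
    "q \<le> hdist C m n" "den (ctree \<Delta>) v' A m'" "den (ctree \<Delta>) w' A n'" "r \<le> hdist C m' n'"
    using subst.IH(2) by (auto simp: within_def)
  have D: "wf_tree (ctree \<Gamma>)" using denD(9)[OF *(1)] by simp
  note p = den_parallel[OF *(1,2)] den_parallel[OF *(4,5)]
  have i: "parallel (ident C (tobj (ctree \<Gamma>))) (ident C (tobj (ctree \<Gamma>)))"
    using D by (simp add: parallel_def del: wf_ctree)
  have "q * r \<le> hdist C (m \<cdot> (ident C (tobj (ctree \<Gamma>)) \<otimes> m')) (n \<cdot> (ident C (tobj (ctree \<Gamma>)) \<otimes> n'))"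
    by (rule hdist_comp_le[OF *(3) hdist_ten_ident(2)[OF *(6) p(2)] p(1) parallel_ten[OF i p(2)]])
      (use D denD[OF *(1)] denD[OF *(4)] in \<open>simp_all del: wf_ctree\<close>)
  from withinI[OF den_subst_right[OF *(1,4) nd] den_subst_right[OF *(2,5) nd] this]
  have "within (Node (ctree \<Gamma>) (ctree \<Delta>)) (v[v'//x]) (q * r) (w[w'//x]) B" .
  moreover obtain s where "struct (ctree (\<Gamma> @ \<Delta>)) (Node (ctree \<Gamma>) (ctree \<Delta>)) s"
    using struct_ctree[of "\<Gamma> @ \<Delta>" "Node (ctree \<Gamma>) (ctree \<Delta>)"] D denD(9)[OF *(4)] by auto
  ultimately show ?case by (rule within_struct)
next
  case (permute \<Gamma> v q w A \<Delta>)
  then show ?case using within_reshape[of \<Gamma> v q w A "ctree \<Delta>"] by simp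
qed

text \<open>Obtained semantically: by soundness both sides have denotations, and
  \<open>den_typed\<close> turns a denotation into a typing derivation.\<close>

lemma vthm_typed:
  assumes "vthm \<B> T \<Gamma> v q w A"
  shows "typed T \<Gamma> v A" "typed T \<Gamma> w A"
proof -
  obtain m n where "den (ctree \<Gamma>) v A m" "den (ctree \<Gamma>) w A n"
    using vthm_sound[OF assms] by (auto simp: within_def)
  then show "typed T \<Gamma> v A" "typed T \<Gamma> w A" using den_typed[of "ctree \<Gamma>"] denD(2)[of "ctree \<Gamma>"] by simp_all
qed

lemma tdist_le:
  assumes "typed T \<Gamma> v A" "typed T \<Gamma> w A"
  shows "tdist \<B> T \<Gamma> A v w \<le> hdist C (sem T C M \<Gamma> v A) (sem T C M \<Gamma> w A)"
  unfolding tdist_def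
  using within_hdist[OF vthm_sound typed_den[OF assms(1)] typed_den[OF assms(2)]] by (blast intro: Sup_least)

section \<open>The syntactic category: distances, classes and composition\<close>

lemma tdist_refl:
  assumes "typed T \<Gamma> v A"
  shows "tdist \<B> T \<Gamma> A v v = 1"
proof -
  have "top \<in> {q. vthm \<B> T \<Gamma> v q v A}" using vthm.refl[OF assms] by simp
  from Sup_upper[OF this] show ?thesis by (simp add: tdist_def one_eq_top top_unique)
qed

lemma tdist_trans: "tdist \<B> T \<Gamma> A v w * tdist \<B> T \<Gamma> A w u \<le> tdist \<B> T \<Gamma> A v u"
  unfolding tdist_def using vthm.trans by (intro Sup_mult_Sup_le Sup_upper) blast

lemma tdist_subst:
  "tdist \<B> T [(0, B)] D w w' * tdist \<B> T [(0, A)] B v v' \<le> tdist \<B> T [(0, A)] D (w[v//0]) (w'[v'//0])"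
  unfolding tdist_def
proof (intro Sup_mult_Sup_le Sup_upper CollectI, elim CollectE)
  fix q r assume "vthm \<B> T [(0, B)] w q w' D" "vthm \<B> T [(0, A)] v r v' B"
  then show "vthm \<B> T [(0, A)] (w[v//0]) (q * r) (w'[v'//0]) D"
    using vthm.subst[of \<B> T "[]" 0 B w q w' D "[(0, A)]" v r v'] by simp
qed

text \<open>The theorem rule \<open>subst\<close> applied to two reflexivities, read through
  \<open>vthm_typed\<close>, takes the place of a syntactic substitution lemma.\<close>

lemma typed_subst:
  assumes "typed T [(0, B)] w D" "typed T [(0, A)] v B"
  shows "typed T [(0, A)] (w[v//0]) D"
proof -
  have "vthm \<B> T ([] @ [(0, B)]) w top w D" using vthm.refl[OF assms(1)] by simp
  from vthm_typed(1)[OF vthm.subst[OF this vthm.refl[OF assms(2)]]] show ?thesis by simp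
qed

lemma typed_types:
  assumes "typed T [(x, A)] v B"
  shows "A \<in> types T" "B \<in> types T"
  using denD(1,3)[OF typed_den[OF assms]] by auto

lemma tdist_unit_trans:
  assumes "tdist \<B> T \<Gamma> A v w = 1" "tdist \<B> T \<Gamma> A w u = 1"
  shows "tdist \<B> T \<Gamma> A v u = 1"
  using tdist_trans[of \<Gamma> A v w u] assms by (simp add: unit_le_iff)

lemma cls_eqI:
  assumes "tdist \<B> T [(0, A)] B v w = 1" "tdist \<B> T [(0, A)] B w v = 1"
  shows "cls \<B> T A B v = cls \<B> T A B w"
proof -
  let ?d = "tdist \<B> T [(0, A)] B"
  have "?d v u = 1 \<and> ?d u v = 1 \<longleftrightarrow> ?d w u = 1 \<and> ?d u w = 1" for u
    using assms tdist_unit_trans[of "[(0, A)]" B] by blast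
  then show ?thesis by (simp add: cls_def unit_le_iff)
qed

lemma rep_cls:
  assumes "typed T [(0, A)] v B"
  shows "typed T [(0, A)] (rep (cls \<B> T A B v)) B"
    "tdist \<B> T [(0, A)] B v (rep (cls \<B> T A B v)) = 1"
    "tdist \<B> T [(0, A)] B (rep (cls \<B> T A B v)) v = 1"
proof -
  have "v \<in> snd (snd (cls \<B> T A B v))" using assms tdist_refl by (simp add: cls_def)
  then have "rep (cls \<B> T A B v) \<in> snd (snd (cls \<B> T A B v))" unfolding rep_def by (rule someI)
  then show "typed T [(0, A)] (rep (cls \<B> T A B v)) B"
    "tdist \<B> T [(0, A)] B v (rep (cls \<B> T A B v)) = 1"
    "tdist \<B> T [(0, A)] B (rep (cls \<B> T A B v)) v = 1"
    by (auto simp: cls_def unit_le_iff)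
qed

lemma cls_components [simp]:
  "fst (cls \<B> T A B v) = A" "fst (snd (cls \<B> T A B v)) = B"
  by (simp_all add: cls_def)

lemma Syn_simps [simp]:
  "Obj (Syn \<B> T) = types T"
  "Dom (Syn \<B> T) (cls \<B> T A B v) = A"
  "Cod (Syn \<B> T) (cls \<B> T A B v) = B"
  "ident (Syn \<B> T) A = cls \<B> T A A (Var 0)"
  by (simp_all add: Syn_def cls_def)

lemma Arr_Syn: "f \<in> Arr (Syn \<B> T) \<longleftrightarrow> (\<exists>A B v. typed T [(0, A)] v B \<and> f = cls \<B> T A B v)"
proof -
  have "f \<in> Arr (Syn \<B> T) \<longleftrightarrow>
      (\<exists>A B v. f = cls \<B> T A B v \<and> A \<in> types T \<and> B \<in> types T \<and> typed T [(0, A)] v B)"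
    by (simp add: Syn_def)
  then show ?thesis using typed_types by blast
qed

lemma hom_Syn: "f \<in> hom (Syn \<B> T) A B \<longleftrightarrow> (\<exists>v. typed T [(0, A)] v B \<and> f = cls \<B> T A B v)"
  by (auto simp: hom_def Arr_Syn)

lemma cls_hom: "typed T [(0, A)] v B \<Longrightarrow> cls \<B> T A B v \<in> hom (Syn \<B> T) A B"
  by (auto simp: hom_Syn)

text \<open>Each representative is at distance 1 from the given term in both directions, and
  \<open>tdist_subst\<close> multiplies these distances.\<close>

lemma comp_Syn:
  assumes "typed T [(0, A)] v B" "typed T [(0, B)] w D"
  shows "comp (Syn \<B> T) (cls \<B> T B D w) (cls \<B> T A B v) = cls \<B> T A D (w[v//0])"
proof -
  note V = rep_cls[OF assms(1)] and W = rep_cls[OF assms(2)]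
  have "comp (Syn \<B> T) (cls \<B> T B D w) (cls \<B> T A B v) =
      cls \<B> T A D ((rep (cls \<B> T B D w))[rep (cls \<B> T A B v)//0])"
    by (simp add: Syn_def)
  also have "\<dots> = cls \<B> T A D (w[v//0])"
    using tdist_subst[of B D "rep (cls \<B> T B D w)" w A "rep (cls \<B> T A B v)" v]
      tdist_subst[of B D w "rep (cls \<B> T B D w)" A v "rep (cls \<B> T A B v)"] V W
    by (intro cls_eqI) (simp_all add: unit_le_iff)
  finally show ?thesis .
qed

text \<open>The triangle inequality through representatives at distance 1, in both
  directions.\<close>

lemma hdist_Syn:
  assumes "typed T [(0, A)] v B" "typed T [(0, A)] w B"
  shows "hdist (Syn \<B> T) (cls \<B> T A B v) (cls \<B> T A B w) = tdist \<B> T [(0, A)] B v w"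
proof -
  let ?d = "tdist \<B> T [(0, A)] B" and ?v = "rep (cls \<B> T A B v)" and ?w = "rep (cls \<B> T A B w)"
  note V = rep_cls[OF assms(1)] and W = rep_cls[OF assms(2)]
  have "?d ?v ?w \<le> ?d v w"
    using order.trans[OF _ tdist_trans[of "[(0, A)]" B v ?w w], of "?d ?v ?w"]
      tdist_trans[of "[(0, A)]" B v ?v ?w] V W by simp
  moreover have "?d v w \<le> ?d ?v ?w"
    using order.trans[OF _ tdist_trans[of "[(0, A)]" B ?v w ?w], of "?d v w"]
      tdist_trans[of "[(0, A)]" B ?v v w] V W by simp
  ultimately show ?thesis by (simp add: Syn_def)
qed

lemma typed_Var: "A \<in> types T \<Longrightarrow> typed T [(x, A)] (Var x) A"
  by (rule typed.hyp)

lemma Syn_category: "enriched_category (Syn \<B> T)"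
proof
  let ?S = "Syn \<B> T"
  show "Dom ?S f \<in> Obj ?S" "Cod ?S f \<in> Obj ?S" if "f \<in> Arr ?S" for f
    using that typed_types by (auto simp: Arr_Syn)
  show "ident ?S A \<in> hom ?S A A" if "A \<in> Obj ?S" for A
    using that typed_Var by (auto intro: cls_hom)
  show "comp ?S g f \<in> hom ?S A D" if "f \<in> hom ?S A B" "g \<in> hom ?S B D" for f g A B D
    using that by (auto simp: hom_Syn comp_Syn) (blast intro: typed_subst)
  show "comp ?S (ident ?S B) f = f" if "f \<in> hom ?S A B" for f A B
    using that typed_Var typed_types by (auto simp: hom_Syn comp_Syn)
  show "comp ?S f (ident ?S A) = f" if "f \<in> hom ?S A B" for f A B
    using that typed_Var typed_types by (auto simp: hom_Syn comp_Syn subst_Var_same)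
  show "comp ?S (comp ?S h g) f = comp ?S h (comp ?S g f)"
    if "f \<in> hom ?S A B" "g \<in> hom ?S B D" "h \<in> hom ?S D E" for f g h A B D E
    using that typed_subst by (auto simp: hom_Syn comp_Syn subst_subst_same)
  show "1 \<le> hdist ?S f f" if "f \<in> hom ?S A B" for f A B
    using that by (auto simp: hom_Syn hdist_Syn tdist_refl)
  show "hdist ?S f g * hdist ?S g h \<le> hdist ?S f h"
    if "f \<in> hom ?S A B" "g \<in> hom ?S A B" "h \<in> hom ?S A B" for f g h A B
    using that by (auto simp: hom_Syn hdist_Syn intro: tdist_trans)
  show "f = g" if "f \<in> hom ?S A B" "g \<in> hom ?S A B" "1 \<le> hdist ?S f g" "1 \<le> hdist ?S g f" for f g A B
    using that by (auto simp: hom_Syn hdist_Syn unit_le_iff intro: cls_eqI)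
  show "hdist ?S g g' * hdist ?S f f' \<le> hdist ?S (comp ?S g f) (comp ?S g' f')"
    if "f \<in> hom ?S A B" "f' \<in> hom ?S A B" "g \<in> hom ?S B D" "g' \<in> hom ?S B D" for f f' g g' A B D
    using that typed_subst by (auto simp: hom_Syn hdist_Syn comp_Syn intro: tdist_subst)
qed

section \<open>The interpretation functor and strict preservation\<close>

definition interpret_arr :: "('g, 'f) synarr \<Rightarrow> 'm" where
  "interpret_arr f = sem T C M [(0, fst f)] (rep f) (fst (snd f))"

text \<open>Separatedness of the homs of \<open>C\<close> enters here: equivalent terms have
  interpretations at distance 1 both ways, hence equal ones.\<close>

lemma interpret_cls:
  assumes "typed T [(0, A)] v B"
  shows "interpret_arr (cls \<B> T A B v) = sem T C M [(0, A)] v B"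
proof -
  let ?v = "rep (cls \<B> T A B v)"
  note R = rep_cls[OF assms]
  note D = denD[OF typed_den[OF assms]] denD[OF typed_den[OF R(1)]]
  have "1 \<le> hdist C (sem T C M [(0, A)] ?v B) (sem T C M [(0, A)] v B)"
    "1 \<le> hdist C (sem T C M [(0, A)] v B) (sem T C M [(0, A)] ?v B)"
    using tdist_le[OF assms R(1)] tdist_le[OF R(1) assms] R by simp_all
  then have "sem T C M [(0, A)] ?v B = sem T C M [(0, A)] v B"
    using hdist_separated[of "sem T C M [(0, A)] ?v B" "ty A" "ty B" "sem T C M [(0, A)] v B"] D
    by (simp add: hom_iff)
  then show ?thesis by (simp add: interpret_arr_def)
qed

text \<open>Reduces a preservation law to exhibiting one tree derivation over a single leaf.\<close>

lemma interpret_den: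
  assumes "den (Leaf (0, A)) v B m"
  shows "interpret_arr (cls \<B> T A B v) = m"
proof -
  have "den (ctree [(0, A)]) v B m" using assms by simp
  moreover have "typed T [(0, A)] v B" using den_typed[OF assms] by simp
  ultimately show ?thesis using interpret_cls den_sem by simp
qed

lemma den_rep:
  assumes "f \<in> hom (Syn \<B> T) A B"
  shows "den (Leaf (0, A)) (rep f) B (interpret_arr f)" "fst f = A" "fst (snd f) = B"
proof -
  obtain v where v: "typed T [(0, A)] v B" "f = cls \<B> T A B v" using assms by (auto simp: hom_Syn)
  show "fst f = A" "fst (snd f) = B" using v by simp_all
  show "den (Leaf (0, A)) (rep f) B (interpret_arr f)"
    using typed_den[OF rep_cls(1)[OF v(1)]] v by (simp add: interpret_arr_def)
qed

theorem interpret_functor: "enriched_functor (Syn \<B> T) C (tyO C M) interpret_arr"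
  unfolding enriched_functor_def
proof (intro conjI allI impI ballI)
  let ?S = "Syn \<B> T"
  show "enriched_category ?S" by (rule Syn_category)
  show "enriched_category C" by (rule enriched_category_axioms)
  show "ty A \<in> Obj C" if "A \<in> Obj ?S" for A using that by simp
  show "interpret_arr f \<in> hom C (ty A) (ty B)" if "f \<in> hom ?S A B" for f A B
    using denD[OF den_rep(1)[OF that]] by (simp add: hom_iff)
  show "interpret_arr (ident ?S A) = ident C (ty A)" if "A \<in> Obj ?S" for A
    using interpret_den[OF den_var] that by simp
  show "interpret_arr (comp ?S g f) = interpret_arr g \<cdot> interpret_arr f"
    if "f \<in> hom ?S A B \<and> g \<in> hom ?S B D" for f g A B D
  proof -
    have f: "f \<in> hom ?S A B" and g: "g \<in> hom ?S B D" using that by auto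
    show ?thesis
      using interpret_den[OF den_subst_leaf[OF den_rep(1)[OF g] den_rep(1)[OF f]]] den_rep[OF f] den_rep[OF g]
      by (simp add: Syn_def)
  qed
  show "hdist ?S f g \<le> hdist C (interpret_arr f) (interpret_arr g)"
    if "f \<in> hom ?S A B \<and> g \<in> hom ?S A B" for f g A B
    using that tdist_le by (auto simp: hom_Syn hdist_Syn interpret_cls)
qed

text \<open>Matching with no further context: a unit is inserted and removed again by
  \<open>run\<close>, whose naturality cancels the pair. The tensor of arrows, the structure
  isomorphisms and \<open>app\<close> of the syntactic category are all terms of this form.\<close>

lemma den_pm_closed:
  assumes "den a v (Tensor A B) m" "den (Node (Leaf (x, A)) (Leaf (y, B))) w D n"
  shows "den a (pm v x y w) D (n \<cdot> m)"
proof -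
  let ?t = "Node (Leaf (x, A)) (Leaf (y, B))"
  note D = denD[OF assms(1)] denD[OF assms(2)]
  have "den (Node ?t Empty) w D (n \<cdot> run C (tobj ?t))"
    by (rule den_struct[OF assms(2) struct_run]) (use D in simp)
  from den_struct[OF den_pm[OF assms(1) this] struct_inv[OF struct_run[OF D(9)]]]
  have "den a (pm v x y w) D (((n \<cdot> run C (tobj ?t)) \<cdot> (m \<otimes> ident C (unitO C))) \<cdot> inv_arrow C (run C (tobj a)))"
    using D by simp
  moreover have "((n \<cdot> run C (tobj ?t)) \<cdot> (m \<otimes> ident C (unitO C))) \<cdot> inv_arrow C (run C (tobj a)) =
      n \<cdot> (run C (tobj ?t) \<cdot> (m \<otimes> ident C (unitO C))) \<cdot> inv_arrow C (run C (tobj a))"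
    using D by simp
  moreover have "\<dots> = n \<cdot> m"
    by (subst run_nat) (use D in simp_all)
  ultimately show ?thesis by simp
qed

theorem interpret_strict: "strictly_preserves_autonomous_structure (Syn \<B> T) C (tyO C M) interpret_arr"
  unfolding strictly_preserves_autonomous_structure_def
proof (intro conjI ballI)
  let ?S = "Syn \<B> T"
  let ?x = "\<lambda>i A. Leaf (i :: var, A :: 'g ty)"
  show "ty (unitO ?S) = unitO C" by (simp add: Syn_def)
  show "ty (tenO ?S A B) = ty A \<boxtimes> ty B" for A B by (simp add: Syn_def)
  show "ty (ihom ?S A B) = ihom C (ty A) (ty B)" for A B by (simp add: Syn_def)
  show "interpret_arr (tenM ?S f g) = interpret_arr f \<otimes> interpret_arr g" if "f \<in> Arr ?S" "g \<in> Arr ?S" for f g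
  proof -
    have "\<exists>A B. h \<in> hom ?S A B" if "h \<in> Arr ?S" for h
      using that by (simp add: hom_def)
    then obtain A B A' B' where f: "f \<in> hom ?S A B" and g: "g \<in> hom ?S A' B'"
      using \<open>f \<in> Arr ?S\<close> \<open>g \<in> Arr ?S\<close> by blast
    note F = den_rep[OF f] and G = den_rep[OF g]
    have [simp]: "A \<in> types T" "A' \<in> types T" using denD(1)[OF F(1)] denD(1)[OF G(1)] by auto
    have "den (?x 1 A) ((rep f)[Var 1//0]) B (interpret_arr f)"
      using den_subst_leaf[OF F(1) den_var[of A 1]] denD[OF F(1)] by simp
    moreover have "den (?x 2 A') ((rep g)[Var 2//0]) B' (interpret_arr g)"
      using den_subst_leaf[OF G(1) den_var[of A' 2]] denD[OF G(1)] by simp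
    ultimately have "den (Node (?x 1 A) (?x 2 A')) (TPair ((rep f)[Var 1//0]) ((rep g)[Var 2//0]))
        (Tensor B B') (interpret_arr f \<otimes> interpret_arr g)"
      by (rule den_pair) simp
    from interpret_den[OF den_pm_closed[OF den_var this, of 0]] show ?thesis
      using F(2,3) G(2,3) denD[OF F(1)] denD[OF G(1)] by (simp add: Syn_def)
  qed
  show "interpret_arr (asc ?S A B D) = asc C (ty A) (ty B) (ty D)"
    if "A \<in> Obj ?S" "B \<in> Obj ?S" "D \<in> Obj ?S" for A B D
  proof -
    have [simp]: "A \<in> types T" "B \<in> types T" "D \<in> types T" using that by simp_all
    let ?u = "TPair (TPair (Var 1) (Var 3)) (Var 4) :: ('g, 'f) tm"
    have "den (Node (Node (?x 1 A) (?x 3 B)) (?x 4 D)) ?u (Tensor (Tensor A B) D)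
        ((ident C (ty A) \<otimes> ident C (ty B)) \<otimes> ident C (ty D))"
      by (intro den_pair den_var) simp_all
    \<comment> \<open>The inner matching on name 2 needs the leaves 3 and 4 in front. The switch
      introduced here cancels against the one applied after the matching.\<close>
    from den_struct[OF den_struct[OF this struct_asc] struct_sw]
    have "den (Node (Node (?x 3 B) (?x 4 D)) (?x 1 A)) ?u (Tensor (Tensor A B) D)
        (asc C (ty A) (ty B) (ty D) \<cdot> sw C (ty B \<boxtimes> ty D) (ty A))"
      by simp
    from den_pm[OF den_var[of "Tensor B D" 2] this]
    have "den (Node (?x 2 (Tensor B D)) (?x 1 A)) (pm (Var 2) 3 4 ?u) (Tensor (Tensor A B) D)
        (asc C (ty A) (ty B) (ty D) \<cdot> sw C (ty B \<boxtimes> ty D) (ty A))"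
      by simp
    from den_struct[OF this struct_sw]
    have "den (Node (?x 1 A) (?x 2 (Tensor B D))) (pm (Var 2) 3 4 ?u) (Tensor (Tensor A B) D)
        (asc C (ty A) (ty B) (ty D))"
      by simp
    from interpret_den[OF den_pm_closed[OF den_var this, of 0]] show ?thesis by (simp add: Syn_def)
  qed
  show "interpret_arr (lun ?S A) = lun C (ty A)" if "A \<in> Obj ?S" for A
  proof -
    have [simp]: "A \<in> types T" using that by simp
    have "den (Node (?x 1 Unit) (?x 2 A)) (ToStar (Var 1) (Var 2)) A
        (lun C (ty A) \<cdot> (ident C (ty Unit) \<otimes> ident C (ty A)))"
      by (intro den_to_star den_var) simp_all
    from interpret_den[OF den_pm_closed[OF den_var this, of 0]] show ?thesis by (simp add: Syn_def)
  qed
  show "interpret_arr (run ?S A) = run C (ty A)" if "A \<in> Obj ?S" for A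
  proof -
    have [simp]: "A \<in> types T" using that by simp
    have "den (Node (?x 2 Unit) (?x 1 A)) (ToStar (Var 2) (Var 1)) A
        (lun C (ty A) \<cdot> (ident C (ty Unit) \<otimes> ident C (ty A)))"
      by (intro den_to_star den_var) simp_all
    \<comment> \<open>Names 1 and 2 occur in reversed order in the term; the switch puts them back
      and turns \<open>lun\<close> into \<open>run\<close>.\<close>
    from den_struct[OF this struct_sw]
    have "den (Node (?x 1 A) (?x 2 Unit)) (ToStar (Var 2) (Var 1)) A (run C (ty A))"
      by (simp add: lun_sw)
    from interpret_den[OF den_pm_closed[OF den_var this, of 0]] show ?thesis by (simp add: Syn_def)
  qed
  show "interpret_arr (sw ?S A B) = sw C (ty A) (ty B)" if "A \<in> Obj ?S" "B \<in> Obj ?S" for A B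
  proof -
    have [simp]: "A \<in> types T" "B \<in> types T" using that by simp_all
    have "den (Node (?x 2 B) (?x 1 A)) (TPair (Var 2) (Var 1)) (Tensor B A) (ident C (ty B) \<otimes> ident C (ty A))"
      by (intro den_pair den_var) simp_all
    from den_struct[OF this struct_sw]
    have "den (Node (?x 1 A) (?x 2 B)) (TPair (Var 2) (Var 1)) (Tensor B A) (sw C (ty A) (ty B))"
      by simp
    from interpret_den[OF den_pm_closed[OF den_var this, of 0]] show ?thesis by (simp add: Syn_def)
  qed
  show "interpret_arr (app ?S A B) = app C (ty A) (ty B)" if "A \<in> Obj ?S" "B \<in> Obj ?S" for A B
  proof -
    have [simp]: "A \<in> types T" "B \<in> types T" using that by simp_all
    have "den (Node (?x 1 (Lolli A B)) (?x 2 A)) (Ap (Var 1) (Var 2)) B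
        (app C (ty A) (ty B) \<cdot> (ident C (ty (Lolli A B)) \<otimes> ident C (ty A)))"
      by (intro den_ap den_var) simp_all
    from interpret_den[OF den_pm_closed[OF den_var this, of 0]] show ?thesis by (simp add: Syn_def)
  qed
  show "interpret_arr (curry ?S D A B f) = curry C (ty D) (ty A) (ty B) (interpret_arr f)"
    if "A \<in> Obj ?S" "B \<in> Obj ?S" "D \<in> Obj ?S" "f \<in> hom ?S (tenO ?S D A) B" for A B D f
  proof -
    have [simp]: "A \<in> types T" "B \<in> types T" "D \<in> types T" using that by simp_all
    have "f \<in> hom ?S (Tensor D A) B" using that(4) by (simp add: Syn_def)
    note F = den_rep[OF this]
    have "den (Node (?x 0 D) (?x 1 A)) (TPair (Var 0) (Var 1)) (Tensor D A) (ident C (ty D) \<otimes> ident C (ty A))"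
      by (intro den_pair den_var) simp_all
    from den_lam[OF den_subst_leaf[OF F(1) this]]
    have "den (?x 0 D) (lam 1 A ((rep f)[TPair (Var 0) (Var 1)//0])) (Lolli A B)
        (curry C (ty D) (ty A) (ty B) (interpret_arr f))"
      using denD[OF F(1)] by simp
    from interpret_den[OF this] show ?thesis by (simp add: Syn_def)
  qed
qed

end


theorem theorem3p16:
  fixes \<B> :: "'v::continuous_quantale set"
    and T :: "('g, 'f, 'v) vtheory"
    and C :: "('o, 'm, 'v) autcat"
    and M :: "('g, 'f, 'o, 'm) assignment"
  assumes "quantale_basis \<B>"
    and "vlambda_theory \<B> T"
    and "enriched_autonomous_category C"
    and "model T C M"
  shows "\<exists>F. enriched_functor (Syn \<B> T) C (tyO C M) F \<and>
             strictly_preserves_autonomous_structure (Syn \<B> T) C (tyO C M) F \<and>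
             (\<forall>A B v. typed T [(0, A)] v B \<longrightarrow>
                F (cls \<B> T A B v) = sem T C M [(0, A)] v B)"
proof -
  interpret enriched_autonomous_category C by (rule assms(3))
  interpret theory_model C M T \<B>
    by unfold_locales (use assms in \<open>auto simp: vlambda_theory_def model_def\<close>)
  show ?thesis using interpret_functor interpret_strict interpret_cls by blast
qed

end
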